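(* There is a polynomial time algorithm that, given a digraph $(V,E)$ and a set of required edges $D\subset E$, produces a transitive reduction $H$ of $E$ with required subset $D$ (i.e. $D\subseteq H\subseteq E$ and $H$ has the same transitive closure as $E$) such that $|E-H|\ge 0.5k+1$, where $k$ is the value $|E-H^*|$ for an optimum solution $H^*$ (i.e. $k$ is the maximum of $|E-A|$ over all $A$ with $D\subseteq A\subseteq E$ whose transitive closure equals that of $E$).
   Context: For a digraph $(V,E)$, the transitive closure of $E$ is the relation "$E$ contains a directed path from $u$ to $v$". Given $D\subset E$, a set $A$ is a transitive reduction of $E$ with required subset $D$ if $D\subseteq A\subseteq E$ and the transitive closures of $A$ and $E$ coincide. The problem of maximizing the number $|E-A|$ of deleted edges over such $A$ is called Max-TR$_1$.
   Formalization: The bound |E-H| ≥ 0.5k+1 is impossible for k = 0 or 1 (no solution deletes more than k edges), so it is claimed only for k ≥ 2; for k < 2 the algorithm instead outputs an optimum solution, |E-H| = k. *)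

theory Defs
  imports Complex_Main "HOL-Computational_Algebra.Polynomial"
begin

section \<open>Transitive reductions with required edges\<close>

definition digraph :: "nat set \<Rightarrow> (nat \<times> nat) set \<Rightarrow> bool" where
  "digraph V E \<longleftrightarrow> finite V \<and> E \<subseteq> V \<times> V"

definition transitive_reduction ::
  "('a \<times> 'a) set \<Rightarrow> ('a \<times> 'a) set \<Rightarrow> ('a \<times> 'a) set \<Rightarrow> bool" where
  "transitive_reduction E D A \<longleftrightarrow> D \<subseteq> A \<and> A \<subseteq> E \<and> A\<^sup>+ = E\<^sup>+"

definition max_deleted :: "('a \<times> 'a) set \<Rightarrow> ('a \<times> 'a) set \<Rightarrow> nat" where
  "max_deleted E D = Max {card (E - A) | A. transitive_reduction E D A}"

lemma card_deleted_le_max_deleted: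
  assumes "finite E" "transitive_reduction E D A"
  shows "card (E - A) \<le> max_deleted E D"
proof -
  have "{card (E - A) | A. transitive_reduction E D A} \<subseteq> (\<lambda>A. card (E - A)) ` Pow E"
    by (auto simp: transitive_reduction_def)
  then have "finite {card (E - A) | A. transitive_reduction E D A}"
    using assms(1) by (meson finite_Pow_iff finite_imageI finite_subset)
  then show ?thesis
    unfolding max_deleted_def using assms(2) by (intro Max_ge) auto
qed

text \<open>
  No feasible solution, however computed, deletes half the optimum plus one edges
  if the optimum is 0 or 1.
\<close>

lemma half_plus_one_needs_two:
  assumes "finite E" "transitive_reduction E D A"
    and "real (card (E - A)) \<ge> 0.5 * real (max_deleted E D) + 1"
  shows "max_deleted E D \<ge> 2"
proof -
  have "real (card (E - A)) \<le> real (max_deleted E D)"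
    using card_deleted_le_max_deleted[OF assms(1,2)] by simp
  with assms(3) show ?thesis by linarith
qed


section \<open>Random access machine programs\<close>

text \<open>
  Structured programs for a random access machine on natural numbers. The memory is split
  into arrays, each with infinitely many cells; a program mentions finitely many arrays, so
  this amounts to an interleaving of one memory. The arithmetic is addition and truncated
  subtraction. There is no multiplication: after t steps every value has bit length linear in
  t and the bit length of the input, so the unit-cost measure below defines the same
  polynomial time as Turing machines do.
\<close>

type_synonym state = "nat \<Rightarrow> nat \<Rightarrow> nat"

datatype aexp =
    Const nat
  | Cell nat aexp
  | Plus aexp aexp
  | Minus aexp aexp

fun aval :: "aexp \<Rightarrow> state \<Rightarrow> nat" where
  "aval (Const n) s = n"
| "aval (Cell a e) s = s a (aval e s)"
| "aval (Plus e f) s = aval e s + aval f s"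
| "aval (Minus e f) s = aval e s - aval f s"

datatype com =
    Store nat aexp aexp
  | Seq com com
  | Cond aexp com com
  | While aexp com

text \<open>
  \<open>exec c s t s'\<close>: started in \<open>s\<close>, the program \<open>c\<close> halts in \<open>s'\<close> after \<open>t\<close> assignments and tests.
\<close>

inductive exec :: "com \<Rightarrow> state \<Rightarrow> nat \<Rightarrow> state \<Rightarrow> bool" where
  Store: "exec (Store a e f) s 1 (s(a := (s a)(aval e s := aval f s)))"
| Seq: "exec c s t s' \<Longrightarrow> exec d s' u s'' \<Longrightarrow> exec (Seq c d) s (t + u) s''"
| CondTrue: "aval e s \<noteq> 0 \<Longrightarrow> exec c s t s' \<Longrightarrow> exec (Cond e c d) s (Suc t) s'"
| CondFalse: "aval e s = 0 \<Longrightarrow> exec d s t s' \<Longrightarrow> exec (Cond e c d) s (Suc t) s'"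
| WhileFalse: "aval e s = 0 \<Longrightarrow> exec (While e c) s 1 s"
| WhileTrue: "aval e s \<noteq> 0 \<Longrightarrow> exec c s t s' \<Longrightarrow> exec (While e c) s' u s''
    \<Longrightarrow> exec (While e c) s (Suc (t + u)) s''"

inductive_cases StoreE: "exec (Store a e f) s t s'"
inductive_cases SeqE: "exec (Seq c d) s t s'"
inductive_cases CondE: "exec (Cond e c d) s t s'"
inductive_cases WhileE: "exec (While e c) s t s'"

lemma exec_CondD:
  "exec (Cond e c d) s t s' \<Longrightarrow> \<exists>u. t = Suc u \<and> exec (if aval e s \<noteq> 0 then c else d) s u s'"
  by (erule CondE) simp_all

lemma exec_WhileD:
  "exec (While e c) s t s' \<Longrightarrow>
     if aval e s = 0 then t = 1 \<and> s' = s
     else \<exists>u r v. t = Suc (u + v) \<and> exec c s u r \<and> exec (While e c) r v s'"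
  by (erule WhileE) auto

lemma exec_deterministic:
  "exec c s t s' \<Longrightarrow> exec c s u s'' \<Longrightarrow> u = t \<and> s'' = s'"
proof (induction arbitrary: u s'' rule: exec.induct)
  case (Store a e f s)
  then show ?case by (auto elim: StoreE)
next
  case (Seq c s t s' d v r)
  from Seq.prems obtain t1 s1 t2 where
    *: "exec c s t1 s1" "exec d s1 t2 s''" "u = t1 + t2" by (rule SeqE)
  from Seq.IH(1)[OF *(1)] Seq.IH(2) * show ?case by simp
next
  case (CondTrue e s c t s' d)
  from exec_CondD[OF CondTrue.prems] CondTrue.hyps(1)
  obtain t1 where *: "exec c s t1 s''" "u = Suc t1" by auto
  from CondTrue.IH[OF *(1)] * show ?case by simp
next
  case (CondFalse e s d t s' c)
  from exec_CondD[OF CondFalse.prems] CondFalse.hyps(1)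
  obtain t1 where *: "exec d s t1 s''" "u = Suc t1" by auto
  from CondFalse.IH[OF *(1)] * show ?case by simp
next
  case (WhileFalse e s c)
  from exec_WhileD[OF WhileFalse.prems] WhileFalse.hyps show ?case by simp
next
  case (WhileTrue e s c t s' v r)
  from exec_WhileD[OF WhileTrue.prems] WhileTrue.hyps(1)
  obtain t1 s1 t2 where
    *: "exec c s t1 s1" "exec (While e c) s1 t2 s''" "u = Suc (t1 + t2)" by auto
  from WhileTrue.IH(1)[OF *(1)] WhileTrue.IH(2) * show ?case by simp
qed


section \<open>Input and output\<close>

definition load :: "nat list list \<Rightarrow> state" where
  "load xss = (\<lambda>a i. if a < length xss \<and> i < length (xss ! a) then xss ! a ! i else 0)"

definition input_state ::
  "nat list \<Rightarrow> (nat \<times> nat) list \<Rightarrow> (nat \<times> nat) list \<Rightarrow> state" where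
  "input_state vs es ds = load
     [[length vs, length es, length ds], vs,
      map fst es, map snd es, map fst ds, map snd ds]"

definition output_edges :: "state \<Rightarrow> (nat \<times> nat) list" where
  "output_edges s = map (\<lambda>i. (s 1 i, s 2 i)) [0..<s 0 0]"

definition list_of :: "'a list \<Rightarrow> 'a set \<Rightarrow> bool" where
  "list_of xs X \<longleftrightarrow> distinct xs \<and> set xs = X"

text \<open>
  The program has to meet the specification whichever listing of the
  vertices, edges and required edges it is given.
\<close>

definition computes_in_time ::
  "com \<Rightarrow> (nat \<Rightarrow> nat) \<Rightarrow> nat set \<Rightarrow> (nat \<times> nat) set \<Rightarrow> (nat \<times> nat) set
    \<Rightarrow> ((nat \<times> nat) set \<Rightarrow> bool) \<Rightarrow> bool" where
  "computes_in_time c T V E D Q \<longleftrightarrow>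
     (\<forall>vs es ds. list_of vs V \<longrightarrow> list_of es E \<longrightarrow> list_of ds D \<longrightarrow>
       (\<exists>t s H. exec c (input_state vs es ds) t s \<and> t \<le> T (card V + card E) \<and>
          list_of (output_edges s) H \<and> Q H))"

end

theory Submission
  imports Defs
begin

text \<open>
  Delete two edges of an optimum solution first, by trying all pairs. It then suffices to find
  some \<open>H\<close> that deletes at least half the remaining optimum, since \<open>2 + (k - 2) / 2 = k / 2 + 1\<close>.

  Add to the required edges all those that cannot be deleted even on their own. In every strong
  component pick a root, and let \<open>T\<close> be a set of edges that makes everything reachable from the
  root, with as few non-required edges as possible. An optimum solution keeps at least
  \<open>card T\<close> non-required edges. Now regard \<open>T\<close> as required and complete it in the same way to a set
  from which the root can be reached. By duality the number of edges added is the number of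
  disjoint cuts with no required edge, and each of these cuts contains at least two edges because
  each edge is deletable on its own. So at most half of the edges outside \<open>T\<close> are added. The edges
  between different strong components obey the same bound, because a needed one has a parallel
  that is not kept. If \<open>m\<close> edges are not required, at least \<open>(m - card T) / 2\<close> of them are deleted,
  while the optimum deletes at most \<open>m - card T\<close>.
\<close>

section \<open>Deleting half of the optimum\<close>

text \<open>Both phases are made instances of one task, regaining all connections of
  \<open>F\<close> (\<open>full\<close>). In phase one, free auxiliary star edges lead into the root
  of each component; with them, reaching a component from its root already means regaining it. In
  phase two all edges are reversed, and what phase one chose takes over the role of the stars: once
  everything is reachable from the root, everything reaches the root in the reversed graph
  (\<open>rooted\<close>). Minimality in phase one is obtained by a primal-dual scheme rather than a
  min-max theorem: whole cuts are added until none is left, then edges are deleted in reverse order,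
  which leaves one edge per cut. The closure in the problem asks for nonempty paths, whereas cuts
  speak of possibly empty ones. This is why \<open>covers\<close> and \<open>full\<close> coexist;
  loops are the only difference. The pairs deleted at the start may consist of the same edge twice.
  This settles an optimum of 1, where no two edges can be deleted. On the machine side, all loops
  run for \<open>2 m\<close> rounds, \<open>m\<close> being the number of edges, so that a
  polynomial time bound can be read off the syntax.\<close>

lemma rtrancl_crossing:
  assumes "(x, y) \<in> r\<^sup>*" "\<not> P x" "P y"
  shows "\<exists>u v. (x, u) \<in> r\<^sup>* \<and> (u, v) \<in> r \<and> (v, y) \<in> r\<^sup>* \<and> \<not> P u \<and> P v"
  using assms
proof (induction rule: converse_rtrancl_induct)
  case (step x z)
  show ?case
  proof (cases "P z")
    case True
    then show ?thesis using step by blast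
  next
    case False
    then obtain u v where "(z, u) \<in> r\<^sup>*" "(u, v) \<in> r" "(v, y) \<in> r\<^sup>*" "\<not> P u" "P v"
      using step by blast
    then show ?thesis using step(1) by (meson converse_rtrancl_into_rtrancl)
  qed
qed simp

definition prune :: "('a set \<Rightarrow> bool) \<Rightarrow> 'a \<Rightarrow> 'a set \<Rightarrow> 'a set" where
  "prune ok e P = (if ok (P - {e}) then P - {e} else P)"

text \<open>By monotonicity, an edge that could not be spared when it was tried cannot be spared
  after further deletions either. So a single pass already gives a minimal set.\<close>

lemma fold_prune:
  fixes es :: "'a list"
  assumes mono: "mono ok" and "ok P"
  defines "Q \<equiv> fold (prune ok) es P"
  shows "Q \<subseteq> P" "P - set es \<subseteq> Q" "ok Q" "e \<in> set es \<Longrightarrow> e \<in> Q \<Longrightarrow> \<not> ok (Q - {e})"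
proof -
  have "fold (prune ok) es P \<subseteq> P \<and> P - set es \<subseteq> fold (prune ok) es P \<and>
    ok (fold (prune ok) es P) \<and>
    (\<forall>e\<in>set es \<inter> fold (prune ok) es P. \<not> ok (fold (prune ok) es P - {e}))"
    using \<open>ok P\<close>
  proof (induction es arbitrary: P)
    case (Cons a es)
    let ?P = "prune ok a P"
    let ?R = "fold (prune ok) es ?P"
    have P: "?P \<subseteq> P" "P - {a} \<subseteq> ?P" "ok ?P" using Cons.prems by (auto simp: prune_def)
    note IH = Cons.IH[OF P(3)]
    have "\<not> ok (?R - {a})" if "a \<in> ?R"
    proof
      assume "ok (?R - {a})"
      moreover have "?R - {a} \<subseteq> P - {a}" using IH P(1) by blast
      ultimately have "ok (P - {a})" using monoD[OF mono] by auto
      then have "a \<notin> ?P" by (simp add: prune_def)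
      with that IH show False by blast
    qed
    with IH P show ?case by auto
  qed simp
  then show "Q \<subseteq> P" "P - set es \<subseteq> Q" "ok Q" "e \<in> set es \<Longrightarrow> e \<in> Q \<Longrightarrow> \<not> ok (Q - {e})"
    by (auto simp: Q_def)
qed

text \<open>Edges are abstract indices with two end maps. Sets of edges can then contain auxiliary
  edges next to genuine ones, keep their cardinality when ends coincide, and are reversed by
  swapping the maps.\<close>

definition arc_rel :: "('e \<Rightarrow> 'v) \<Rightarrow> ('e \<Rightarrow> 'v) \<Rightarrow> 'e set \<Rightarrow> ('v \<times> 'v) set" where
  "arc_rel src dst P = (\<lambda>i. (src i, dst i)) ` P"

lemma arc_rel_converse: "(arc_rel src dst P)\<inverse> = arc_rel dst src P"
  by (auto simp: arc_rel_def)

lemma arc_rel_cong: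
  "(\<And>i. i \<in> P \<Longrightarrow> src i = src' i \<and> dst i = dst' i) \<Longrightarrow> arc_rel src dst P = arc_rel src' dst' P"
  by (simp add: arc_rel_def)

section \<open>Connectivity, strong components and cuts of a directed multigraph\<close>

locale network =
  fixes src dst :: "'e \<Rightarrow> 'v" and F :: "'e set"
  assumes finite_F: "finite F"
begin

abbreviation arcs :: "'e set \<Rightarrow> ('v \<times> 'v) set" where
  "arcs \<equiv> arc_rel src dst"

lemmas arcs_def = arc_rel_def[of src dst]

abbreviation conn :: "'e set \<Rightarrow> 'v \<Rightarrow> 'v \<Rightarrow> bool" where
  "conn P x y \<equiv> (x, y) \<in> (arcs P)\<^sup>*"

abbreviation strong :: "'v \<Rightarrow> 'v \<Rightarrow> bool" where
  "strong x y \<equiv> conn F x y \<and> conn F y x"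

definition full :: "'e set \<Rightarrow> bool" where
  "full P \<longleftrightarrow> arcs F \<subseteq> (arcs P)\<^sup>*"

definition covers :: "'e set \<Rightarrow> bool" where
  "covers P \<longleftrightarrow> arcs F \<subseteq> (arcs P)\<^sup>+"

text \<open>These are the edges between different strong components, not bridges in the usual sense
  of graph theory.\<close>

definition bridges :: "'e set" where
  "bridges = {i \<in> F. \<not> conn F (dst i) (src i)}"

text \<open>With one vertex that the whole component reaches, the only thing that can still be
  missing inside the component is a path away from that vertex.\<close>

definition rooted :: "'e set \<Rightarrow> bool" where
  "rooted Z \<longleftrightarrow> (\<forall>y. \<exists>r. strong y r \<and> (\<forall>u. strong y u \<longrightarrow> conn Z u r))"

text \<open>The edge \<open>j\<close> enters a source among the strong components of \<open>Z\<close> inside one strong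
  component of \<open>F\<close>; \<open>cutset Z j\<close> is the set of all edges that enter this source.\<close>

definition cut_at :: "'e set \<Rightarrow> 'e \<Rightarrow> bool" where
  "cut_at Z j \<longleftrightarrow> j \<in> F \<and> conn F (dst j) (src j) \<and> \<not> conn Z (src j) (dst j) \<and>
     (\<forall>u. conn Z u (dst j) \<longrightarrow> conn F (dst j) u \<longrightarrow> conn Z (dst j) u)"

definition cutset :: "'e set \<Rightarrow> 'e \<Rightarrow> 'e set" where
  "cutset Z j = {i \<in> F. conn F (dst j) (src i) \<and> conn Z (dst i) (dst j) \<and> \<not> conn Z (src i) (dst j)}"

lemma arcs_mono: "P \<subseteq> Q \<Longrightarrow> arcs P \<subseteq> arcs Q"
  by (auto simp: arcs_def)

lemma arcs_Un: "arcs (P \<union> Q) = arcs P \<union> arcs Q"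
  by (auto simp: arcs_def)

lemma conn_mono: "P \<subseteq> Q \<Longrightarrow> conn P x y \<Longrightarrow> conn Q x y"
  by (meson arcs_mono rtrancl_mono subsetD)

lemma conn_arc: "i \<in> P \<Longrightarrow> conn P (src i) (dst i)"
  by (auto simp: arcs_def)

lemma full_conn: "full P \<Longrightarrow> conn F x y \<Longrightarrow> conn P x y"
  unfolding full_def using rtrancl_subset_rtrancl by blast

lemma full_mono: "P \<subseteq> Q \<Longrightarrow> full P \<Longrightarrow> full Q"
  unfolding full_def by (meson arcs_mono order_trans rtrancl_mono)

lemma covers_mono: "P \<subseteq> Q \<Longrightarrow> covers P \<Longrightarrow> covers Q"
  unfolding covers_def by (meson arcs_mono order_trans trancl_mono_subset)

lemma mono_covers: "mono covers"
  by (rule monoI) (auto intro: covers_mono)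

lemma covers_full: "covers P \<Longrightarrow> full P"
  unfolding covers_def full_def by (auto dest: trancl_into_rtrancl)

text \<open>\<open>Z\<close> may contain star edges outside \<open>F\<close>. Instead of
  \<open>Z \<subseteq> F\<close> it is only assumed that these create no connection that
  \<open>F\<close> does not have.\<close>

lemma conn_F_if: "arcs Z \<subseteq> (arcs F)\<^sup>* \<Longrightarrow> conn Z x y \<Longrightarrow> conn F x y"
  using rtrancl_subset_rtrancl by blast

lemma full_iff: "full P \<longleftrightarrow> (\<forall>i\<in>F. conn P (src i) (dst i))"
  by (auto simp: full_def arcs_def)

lemma full_transfer:
  assumes "full Q" "\<And>i. i \<in> Q \<Longrightarrow> conn P (src i) (dst i)"
  shows "full P"
proof -
  have "arcs Q \<subseteq> (arcs P)\<^sup>*" using assms(2) by (auto simp: arcs_def)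
  then show ?thesis using assms(1) unfolding full_def using rtrancl_subset_rtrancl by blast
qed

lemma cut_self: "cut_at Z j \<Longrightarrow> j \<in> cutset Z j"
  by (auto simp: cut_at_def cutset_def)

lemma cut_disjoint: "cutset Z j \<inter> Z = {}"
proof -
  have False if "i \<in> cutset Z j" "i \<in> Z" for i
  proof -
    have "conn Z (src i) (dst i)" using that(2) by (rule conn_arc)
    then show False using that(1) by (auto simp: cutset_def dest: rtrancl_trans)
  qed
  then show ?thesis by blast
qed

text \<open>The set of vertices that reach the head of \<open>j\<close> in \<open>Z\<close> is
  closed under predecessors in \<open>Z\<close>, so a path into it from outside has to enter by an
  edge of \<open>A\<close>.\<close>

lemma cut_crossing:
  assumes sub: "arcs Z \<subseteq> (arcs F)\<^sup>*" and "A \<subseteq> F"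
    and xy: "conn (Z \<union> A) x (dst j)" "conn F (dst j) x" "\<not> conn Z x (dst j)"
  shows "A \<inter> cutset Z j \<noteq> {}"
proof -
  obtain u v where uv: "conn (Z \<union> A) x u" "(u, v) \<in> arcs (Z \<union> A)"
    "\<not> conn Z u (dst j)" "conn Z v (dst j)"
    using rtrancl_crossing[OF xy(1), of "\<lambda>v. conn Z v (dst j)"] xy(3) by auto
  have "arcs (Z \<union> A) \<subseteq> (arcs F)\<^sup>*" using sub arcs_mono[OF \<open>A \<subseteq> F\<close>] by (auto simp: arcs_Un)
  then have u: "conn F (dst j) u" using uv(1) xy(2) conn_F_if by (meson rtrancl_trans)
  obtain i where i: "i \<in> Z \<union> A" "u = src i" "v = dst i" using uv(2) by (auto simp: arcs_def)
  have "i \<notin> Z" using uv(3,4) i conn_arc by (metis rtrancl_trans)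
  then show ?thesis using i uv u \<open>A \<subseteq> F\<close> by (auto simp: cutset_def)
qed

text \<open>This is the source of all lower bounds: a feasible completion contains an edge of every
  cut.\<close>

lemma cut_hit:
  assumes "cut_at Z j" "arcs Z \<subseteq> (arcs F)\<^sup>*" "A \<subseteq> F" "full (Z \<union> A)"
  shows "A \<inter> cutset Z j \<noteq> {}"
proof -
  have "j \<in> F" using assms(1) by (simp add: cut_at_def)
  then have "conn (Z \<union> A) (src j) (dst j)" using assms(4) by (simp add: full_iff)
  with assms show ?thesis by (intro cut_crossing) (auto simp: cut_at_def)
qed

text \<open>All edges of a cut enter the same source of \<open>Z\<close>, and every vertex of the
  component reaches the root. One entering edge that the root can reach therefore replaces all the
  others.\<close>

lemma single_cut_edge:
  assumes cut: "cut_at Z j" and sub: "arcs Z \<subseteq> (arcs F)\<^sup>*" and rooted: "rooted Z"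
    and K: "K \<subseteq> cutset Z j" and T: "T \<subseteq> F" "T \<inter> cutset Z j = {}" and full: "full (Z \<union> T \<union> K)"
  shows "\<exists>e\<in>K. full (Z \<union> T \<union> {e})"
proof -
  let ?y = "dst j"
  obtain r where r: "strong ?y r" "\<And>u. strong ?y u \<Longrightarrow> conn Z u r"
    using rooted by (auto simp: rooted_def)
  have strong_src: "strong ?y (src i)" if "i \<in> cutset Z j" for i
    using that conn_arc[of i F] conn_F_if[OF sub] by (auto simp: cutset_def intro: rtrancl_trans)
  \<comment> \<open>Otherwise the tail of \<open>j\<close> would reach its head by way of the
    root.\<close>
  have nr: "\<not> conn Z r ?y"
    using r(2)[OF strong_src[OF cut_self[OF cut]]] cut
    by (auto simp: cut_at_def dest: rtrancl_trans)
  then have no: "\<not> conn (Z \<union> T) r ?y"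
    using cut_crossing[OF sub T(1), of r j] r T(2) by blast
  have "conn (Z \<union> T \<union> K) r ?y" using full_conn[OF full] r by blast
  \<comment> \<open>The path from the root is followed up to its first edge in
    \<open>K\<close>.\<close>
  then have "conn (Z \<union> T) r ?y \<or> (\<exists>e\<in>K. conn (Z \<union> T) r (src e))"
  proof (induction rule: rtrancl_induct)
    case (step v w)
    then obtain i where "i \<in> Z \<union> T \<union> K" "v = src i" "w = dst i" by (auto simp: arcs_def)
    then show ?case using step.IH conn_arc[of i "Z \<union> T"] by (auto intro: rtrancl_trans)
  qed simp
  then obtain e where e: "e \<in> K" "conn (Z \<union> T) r (src e)" using no by blast
  let ?P = "Z \<union> T \<union> {e}"
  have ZP: "conn Z u v \<Longrightarrow> conn ?P u v" for u v by (rule conn_mono) auto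
  have "conn ?P r (src e)" using e(2) by (rule conn_mono[rotated]) auto
  moreover have "conn ?P (src e) (dst e)" by (rule conn_arc) simp
  moreover have "conn Z (dst e) ?y" using e(1) K by (auto simp: cutset_def)
  ultimately have ry: "conn ?P r ?y" using ZP by (meson rtrancl_trans)
  \<comment> \<open>An edge of \<open>K\<close> is bypassed by going from its tail to the root, from
    there through \<open>e\<close> to \<open>?y\<close>, and on to its head within the
    source.\<close>
  have "conn ?P (src i) (dst i)" if "i \<in> Z \<union> T \<union> K" for i
  proof (cases "i \<in> K")
    case True
    then have i: "i \<in> cutset Z j" using K by blast
    have "conn F ?y (dst i)" using i conn_arc[of i F] by (auto simp: cutset_def intro: rtrancl_trans)
    then have "conn Z ?y (dst i)" using i cut by (auto simp: cutset_def cut_at_def)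
    with ry ZP r(2)[OF strong_src[OF i]] show ?thesis by (meson rtrancl_trans)
  qed (use that in \<open>auto intro: conn_arc\<close>)
  then have "full ?P" using full full_transfer by blast
  with e(1) show ?thesis by blast
qed

text \<open>If something is missing, some root fails to reach part of its component. Among the
  unreached vertices, one with the fewest ancestors lies in a source of \<open>Z\<close>, and a path
  of \<open>F\<close> from the root into this source contains an edge at which there is a
  cut.\<close>

lemma full_if_no_cut:
  assumes rooted: "rooted Z" and bridges: "bridges \<subseteq> Z" and sub: "arcs Z \<subseteq> (arcs F)\<^sup>*"
    and no: "\<And>j. \<not> cut_at Z j"
  shows "full Z"
proof (rule ccontr)
  assume "\<not> full Z"
  then obtain i where i: "i \<in> F" "\<not> conn Z (src i) (dst i)" by (auto simp: full_iff)
  let ?y = "dst i"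
  have "i \<notin> bridges" using i(2) bridges conn_arc by blast
  then have "strong ?y (src i)" using i(1) conn_arc[of i F] by (auto simp: bridges_def)
  moreover obtain r where r: "strong ?y r" "\<And>u. strong ?y u \<Longrightarrow> conn Z u r"
    using rooted by (auto simp: rooted_def)
  ultimately have ry: "\<not> conn Z r ?y" using i(2) by (meson rtrancl_trans)
  define X where "X = {v. strong ?y v \<and> \<not> conn Z r v}"
  define anc where "anc v = {u. strong ?y u \<and> conn Z u v}" for v
  have "{u. conn F ?y u} \<subseteq> insert ?y (dst ` F)"
    by (auto simp: arcs_def elim: rtranclE)
  then have "finite {u. conn F ?y u}" by (rule finite_subset) (simp add: finite_F)
  then have fin: "finite (anc v)" for v by (rule finite_subset[rotated]) (auto simp: anc_def)
  have "?y \<in> X" using ry by (simp add: X_def)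
  then obtain v where v: "v \<in> X" "\<And>w. w \<in> X \<Longrightarrow> card (anc v) \<le> card (anc w)"
    using ex_has_least_nat[of "\<lambda>v. v \<in> X" ?y "\<lambda>v. card (anc v)"] by blast
  have sv: "strong ?y v" and rv: "\<not> conn Z r v" using v(1) by (auto simp: X_def)
  have source: "conn Z v u" if "conn Z u v" "conn F v u" for u
  proof -
    have su: "strong ?y u" using that sv conn_F_if[OF sub] by (meson rtrancl_trans)
    moreover have "\<not> conn Z r u" using that(1) rv by (meson rtrancl_trans)
    ultimately have "u \<in> X" by (simp add: X_def)
    then have "card (anc v) \<le> card (anc u)" by (rule v(2))
    moreover have "anc u \<subseteq> anc v" using that(1) by (auto simp: anc_def intro: rtrancl_trans)
    \<comment> \<open>Since \<open>v\<close> is its own ancestor, equality makes it an ancestor of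
      \<open>u\<close>.\<close>
    ultimately have "anc u = anc v" using fin by (simp add: card_subset_eq card_mono le_antisym)
    then show ?thesis using sv by (auto simp: anc_def)
  qed
  have "conn F r v" using r(1) sv by (meson rtrancl_trans)
  from rtrancl_crossing[OF this, of "\<lambda>u. conn Z u v"] rv
  obtain a b where ab: "conn F r a" "(a, b) \<in> arcs F" "conn F b v" "\<not> conn Z a v" "conn Z b v"
    by auto
  then obtain j where j: "j \<in> F" "a = src j" "b = dst j" by (auto simp: arcs_def)
  have "conn F v r" using r(1) sv by (meson rtrancl_trans)
  then have va: "conn F v a" using ab(1) by (meson rtrancl_trans)
  then have vb: "conn Z v b" using ab source by (meson rtrancl.rtrancl_into_rtrancl)
  have "cut_at Z j" unfolding cut_at_def
  proof (intro conjI allI impI)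
    show "conn F (dst j) (src j)" using j ab(3) va by (auto intro: rtrancl_trans)
    show "\<not> conn Z (src j) (dst j)" using j ab(4,5) by (auto dest: rtrancl_trans)
  next
    fix u assume "conn Z u (dst j)" "conn F (dst j) u"
    then have "conn Z u v" "conn F v u" using j ab(5) vb conn_F_if[OF sub] 
      by (meson rtrancl_trans)+
    then show "conn Z (dst j) u" using source ab(5) j by (meson rtrancl_trans)
  qed (use j in simp)
  with no show False by blast
qed

text \<open>A run of the primal-dual algorithm. With costs 0 and 1, raising the dual variable of a
  source by one makes all entering edges tight together, so the cut is added as a whole. The list
  remembers the order for the reverse deletion.\<close>

inductive chain :: "'e set \<Rightarrow> 'e list \<Rightarrow> 'e set \<Rightarrow> bool" for Z0 where
  Nil: "chain Z0 [] Z0"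
| Snoc: "chain Z0 es Z \<Longrightarrow> cut_at Z j \<Longrightarrow> set ks = cutset Z j \<Longrightarrow> distinct ks \<Longrightarrow>
    chain Z0 (es @ ks) (Z \<union> cutset Z j)"

lemma chainD:
  assumes "chain Z0 es Z"
  shows "Z = Z0 \<union> set es" "set es \<subseteq> F - Z0" "distinct es"
proof -
  have "Z = Z0 \<union> set es \<and> set es \<subseteq> F - Z0 \<and> distinct es"
    using assms
  proof induction
    case (Snoc es Z j ks)
    then show ?case using cut_disjoint[of Z j] by (auto simp: cutset_def)
  qed simp
  then show "Z = Z0 \<union> set es" "set es \<subseteq> F - Z0" "distinct es" by auto
qed

lemma chain_arcs:
  assumes "chain Z0 es Z" "arcs Z0 \<subseteq> (arcs F)\<^sup>*"
  shows "arcs Z \<subseteq> (arcs F)\<^sup>*"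
proof -
  have "Z \<subseteq> Z0 \<union> F" using chainD[OF assms(1)] by blast
  then have "arcs Z \<subseteq> arcs Z0 \<union> arcs F" using arcs_mono arcs_Un by metis
  then show ?thesis using assms(2) by blast
qed

lemma rooted_mono: "rooted Z \<Longrightarrow> Z \<subseteq> Z' \<Longrightarrow> rooted Z'"
  unfolding rooted_def by (meson conn_mono)

text \<open>The cuts of a chain are disjoint, and pruning them in reverse order leaves a single edge
  of each. This is the primal-dual argument for minimum cost arborescences with costs 0 and 1.\<close>

lemma chain_prune:
  assumes "chain Z0 es Z" "arcs Z0 \<subseteq> (arcs F)\<^sup>*" "rooted Z0"
    and ok_mono: "mono ok"
    and ok_full: "\<And>P. Z0 \<subseteq> P \<Longrightarrow> ok P \<longleftrightarrow> full P"
    and "T' \<subseteq> F - Z" "full (Z \<union> T')"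
  shows "\<exists>T \<subseteq> Z - Z0. fold (prune ok) (rev es) (Z \<union> T') = Z0 \<union> T' \<union> T \<and> full (Z0 \<union> T' \<union> T) \<and>
    (\<forall>A \<subseteq> F. full (Z0 \<union> A) \<longrightarrow> card T \<le> card (A \<inter> (Z - Z0))) \<and>
    ((\<forall>e\<in>F - Z0. full (F - {e})) \<longrightarrow> 2 * card T \<le> card (Z - Z0))"
  using assms(1,6,7)
\<comment> \<open>\<open>T'\<close> holds the edges kept from later cuts, which are pruned before
  the cuts of the chain at hand.\<close>
proof (induction arbitrary: T')
  case Nil
  then show ?case by simp
next
  case (Snoc es Z j ks)
  let ?K = "cutset Z j"
  note chain = chainD[OF Snoc.hyps(1)]
  have sub: "arcs Z \<subseteq> (arcs F)\<^sup>*" using Snoc.hyps(1) assms(2) by (rule chain_arcs)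
  have rooted: "rooted Z" using assms(3) chain(1) by (auto intro: rooted_mono)
  have finK: "finite ?K" using Snoc.hyps(3) by (metis List.finite_set)
  have finZ: "finite (Z - Z0)" using chain by (auto intro: finite_subset)
  have KF: "?K \<subseteq> F" by (auto simp: cutset_def)
  have KZ: "?K \<inter> Z = {}" by (rule cut_disjoint)
  \<comment> \<open>The last cut is pruned while all earlier ones are still completely present in
    \<open>Z\<close>; this is the situation of \<open>single_cut_edge\<close>.\<close>
  define P where "P = fold (prune ok) (rev ks) (Z \<union> ?K \<union> T')"
  have "ok (Z \<union> ?K \<union> T')" using Snoc.prems(2) ok_full[of "Z \<union> ?K \<union> T'"] chain(1) by auto
  note P = fold_prune[where ok = ok and es = "rev ks", OF ok_mono this, folded P_def]
  define K where "K = P \<inter> ?K"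
  have P_eq: "P = Z \<union> T' \<union> K" using P(1,2) Snoc.hyps(3) Snoc.prems(1) KZ by (auto simp: K_def)
  then have "Z0 \<subseteq> P" using chain(1) by auto
  then have fullP: "full P" using P(3) ok_full by blast
  have "\<exists>e\<in>K. full (Z \<union> T' \<union> {e})"
  proof (rule single_cut_edge[OF Snoc.hyps(2) sub rooted])
    show "full (Z \<union> T' \<union> K)" using fullP unfolding P_eq .
  qed (use Snoc.prems(1) in \<open>auto simp: K_def\<close>)
  then obtain e where e: "e \<in> K" "full (Z \<union> T' \<union> {e})" by blast
  \<comment> \<open>A second survivor could have been deleted, because \<open>e\<close> alone
    already suffices.\<close>
  have "K \<subseteq> {e}"
  proof
    fix f assume f: "f \<in> K"
    then have "\<not> ok (P - {f})" using P(4)[of f] Snoc.hyps(3) by (auto simp: K_def)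
    moreover have "f \<notin> Z \<union> T'" using f Snoc.prems(1) KZ by (auto simp: K_def)
    moreover have "Z0 \<subseteq> P - {f}" using \<open>Z0 \<subseteq> P\<close> \<open>f \<notin> Z \<union> T'\<close> chain(1) by auto
    ultimately have "\<not> full (P - {f})" using ok_full by blast
    then show "f \<in> {e}" using e f P_eq \<open>f \<notin> Z \<union> T'\<close> full_mono[OF _ e(2), of "P - {f}"] by blast
  qed
  with e(1) have Ke: "K = {e}" by blast
  have eK: "e \<in> ?K" using e(1) by (simp add: K_def)
  have "T' \<union> {e} \<subseteq> F - Z" using Snoc.prems(1) eK KF KZ by blast
  moreover have "full (Z \<union> (T' \<union> {e}))" using e(2) by (simp add: Un_assoc)
  ultimately obtain T where T: "T \<subseteq> Z - Z0"
    "fold (prune ok) (rev es) (Z \<union> (T' \<union> {e})) = Z0 \<union> (T' \<union> {e}) \<union> T"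
    "full (Z0 \<union> (T' \<union> {e}) \<union> T)"
    "\<And>A. A \<subseteq> F \<Longrightarrow> full (Z0 \<union> A) \<Longrightarrow> card T \<le> card (A \<inter> (Z - Z0))"
    "(\<forall>e\<in>F - Z0. full (F - {e})) \<Longrightarrow> 2 * card T \<le> card (Z - Z0)"
    using Snoc.IH[of "T' \<union> {e}"] by blast
  let ?T = "insert e T"
  have split: "Z \<union> ?K - Z0 = (Z - Z0) \<union> ?K" using KZ chain(1) by blast
  have cT: "card ?T = Suc (card T)"
    using T(1) eK KZ finZ by (intro card_insert_disjoint) (auto intro: finite_subset)
  show ?case
  proof (intro exI[of _ ?T] conjI allI impI)
    show "?T \<subseteq> Z \<union> ?K - Z0" using T(1) eK split by blast
    have "fold (prune ok) (rev (es @ ks)) (Z \<union> ?K \<union> T') = fold (prune ok) (rev es) P"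
      by (simp add: P_def)
    also have "\<dots> = Z0 \<union> T' \<union> ?T" using T(2) P_eq Ke by (simp add: Un_assoc)
    finally show "fold (prune ok) (rev (es @ ks)) (Z \<union> ?K \<union> T') = Z0 \<union> T' \<union> ?T" .
    show "full (Z0 \<union> T' \<union> ?T)" using T(3) by simp
  next
    fix A assume A: "A \<subseteq> F" "full (Z0 \<union> A)"
    then have "full (Z \<union> A)" using chain(1) by (auto intro: full_mono[rotated])
    then have "A \<inter> ?K \<noteq> {}" using cut_hit[OF Snoc.hyps(2) sub A(1)] by blast
    \<comment> \<open>The new cut is disjoint from the earlier ones, so hitting it costs
      \<open>A\<close> one more edge.\<close>
    then have "Suc (card (A \<inter> (Z - Z0))) \<le> card (A \<inter> (Z - Z0)) + card (A \<inter> ?K)"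
      using finK by (simp add: Suc_le_eq card_gt_0_iff)
    also have "\<dots> = card (A \<inter> (Z - Z0) \<union> A \<inter> ?K)"
      using finK finZ KZ by (intro card_Un_disjoint[symmetric]) auto
    also have "A \<inter> (Z - Z0) \<union> A \<inter> ?K = A \<inter> (Z \<union> ?K - Z0)" using split by blast
    finally show "card ?T \<le> card (A \<inter> (Z \<union> ?K - Z0))" using T(4)[OF A] cT by linarith
  next
    \<comment> \<open>As \<open>F - {e}\<close> is full, it crosses the cut too. So the cut contains
      a second edge.\<close>
    assume del: "\<forall>e\<in>F - Z0. full (F - {e})"
    have "e \<in> F - Z0" using eK KF KZ chain(1) by blast
    then have "full (F - {e})" using del by blast
    then have "full (Z \<union> (F - {e}))" by (rule full_mono[rotated]) auto
    then have "(F - {e}) \<inter> ?K \<noteq> {}" using cut_hit[OF Snoc.hyps(2) sub, of "F - {e}"] by blast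
    then obtain f where "f \<in> ?K" "f \<noteq> e" by blast
    then have "card {e, f} \<le> card ?K" using eK finK by (intro card_mono) auto
    then have "2 \<le> card ?K" using \<open>f \<noteq> e\<close> by simp
    moreover have "card (Z \<union> ?K - Z0) = card (Z - Z0) + card ?K"
      unfolding split using finK finZ KZ by (intro card_Un_disjoint) auto
    ultimately show "2 * card ?T \<le> card (Z \<union> ?K - Z0)" using T(5)[OF del] cT by simp
  qed
qed

lemma chain_prune_obtain:
  assumes "chain Z0 es Z" "arcs Z0 \<subseteq> (arcs F)\<^sup>*" "rooted Z0"
    and ok_mono: "mono ok"
    and ok_full: "\<And>P. Z0 \<subseteq> P \<Longrightarrow> ok P \<longleftrightarrow> full P"
    and "full Z"
  obtains T where "T \<subseteq> Z - Z0" "fold (prune ok) (rev es) Z = Z0 \<union> T" "full (Z0 \<union> T)"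
    "\<And>A. A \<subseteq> F \<Longrightarrow> full (Z0 \<union> A) \<Longrightarrow> card T \<le> card (A \<inter> (Z - Z0))"
    "\<forall>e\<in>F - Z0. full (F - {e}) \<Longrightarrow> 2 * card T \<le> card (Z - Z0)"
proof -
  have "\<exists>T \<subseteq> Z - Z0. fold (prune ok) (rev es) Z = Z0 \<union> T \<and> full (Z0 \<union> T) \<and>
    (\<forall>A \<subseteq> F. full (Z0 \<union> A) \<longrightarrow> card T \<le> card (A \<inter> (Z - Z0))) \<and>
    ((\<forall>e\<in>F - Z0. full (F - {e})) \<longrightarrow> 2 * card T \<le> card (Z - Z0))"
    using chain_prune[where ok = ok and T' = "{}", OF assms(1-5), simplified] assms(6) by simp
  then show ?thesis by (elim exE conjE) (rule that, auto)
qed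

section \<open>Edges between different strong components\<close>

lemma conn_remove:
  assumes "conn P x y" "\<not> conn (P - {e}) x y"
  shows "conn P x (src e) \<and> conn P (dst e) y"
  using assms
proof (induction rule: converse_rtrancl_induct)
  case (step x z)
  then obtain i where i: "i \<in> P" "x = src i" "z = dst i" by (auto simp: arcs_def)
  show ?case
  proof (cases "i = e")
    case True
    then show ?thesis using i step by auto
  next
    case False
    then have "conn (P - {e}) x z" using i conn_arc[of i "P - {e}"] by auto
    then have "\<not> conn (P - {e}) z y" using step.prems by (meson rtrancl_trans)
    then show ?thesis using step by (meson converse_rtrancl_into_rtrancl)
  qed
qed simp

text \<open>A path from \<open>x\<close> to \<open>y\<close> through \<open>e\<close> would be
  closed to a cycle by the way back from \<open>y\<close> to \<open>x\<close>, but an edge between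
  different strong components lies on no cycle.\<close>

lemma strong_conn_remove_bridge:
  assumes "full P" "P \<subseteq> F" "e \<in> bridges" "conn F x y" "strong x (src e) \<or> strong x (dst e)"
    "strong x y"
  shows "conn (P - {e}) x y"
proof (rule ccontr)
  assume no: "\<not> ?thesis"
  have "conn P x y" using full_conn[OF assms(1,4)] .
  from conn_remove[OF this no] have "conn P x (src e)" "conn P (dst e) y" by auto
  then have "conn F x (src e)" "conn F (dst e) y" using conn_mono[OF assms(2)] by blast+
  then show False using assms(3,5,6) by (auto simp: bridges_def dest: rtrancl_trans)
qed

text \<open>Inter-component edges: in a minimal solution, one that is not needed in \<open>F\<close> itself has an
  unused parallel edge between the same two strong components.\<close>

lemma card_bridges_le:
  assumes "H \<subseteq> F" "full H" "M \<subseteq> bridges"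
    and del: "\<And>e. e \<in> M \<Longrightarrow> full (F - {e})"
    and min: "\<And>e. e \<in> M \<Longrightarrow> e \<in> H \<Longrightarrow> \<not> full (H - {e})"
    and rest: "bridges - M \<subseteq> H"
  shows "2 * card (M \<inter> H) \<le> card M"
proof -
  have finM: "finite M" using assms(3) finite_F by (auto simp: bridges_def intro: finite_subset)
  define par where "par e f \<longleftrightarrow> strong (src e) (src f) \<and> strong (dst e) (dst f)" for e f
  \<comment> \<open>Of two kept parallel edges, \<open>e\<close> is redundant: its ends are linked
    to those of \<open>f\<close> by paths of \<open>H\<close> inside the components, and these avoid
    \<open>e\<close>.\<close>
  have uniq: "e = f" if "e \<in> M \<inter> H" "f \<in> H" "par e f" for e f
  proof (rule ccontr)
    assume "e \<noteq> f"
    have e: "e \<in> bridges" using that assms(3) by blast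
    have f: "conn (H - {e}) (src f) (dst f)" using \<open>e \<noteq> f\<close> that conn_arc by auto
    have "conn (H - {e}) (src e) (src f)" "conn (H - {e}) (dst f) (dst e)"
      using that by (auto simp: par_def intro!: strong_conn_remove_bridge[OF assms(2,1) e])
    with f have "conn (H - {e}) (src e) (dst e)" by (meson rtrancl_trans)
    then have "full (H - {e})" using assms(2)
      by (rule_tac full_transfer[of H]) (auto intro: conn_arc)
    then show False using min that by blast
  qed
  \<comment> \<open>Otherwise \<open>e\<close> would have no parallel in \<open>F\<close>. A path
    around \<open>e\<close> in \<open>F - {e}\<close> then translates into \<open>H - {e}\<close>:
    an edge whose replacement in \<open>H\<close> had to use \<open>e\<close> would be parallel to
    \<open>e\<close>. This contradicts the minimality of \<open>H\<close>.\<close>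
  have ex: "\<exists>f\<in>M - H. par e f" if e: "e \<in> M \<inter> H" for e
  proof (rule ccontr)
    assume none: "\<not> ?thesis"
    have eF: "e \<in> F" using e assms(1) by blast
    have ebridge: "e \<in> bridges" using e assms(3) by blast
    have nopar: "\<not> par e g" if g: "g \<in> F" "g \<noteq> e" for g
    proof
      assume p: "par e g"
      then have "g \<notin> H" using uniq[of e g] e g by blast
      moreover have "g \<in> bridges"
        using ebridge p g(1) conn_arc[of e F] eF
        by (auto simp: bridges_def par_def dest: rtrancl_trans)
      ultimately have "g \<in> M" using rest by blast
      with none p \<open>g \<notin> H\<close> show False by blast
    qed
    have "conn (F - {e}) (src e) (dst e)" using del e eF by (simp add: full_iff)
    moreover have "conn (F - {e}) v (dst e) \<Longrightarrow> conn (H - {e}) (src e) v"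
      if "conn (F - {e}) (src e) v" for v
      using that
    proof (induction rule: rtrancl_induct)
      case (step v w)
      then obtain g where g: "g \<in> F" "g \<noteq> e" "v = src g" "w = dst g" by (auto simp: arcs_def)
      have "conn (F - {e}) v (dst e)" using step by (meson converse_rtrancl_into_rtrancl)
      then have v: "conn (H - {e}) (src e) v" by (rule step.IH)
      have "conn (H - {e}) v w"
      proof (rule ccontr)
        assume no: "\<not> ?thesis"
        have "conn H v w" using assms(2) g by (simp add: full_iff)
        from conn_remove[OF this no] have "conn F v (src e)" "conn F (dst e) w"
          using conn_mono[OF assms(1)] by blast+
        moreover have "conn F (src e) v" "conn F w (dst e)"
          using step by (auto intro: conn_mono[of "F - {e}"])
        ultimately have "par e g" using g by (simp add: par_def)
        with nopar g show False by blast
      qed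
      with v show ?case by (meson rtrancl_trans)
    qed simp
    ultimately have "conn (H - {e}) (src e) (dst e)" by blast
    then have "full (H - {e})" using assms(2)
      by (rule_tac full_transfer[of H]) (auto intro: conn_arc)
    then show False using min e by blast
  qed
  then obtain \<phi> where \<phi>: "\<And>e. e \<in> M \<inter> H \<Longrightarrow> \<phi> e \<in> M - H \<and> par e (\<phi> e)" by metis
  have "inj_on \<phi> (M \<inter> H)"
  proof (rule inj_onI)
    fix e f assume ef: "e \<in> M \<inter> H" "f \<in> M \<inter> H" "\<phi> e = \<phi> f"
    then have "par e f" using \<phi>[of e] \<phi>[of f] by (auto simp: par_def intro: rtrancl_trans)
    then show "e = f" using uniq ef by blast
  qed
  then have "card (M \<inter> H) \<le> card (M - H)"
    using \<phi> finM by (intro card_inj_on_le) auto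
  moreover have "card M = card (M \<inter> H) + card (M - H)"
    using finM by (rule card_Int_Diff)
  ultimately show ?thesis by simp
qed

section \<open>Auxiliary edges into the roots\<close>

definition star :: "'e set \<Rightarrow> bool" where
  "star S \<longleftrightarrow> (\<forall>y. \<exists>r. strong y r \<and>
     (\<forall>u. strong y u \<longrightarrow> u = r \<or> (\<exists>i\<in>S. src i = u \<and> dst i = r)) \<and>
     (\<forall>i\<in>S. strong y (src i) \<longrightarrow> dst i = r))"

text \<open>In a component with several vertices every vertex is the head of an edge, so star edges
  that start at heads are enough. A component where no star edge starts consists of one vertex,
  which is its own root.\<close>

lemma starI:
  assumes "dst ` F \<subseteq> src ` S" "\<And>i. i \<in> S \<Longrightarrow> strong (src i) (dst i)"
    and eq: "\<And>i j. i \<in> S \<Longrightarrow> j \<in> S \<Longrightarrow> strong (src i) (src j) \<Longrightarrow> dst i = dst j"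
  shows "star S"
  unfolding star_def
proof
  fix y
  have head: "u \<in> src ` S" if xu: "conn F x u" "u \<noteq> x" for x u
    using xu(1)
  proof (cases rule: rtranclE)
    case (step w)
    then show ?thesis using assms(1) by (auto simp: arcs_def)
  qed (use xu(2) in simp)
  show "\<exists>r. strong y r \<and> (\<forall>u. strong y u \<longrightarrow> u = r \<or> (\<exists>i\<in>S. src i = u \<and> dst i = r)) \<and>
     (\<forall>i\<in>S. strong y (src i) \<longrightarrow> dst i = r)"
  proof (cases "\<exists>i\<in>S. strong y (src i)")
    case True
    then obtain i where i: "i \<in> S" "strong y (src i)" by blast
    have r: "strong y (dst i)" using i assms(2)[OF i(1)] by (meson rtrancl_trans)
    have same: "dst k = dst i" if "k \<in> S" "strong y (src k)" for k
      using eq[of k i] that i by (meson rtrancl_trans)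
    show ?thesis
    proof (intro exI[of _ "dst i"] conjI allI impI ballI)
      fix u assume u: "strong y u"
      show "u = dst i \<or> (\<exists>k\<in>S. src k = u \<and> dst k = dst i)"
      proof (cases "u = dst i")
        case False
        have "conn F (dst i) u" using u r by (meson rtrancl_trans)
        with head False obtain k where "k \<in> S" "u = src k" by blast
        then show ?thesis using same u by blast
      qed simp
    qed (use r same in auto)
  next
    case False
    have "u = y" if "strong y u" for u using head[of y u] that False by auto
    then show ?thesis using False by blast
  qed
qed

lemma star_arcs: "star S \<Longrightarrow> arcs S \<subseteq> (arcs F)\<^sup>*"
  unfolding star_def arcs_def by auto

lemma star_rooted: "star S \<Longrightarrow> S \<subseteq> Z \<Longrightarrow> rooted Z"
  unfolding rooted_def
proof
  fix y assume S: "star S" "S \<subseteq> Z"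
  obtain r where "strong y r" "\<And>u. strong y u \<Longrightarrow> u = r \<or> (\<exists>i\<in>S. src i = u \<and> dst i = r)"
    using S(1) unfolding star_def by blast
  then show "\<exists>r. strong y r \<and> (\<forall>u. strong y u \<longrightarrow> conn Z u r)"
    using S(2) conn_arc[of _ Z] by blast
qed

text \<open>Star edges end in the root, so a path from the root that uses one may as well restart
  there. What phase one chose thus reaches the component from its root without the stars, which is
  \<open>rooted\<close> for the reversed edges.\<close>

lemma star_remove:
  assumes "star S" "full (Z \<union> S)" "Z \<subseteq> F"
  shows "\<forall>y. \<exists>r. strong y r \<and> (\<forall>u. strong y u \<longrightarrow> conn Z r u)"
proof
  fix y
  obtain r where r: "strong y r" "\<And>i. i \<in> S \<Longrightarrow> strong y (src i) \<Longrightarrow> dst i = r"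
    using assms(1) unfolding star_def by blast
  have sub: "arcs (Z \<union> S) \<subseteq> (arcs F)\<^sup>*"
    using star_arcs[OF assms(1)] arcs_mono[OF assms(3)] by (auto simp: arcs_Un)
  have "conn F u r \<Longrightarrow> conn Z r u" if "conn (Z \<union> S) r u" for u
    using that
  proof (induction rule: rtrancl_induct)
    case (step v w)
    then obtain i where i: "i \<in> Z \<union> S" "v = src i" "w = dst i" by (auto simp: arcs_def)
    have vw: "conn F v w" using step(2) sub by blast
    then have vr: "conn F v r" using step.prems by (meson rtrancl_trans)
    show ?case
    proof (cases "i \<in> Z")
      case True
      then show ?thesis using i step.IH[OF vr] conn_arc by (metis rtrancl_trans)
    next
      case False
      have "conn F r v" using step(1) conn_F_if[OF sub] by blast
      then have "strong y v" using r(1) vr by (meson rtrancl_trans)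
      then have "w = r" using r(2) i False by blast
      then show ?thesis by simp
    qed
  qed simp
  then have "conn Z r u" if "strong y u" for u
    using that r(1) full_conn[OF assms(2)] by (meson rtrancl_trans)
  with r(1) show "\<exists>r. strong y r \<and> (\<forall>u. strong y u \<longrightarrow> conn Z r u)" by blast
qed

section \<open>Combining the two phases\<close>

definition necessary :: "'e set \<Rightarrow> 'e set" where
  "necessary D = D \<union> {i \<in> F. \<not> covers (F - {i})}"

text \<open>Full and covering differ only on loops: a loop that is not necessary lies on a longer cycle.\<close>

lemma full_covers:
  assumes inj: "inj_on (\<lambda>i. (src i, dst i)) F" and "necessary D \<subseteq> P" "full P"
  shows "covers P"
proof -
  have "(src i, dst i) \<in> (arcs P)\<^sup>+" if i: "i \<in> F" for i
  proof (cases "src i = dst i \<and> i \<notin> P")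
    case False
    have "conn P (src i) (dst i)" using assms(3) i by (simp add: full_iff)
    then show ?thesis using False by (auto simp: arcs_def rtrancl_eq_or_trancl)
  next
    case True
    let ?x = "src i"
    have "i \<notin> necessary D" using True assms(2) by blast
    then have "(?x, ?x) \<in> (arcs (F - {i}))\<^sup>+" using i True
      by (auto simp: necessary_def covers_def arcs_def)
    then obtain z where z: "(?x, z) \<in> arcs (F - {i})" "conn (F - {i}) z ?x"
      by (meson tranclD)
    then obtain g where g: "g \<in> F" "g \<noteq> i" "?x = src g" "z = dst g" by (auto simp: arcs_def)
    \<comment> \<open>No two edges of \<open>F\<close> have the same ends, so the first edge of the
      closed walk is not another loop, and the walk really leaves the vertex.\<close>
    have "z \<noteq> ?x" using inj_onD[OF inj, of g i] g i True by auto
    moreover have "conn P ?x z" using assms(3) g by (simp add: full_iff)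
    moreover have "conn P z ?x" using full_conn[OF assms(3)] conn_mono[OF _ z(2)] by blast
    ultimately show ?thesis using True by (metis rtranclD trancl_rtrancl_trancl)
  qed
  then show ?thesis by (auto simp: covers_def arcs_def)
qed

lemma necessary_subset:
  assumes "D \<subseteq> A" "A \<subseteq> F" "covers A"
  shows "necessary D \<subseteq> A"
proof -
  have "covers (F - {i})" if "i \<in> F" "i \<notin> A" for i
    using covers_mono[of A "F - {i}"] that assms by blast
  then show ?thesis using assms(1) by (auto simp: necessary_def)
qed

interpretation rev: network dst src F
  by unfold_locales (rule finite_F)

lemma rev_arcs: "rev.arcs P = (arcs P)\<inverse>"
  by (simp add: arc_rel_converse)

lemma rev_full: "rev.full P = full P"
  by (auto simp: full_iff rev.full_iff rev_arcs rtrancl_converse)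

text \<open>Let \<open>N\<close> be the necessary edges, \<open>M\<close> the other edges between
  components, \<open>T\<close> and \<open>C\<close> the edges chosen in the two phases, and
  \<open>R\<close> the edges of \<open>F\<close> still unselected after phase one. Then
  \<open>F\<close> has \<open>card N + card M + card T + card R\<close> edges. The result keeps at
  most \<open>card N + card T\<close> plus half of \<open>card M + card R\<close>, while any
  feasible \<open>A\<close> keeps at least \<open>card N + card T\<close>.\<close>

lemma half_optimal:
  assumes inj: "inj_on (\<lambda>i. (src i, dst i)) F" and D: "D \<subseteq> F"
    and S: "star S" "S \<inter> F = {}"
    and c1: "chain (necessary D \<union> bridges \<union> S) es1 Z1" "\<And>j. \<not> cut_at Z1 j"
    and P1: "P1 = fold (prune covers) (rev es1) Z1"
    and c2: "rev.chain (P1 - S) es2 Z2" "\<And>j. \<not> rev.cut_at Z2 j"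
    and P2: "P2 = fold (prune covers) (rev es2) Z2"
    and H: "H = fold (prune covers) es P2" "F - D \<subseteq> set es" "D \<inter> set es = {}"
  shows "D \<subseteq> H" "H \<subseteq> F" "covers H"
    "D \<subseteq> A \<Longrightarrow> A \<subseteq> F \<Longrightarrow> covers A \<Longrightarrow> card (F - A) \<le> 2 * card (F - H)"
proof -
  let ?N = "necessary D"
  let ?Z0 = "?N \<union> bridges \<union> S"
  have NF: "?N \<subseteq> F" using D by (auto simp: necessary_def)
  have IF: "bridges \<subseteq> F" by (auto simp: bridges_def)
  have sub0: "arcs ?Z0 \<subseteq> (arcs F)\<^sup>*"
    using star_arcs[OF S(1)] arcs_mono[OF NF] arcs_mono[OF IF] by (auto simp: arcs_Un)
  have root0: "rooted ?Z0" using S(1) by (rule star_rooted) simp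
  have covers_iff: "covers P \<longleftrightarrow> full P" if "?N \<subseteq> P" for P
    using full_covers[OF inj that] covers_full by blast
  have Z1: "Z1 = ?Z0 \<union> set es1" "set es1 \<subseteq> F - ?Z0" using chainD[OF c1(1)] by auto
  have full1: "full Z1"
  proof (rule full_if_no_cut[OF _ _ chain_arcs[OF c1(1) sub0] c1(2)])
    show "rooted Z1" using Z1(1) by (intro rooted_mono[OF root0]) blast
    show "bridges \<subseteq> Z1" using Z1(1) by blast
  qed
  obtain T where T: "T \<subseteq> Z1 - ?Z0" "P1 = ?Z0 \<union> T" "full (?Z0 \<union> T)"
    "\<And>A. A \<subseteq> F \<Longrightarrow> full (?Z0 \<union> A) \<Longrightarrow> card T \<le> card (A \<inter> (Z1 - ?Z0))"
  proof (rule chain_prune_obtain[where ok = covers, OF c1(1) sub0 root0 mono_covers _ full1])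
    show "covers P \<longleftrightarrow> full P" if "?Z0 \<subseteq> P" for P using covers_iff that by blast
  qed (auto simp: P1)
  let ?Y0 = "P1 - S"
  have TF: "T \<subseteq> F - ?Z0" using T(1) Z1 by blast
  have Y0: "?Y0 = ?N \<union> bridges \<union> T" using T(2) TF NF IF S(2) by blast
  then have Y0F: "?Y0 \<subseteq> F" using NF IF TF by blast
  have fullYS: "full (?Y0 \<union> S)" using T(2,3) by (auto intro: full_mono[rotated])
  have rooty: "rev.rooted ?Y0"
    using star_remove[OF S(1) fullYS Y0F]
    unfolding rev.rooted_def rev_arcs rtrancl_converse converse_iff by metis
  have suby: "rev.arcs ?Y0 \<subseteq> (rev.arcs F)\<^sup>*" using rev.arcs_mono[OF Y0F] by blast
  have bridges_rev: "rev.bridges = bridges"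
    by (auto simp: rev.bridges_def bridges_def rev_arcs rtrancl_converse)
  have Z2: "Z2 = ?Y0 \<union> set es2" "set es2 \<subseteq> F - ?Y0" using rev.chainD[OF c2(1)] by auto
  have full2: "rev.full Z2"
  proof (rule rev.full_if_no_cut[OF _ _ rev.chain_arcs[OF c2(1) suby] c2(2)])
    show "rev.rooted Z2" using Z2(1) by (intro rev.rooted_mono[OF rooty]) blast
    show "rev.bridges \<subseteq> Z2" using Z2(1) Y0 bridges_rev by blast
  qed
  have okY: "covers P \<longleftrightarrow> rev.full P" if "?Y0 \<subseteq> P" for P
    using that covers_iff Y0 rev_full by auto
  have del: "full (F - {e})" if "e \<in> F" "e \<notin> ?N" for e
    using that covers_full by (auto simp: necessary_def)
  obtain C where C: "C \<subseteq> Z2 - ?Y0" "P2 = ?Y0 \<union> C" "rev.full (?Y0 \<union> C)"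
    "2 * card C \<le> card (Z2 - ?Y0)"
  proof (rule rev.chain_prune_obtain[where ok = covers, OF c2(1) suby rooty mono_covers okY full2])
    fix C assume C: "C \<subseteq> Z2 - ?Y0" "fold (prune covers) (rev es2) Z2 = ?Y0 \<union> C"
      "rev.full (?Y0 \<union> C)" "\<forall>e\<in>F - ?Y0. rev.full (F - {e}) \<Longrightarrow> 2 * card C \<le> card (Z2 - ?Y0)"
    have "\<forall>e\<in>F - ?Y0. rev.full (F - {e})" using del Y0 rev_full by blast
    with C that show ?thesis by (simp add: P2)
  qed
  have CF: "C \<subseteq> F - ?Y0" using C(1) Z2 by blast
  have "covers P2" using C(2,3) okY by auto
  note H' = fold_prune[where ok = covers and es = es, OF mono_covers this, folded H(1)]
  have P2F: "P2 \<subseteq> F" using C(2) CF Y0F by blast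
  then show HF: "H \<subseteq> F" using H'(1) by blast
  have "D \<subseteq> P2" using C(2) Y0 by (auto simp: necessary_def)
  then show DH: "D \<subseteq> H" using H'(2) H(3) by blast
  show covH: "covers H" by (rule H'(3))
  have NH: "?N \<subseteq> H" using necessary_subset[OF DH HF covH] .
  have min: "\<not> full (H - {e})" if "e \<in> F - ?N" "e \<in> H" for e
  proof -
    have "e \<in> set es" using that H(2) by (auto simp: necessary_def)
    then have "\<not> covers (H - {e})" using H'(4) that by blast
    then show ?thesis using covers_iff[of "H - {e}"] NH that by blast
  qed
  define M where "M = bridges - ?N"
  have bridges_half: "2 * card (M \<inter> H) \<le> card M"
    using HF covers_full[OF covH] del min NH IF
    by (intro card_bridges_le) (auto simp: M_def)
  define R where "R = F - ?Y0"
  have finite: "finite R" "finite M" "finite ?N" "finite T" "finite C"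
    using finite_F IF NF TF CF by (auto simp: R_def M_def intro: finite_subset)
  have "Z2 - ?Y0 \<subseteq> R" using Z2 unfolding R_def by blast
  then have "2 * card C \<le> card R" using C(4) card_mono[OF finite(1)] le_trans by blast
  moreover have "H \<subseteq> ?N \<union> (M \<inter> H) \<union> T \<union> C" using H'(1) C(2) Y0 by (auto simp: M_def)
  then have "card H \<le> card (?N \<union> (M \<inter> H) \<union> T \<union> C)"
    using finite by (intro card_mono) auto
  then have "card H \<le> card ?N + card (M \<inter> H) + card T + card C"
    by (meson card_Un_le order_trans add_le_mono1)
  moreover have "card F = card ?N + card M + card T + card R"
  proof -
    have "F = ((?N \<union> M) \<union> T) \<union> R" using NF IF TF Y0 by (auto simp: M_def R_def)
    then have "card F = card (((?N \<union> M) \<union> T) \<union> R)" by metis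
    also have "\<dots> = card ((?N \<union> M) \<union> T) + card R"
      using finite Y0 by (intro card_Un_disjoint) (auto simp: M_def R_def)
    also have "card ((?N \<union> M) \<union> T) = card (?N \<union> M) + card T"
      using finite TF by (intro card_Un_disjoint) (auto simp: M_def)
    also have "card (?N \<union> M) = card ?N + card M"
      using finite by (intro card_Un_disjoint) (auto simp: M_def)
    finally show ?thesis .
  qed
  moreover have "card (F - H) = card F - card H"
    using HF finite_F by (meson card_Diff_subset finite_subset)
  ultimately have FH: "card F \<le> card ?N + card T + 2 * card (F - H)" using bridges_half by linarith
  assume A: "D \<subseteq> A" "A \<subseteq> F" "covers A"
  \<comment> \<open>Even with the free edges of \<open>?Z0\<close> added, \<open>A\<close> has to
    hit the cuts of phase one. The edges that do so come on top of the necessary ones.\<close>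
  have "full (?Z0 \<union> A)" using covers_full[OF A(3)] by (rule full_mono[rotated]) auto
  then have "card T \<le> card (A \<inter> (Z1 - ?Z0))" using T(4) A(2) by blast
  also have "\<dots> \<le> card (A - ?N)"
    using finite_subset[OF A(2) finite_F] by (intro card_mono) auto
  finally have "card T + card ?N \<le> card A"
    using card_Diff_subset[OF finite(3) necessary_subset[OF A]]
      card_mono[OF finite_subset[OF A(2) finite_F] necessary_subset[OF A]] by linarith
  moreover have "card (F - A) = card F - card A"
    using A(2) finite_F by (meson card_Diff_subset finite_subset)
  ultimately show "card (F - A) \<le> 2 * card (F - H)" using FH by linarith
qed

end

text \<open>\<open>star\<close> depends on strong connectivity alone. The stars computed once for
  all edges therefore serve every remainder that has the same closure.\<close>

lemma star_cong:
  assumes "finite F" "finite G" "(arc_rel src dst F)\<^sup>* = (arc_rel src dst G)\<^sup>*"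
  shows "network.star src dst F S = network.star src dst G S"
proof -
  interpret N: network src dst F by unfold_locales (rule assms(1))
  interpret M: network src dst G by unfold_locales (rule assms(2))
  show ?thesis unfolding N.star_def M.star_def assms(3) ..
qed

section \<open>Bounded loop programs\<close>

text \<open>With loop bounds fixed in advance the semantics is a total function and the running time
  a polynomial determined by the syntax, so no termination arguments about \<open>While\<close> are
  needed later.\<close>

datatype prog =
    Skip
  | Assign nat aexp aexp
  | Comp prog prog (infixr ";;" 60)
  | Ite aexp prog prog
  | For nat prog

abbreviation Var :: "nat \<Rightarrow> aexp" where
  "Var x \<equiv> Cell x (Const 0)"

abbreviation assign_var :: "nat \<Rightarrow> aexp \<Rightarrow> prog" (infix "::=" 61) where
  "x ::= e \<equiv> Assign x (Const 0) e"

text \<open>Every loop runs up to twice the number of edges, which the input stores in cell 1 of array 0.\<close>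

abbreviation bound :: aexp where
  "bound \<equiv> Plus (Cell 0 (Const 1)) (Cell 0 (Const 1))"

text \<open>There is no empty statement in \<open>com\<close>, so \<open>Skip\<close> stores a cell
  back into itself.\<close>

primrec compile :: "prog \<Rightarrow> com" where
  "compile Skip = Store 0 (Const 0) (Var 0)"
| "compile (Assign a e f) = Store a e f"
| "compile (c ;; d) = Seq (compile c) (compile d)"
| "compile (Ite e c d) = Cond e (compile c) (compile d)"
| "compile (For i c) = Seq (Store i (Const 0) (Const 0))
     (While (Minus bound (Var i)) (Seq (compile c) (Store i (Const 0) (Plus (Var i) (Const 1)))))"

definition put :: "nat \<Rightarrow> nat \<Rightarrow> state \<Rightarrow> state" where
  "put i j s = s(i := (s i)(0 := j))"

primrec sem :: "prog \<Rightarrow> state \<Rightarrow> state" where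
  "sem Skip s = s"
| "sem (Assign a e f) s = s(a := (s a)(aval e s := aval f s))"
| "sem (c ;; d) s = sem d (sem c s)"
| "sem (Ite e c d) s = (if aval e s \<noteq> 0 then sem c s else sem d s)"
| "sem (For i c) s =
     put i (2 * s 0 1) (fold (\<lambda>j t. sem c (put i j t)) [0..<2 * s 0 1] s)"

primrec writes :: "prog \<Rightarrow> nat set" where
  "writes Skip = {}"
| "writes (Assign a e f) = {a}"
| "writes (c ;; d) = writes c \<union> writes d"
| "writes (Ite e c d) = writes c \<union> writes d"
| "writes (For i c) = insert i (writes c)"

text \<open>Array 0 contains the loop bound, so neither a loop body nor anything followed by another
  program may write to it. The final step may, and this is how the output length gets there.\<close>

primrec bounded :: "prog \<Rightarrow> bool" where
  "bounded Skip \<longleftrightarrow> True"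
| "bounded (Assign a e f) \<longleftrightarrow> True"
| "bounded (c ;; d) \<longleftrightarrow> bounded c \<and> bounded d \<and> 0 \<notin> writes c"
| "bounded (Ite e c d) \<longleftrightarrow> bounded c \<and> bounded d"
| "bounded (For i c) \<longleftrightarrow> bounded c \<and> i \<noteq> 0 \<and> 0 \<notin> writes c \<and> i \<notin> writes c"

text \<open>The variable is the number \<open>m\<close> of edges. A loop pays for the initial store
  and the failing test, and in each of \<open>2 m\<close> rounds for a test, an increment and the
  body.\<close>

primrec cost :: "prog \<Rightarrow> nat poly" where
  "cost Skip = 1"
| "cost (Assign a e f) = 1"
| "cost (c ;; d) = cost c + cost d"
| "cost (Ite e c d) = 1 + cost c + cost d"
| "cost (For i c) = 2 + [:0, 2:] * (2 + cost c)"

lemma put_other [simp]: "a \<noteq> i \<Longrightarrow> put i j s a = s a"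
  by (simp add: put_def)

lemma put_same [simp]: "put i j s i 0 = j"
  by (simp add: put_def)

lemma sem_frame: "a \<notin> writes c \<Longrightarrow> sem c s a = s a"
proof (induction c arbitrary: s)
  case (For i c)
  have "fold (\<lambda>j t. sem c (put i j t)) js s a = s a" for js
    using For by (induction js arbitrary: s) auto
  with For.prems show ?case by simp
qed auto

lemma exec_loop:
  assumes body: "\<And>s. s 0 1 = m \<Longrightarrow> \<exists>t \<le> w. exec c s t (f s)"
    and f: "\<And>s. f s 0 = s 0" "\<And>s. f s i 0 = s i 0" and "i \<noteq> 0"
    and "s 0 1 = m" "j \<le> 2 * m"
  shows "\<exists>t \<le> 1 + (2 * m - j) * (2 + w).
    exec (While (Minus bound (Var i)) (Seq c (Store i (Const 0) (Plus (Var i) (Const 1)))))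
      (put i j s) t (put i (2 * m) (fold (\<lambda>j t. f (put i j t)) [j..<2 * m] s))"
  using assms(5,6)
proof (induction "2 * m - j" arbitrary: j s)
  case 0
  then have "aval (Minus bound (Var i)) (put i j s) = 0" "j = 2 * m" using \<open>i \<noteq> 0\<close> by auto
  from exec.WhileFalse[OF this(1)] this(2) show ?case by (intro exI[of _ 1]) simp
next
  case (Suc n)
  let ?s = "f (put i j s)"
  have "exec (Store i (Const 0) (Plus (Var i) (Const 1))) ?s 1 (put i (Suc j) ?s)"
    using exec.Store[of i "Const 0" "Plus (Var i) (Const 1)" ?s] by (simp add: put_def f)
  moreover obtain t where t: "t \<le> w" "exec c (put i j s) t ?s"
    using body[of "put i j s"] Suc.prems(1) \<open>i \<noteq> 0\<close> by auto
  ultimately have 1: "exec (Seq c (Store i (Const 0) (Plus (Var i) (Const 1))))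
    (put i j s) (t + 1) (put i (Suc j) ?s)"
    by (blast intro: exec.Seq)
  have "n = 2 * m - Suc j" "?s 0 1 = m" "Suc j \<le> 2 * m"
    using Suc \<open>i \<noteq> 0\<close> by (auto simp: f)
  from Suc.hyps(1)[where j = "Suc j" and s = ?s, OF this] obtain u where u: "u \<le> 1 + (2 * m - Suc j) * (2 + w)"
    "exec (While (Minus bound (Var i)) (Seq c (Store i (Const 0) (Plus (Var i) (Const 1)))))
      (put i (Suc j) ?s) u (put i (2 * m) (fold (\<lambda>j t. f (put i j t)) [Suc j..<2 * m] ?s))"
    by blast
  have "aval (Minus bound (Var i)) (put i j s) \<noteq> 0" using Suc \<open>i \<noteq> 0\<close> by simp
  from exec.WhileTrue[OF this 1 u(2)] have
    "exec (While (Minus bound (Var i)) (Seq c (Store i (Const 0) (Plus (Var i) (Const 1)))))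
      (put i j s) (Suc (t + 1 + u)) (put i (2 * m) (fold (\<lambda>j t. f (put i j t)) [j..<2 * m] s))"
    using Suc by (simp add: upt_conv_Cons)
  moreover have "2 * m - j = Suc (2 * m - Suc j)" using Suc by simp
  then have "Suc (t + 1 + u) \<le> 1 + (2 * m - j) * (2 + w)" using t(1) u(1) by simp
  ultimately show ?case by blast
qed

lemma exec_compile:
  assumes "bounded c" "s 0 1 = m"
  shows "\<exists>t \<le> poly (cost c) m. exec (compile c) s t (sem c s)"
  using assms
proof (induction c arbitrary: s)
  case Skip
  have "exec (compile Skip) s 1 (sem Skip s)"
    using exec.Store[of 0 "Const 0" "Var 0" s] by simp
  then show ?case by (metis cost.simps(1) poly_1 order_refl)
next
  case (Assign a e f)
  have "exec (compile (Assign a e f)) s 1 (sem (Assign a e f) s)"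
    using exec.Store[of a e f s] by simp
  then show ?case by (metis cost.simps(2) poly_1 order_refl)
next
  case (Comp c d)
  then have "sem c s 0 1 = m" by (simp add: sem_frame)
  then obtain t u where "t \<le> poly (cost c) m" "exec (compile c) s t (sem c s)"
    "u \<le> poly (cost d) m" "exec (compile d) (sem c s) u (sem d (sem c s))"
    using Comp by fastforce
  then show ?case by (intro exI[of _ "t + u"]) (auto intro: exec.Seq)
next
  case (Ite e c d)
  obtain t u where "t \<le> poly (cost c) m" "exec (compile c) s t (sem c s)"
    "u \<le> poly (cost d) m" "exec (compile d) s u (sem d s)"
    using Ite by fastforce
  then show ?case
    by (intro exI[of _ "if aval e s \<noteq> 0 then Suc t else Suc u"])
      (auto intro: exec.CondTrue exec.CondFalse)
next
  case (For i c)
  have "\<exists>t \<le> 1 + (2 * m - 0) * (2 + poly (cost c) m).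
    exec (While (Minus bound (Var i)) (Seq (compile c) (Store i (Const 0) (Plus (Var i) (Const 1)))))
      (put i 0 s) t (put i (2 * m) (fold (\<lambda>j t. sem c (put i j t)) [0..<2 * m] s))"
    using For by (intro exec_loop) (auto simp: sem_frame)
  then obtain t where t: "t \<le> 1 + 2 * m * (2 + poly (cost c) m)"
    "exec (While (Minus bound (Var i)) (Seq (compile c) (Store i (Const 0) (Plus (Var i) (Const 1)))))
      (put i 0 s) t (sem (For i c) s)"
    using For.prems by auto
  moreover have "exec (Store i (Const 0) (Const 0)) s 1 (put i 0 s)"
    using exec.Store[of i "Const 0" "Const 0" s] by (simp add: put_def)
  ultimately have "exec (compile (For i c)) s (1 + t) (sem (For i c) s)"
    unfolding compile.simps by (blast intro: exec.Seq)
  moreover have "1 + t \<le> poly (cost (For i c)) m" using t by (simp add: algebra_simps)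
  ultimately show ?case by blast
qed

lemma poly_nat_mono: "a \<le> b \<Longrightarrow> poly p a \<le> poly p b" for p :: "nat poly"
  by (induction p) (auto intro: add_mono mult_mono)

text \<open>An invariant rule with a built-in frame: inside the body, arrays that are not written
  still have their initial content. The second premise keeps the invariant independent of the
  counter, which is overwritten in each round.\<close>

lemma For_rule:
  assumes "P 0 s" and "\<And>j k t. P j t \<Longrightarrow> P j (put i k t)"
    and "\<And>j t. j < 2 * s 0 1 \<Longrightarrow> (\<And>a. a \<noteq> i \<Longrightarrow> a \<notin> writes c \<Longrightarrow> t a = s a) \<Longrightarrow> t i 0 = j \<Longrightarrow>
      P j t \<Longrightarrow> P (Suc j) (sem c t)"
  shows "P (2 * s 0 1) (sem (For i c) s)"
proof -
  let ?f = "\<lambda>n. fold (\<lambda>j t. sem c (put i j t)) [0..<n] s"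
  have "P n (?f n) \<and> (\<forall>a. a \<noteq> i \<longrightarrow> a \<notin> writes c \<longrightarrow> ?f n a = s a)" if "n \<le> 2 * s 0 1" for n
    using that
  proof (induction n)
    case (Suc n)
    then show ?case using assms(2) by (auto simp: sem_frame intro!: assms(3))
  qed (use assms(1) in simp)
  then show ?thesis using assms(2) by simp
qed

section \<open>Testing connectivity\<close>

text \<open>Arrays 0 to 5 hold the input and 30 to 46 are loop counters. Edges are represented by
  their index; those from the number of edges up to twice that number are auxiliary edges from a
  vertex to the root of its strong component.\<close>

abbreviation (input) "TL \<equiv> (6::nat)"
abbreviation (input) "HD \<equiv> (7::nat)"
abbreviation (input) "REQ \<equiv> (8::nat)"
abbreviation (input) "CUR \<equiv> (9::nat)"
abbreviation (input) "NEC \<equiv> (10::nat)"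
abbreviation (input) "SEL \<equiv> (11::nat)"
abbreviation (input) "STACK \<equiv> (12::nat)"
abbreviation (input) "TOP \<equiv> (13::nat)"
abbreviation (input) "OK \<equiv> (14::nat)"
abbreviation (input) "ANC \<equiv> (15::nat)"
abbreviation (input) "DESC \<equiv> (16::nat)"
abbreviation (input) "COMP \<equiv> (17::nat)"
abbreviation (input) "MARK \<equiv> (18::nat)"
abbreviation (input) "GOOD \<equiv> (19::nat)"
abbreviation (input) "BEST \<equiv> (20::nat)"
abbreviation (input) "VALUE \<equiv> (21::nat)"
abbreviation (input) "COUNT \<equiv> (22::nat)"
abbreviation (input) "OUT \<equiv> (23::nat)"
abbreviation (input) "ROOT \<equiv> (24::nat)"
abbreviation (input) "EDGE \<equiv> (25::nat)"

definition flags :: "state \<Rightarrow> nat \<Rightarrow> nat set" where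
  "flags s a = {i. i < 2 * s 0 1 \<and> s a i \<noteq> 0}"

abbreviation graph :: "state \<Rightarrow> nat \<Rightarrow> nat \<Rightarrow> nat \<Rightarrow> (nat \<times> nat) set" where
  "graph s src dst P \<equiv> arc_rel (s src) (s dst) (flags s P)"

lemma flags_upd [simp]: "x \<noteq> a \<Longrightarrow> x \<noteq> 0 \<Longrightarrow> flags (s(x := f)) a = flags s a"
  by (simp add: flags_def)

lemma flags_put [simp]: "i \<noteq> a \<Longrightarrow> i \<noteq> 0 \<Longrightarrow> flags (put i j s) a = flags s a"
  by (simp add: flags_def)

lemma flags_frame [simp]: "a \<notin> writes c \<Longrightarrow> 0 \<notin> writes c \<Longrightarrow> flags (sem c s) a = flags s a"
  by (simp add: flags_def sem_frame)

lemma flags_cong: "s a = t a \<Longrightarrow> s 0 = t 0 \<Longrightarrow> flags s a = flags t a"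
  by (simp add: flags_def)

text \<open>Vertices are arbitrary numbers used as array indices, so only the marks at ends of edges
  are cleared. The inner condition asks whether the tail is marked or equals the root; equality is
  tested as 1 minus the distance, in truncated subtraction. The root itself starts unmarked, so only
  nonempty walks count.\<close>

definition reach :: "nat \<Rightarrow> nat \<Rightarrow> nat \<Rightarrow> nat \<Rightarrow> prog" where
  "reach src dst P M =
     For 30 (Assign M (Cell src (Var 30)) (Const 0) ;; Assign M (Cell dst (Var 30)) (Const 0)) ;;
     For 31 (For 30 (Ite (Cell P (Var 30))
       (Ite (Plus (Cell M (Cell src (Var 30)))
               (Minus (Const 1) (Plus (Minus (Cell src (Var 30)) (Var ROOT)) (Minus (Var ROOT) (Cell src (Var 30))))))
         (Assign M (Cell dst (Var 30)) (Const 1)) Skip) Skip))"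

lemma writes_reach [simp]: "writes (reach src dst P M) = {M, 30, 31}"
  by (auto simp: reach_def)

lemma bounded_reach [simp]: "0 < M \<Longrightarrow> M \<noteq> 30 \<Longrightarrow> M \<noteq> 31 \<Longrightarrow> bounded (reach src dst P M)"
  by (simp add: reach_def)

declare sem_frame [simp]

lemma finite_flags [simp]: "finite (flags s a)"
  by (simp add: flags_def)

lemma sem_reach:
  assumes M: "M \<notin> {0, 30, 31, ROOT, src, dst, P}" and "{src, dst, P} \<inter> {30, 31} = {}"
    and v: "v \<in> s src ` {..<2 * s 0 1} \<union> s dst ` {..<2 * s 0 1}"
  shows "sem (reach src dst P M) s M v \<noteq> 0 \<longleftrightarrow> (s ROOT 0, v) \<in> (graph s src dst P)\<^sup>+"
proof -
  let ?R = "graph s src dst P" and ?n = "2 * s 0 1" and ?r = "s ROOT 0"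
  define V where "V = s src ` {..<?n} \<union> s dst ` {..<?n}"
  have neq: "src \<noteq> M" "dst \<noteq> M" "P \<noteq> M" "src \<noteq> 30" "dst \<noteq> 30" "P \<noteq> 30" "src \<noteq> 31" "dst \<noteq> 31" "P \<noteq> 31"
    "M \<noteq> 30" "M \<noteq> 31" "M \<noteq> 0" "M \<noteq> ROOT"
    using assms by auto
  define clear where "clear = Assign M (Cell src (Var 30)) (Const 0) ;; Assign M (Cell dst (Var 30)) (Const 0)"
  define step where "step = Ite (Cell P (Var 30))
       (Ite (Plus (Cell M (Cell src (Var 30)))
               (Minus (Const 1) (Plus (Minus (Cell src (Var 30)) (Var ROOT)) (Minus (Var ROOT) (Cell src (Var 30))))))
         (Assign M (Cell dst (Var 30)) (Const 1)) Skip) Skip"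
  have wc: "writes clear = {M}" and ws: "writes step = {M}"
    by (auto simp: clear_def step_def)
  define s1 where "s1 = sem (For 30 clear) s"
  have s1: "s1 a = s a" if "a \<noteq> M" "a \<noteq> 30" for a
    using that unfolding s1_def by (intro sem_frame) (simp add: wc)
  have "\<forall>i<?n. s1 M (s src i) = 0 \<and> s1 M (s dst i) = 0"
    unfolding s1_def
  proof (rule For_rule[where P = "\<lambda>j t. \<forall>i<j. t M (s src i) = 0 \<and> t M (s dst i) = 0"])
    fix j t assume "\<And>a. a \<noteq> 30 \<Longrightarrow> a \<notin> writes clear \<Longrightarrow> t a = s a" "t 30 0 = j"
      "\<forall>i<j. t M (s src i) = 0 \<and> t M (s dst i) = 0"
    moreover from this(1) have "t src = s src" "t dst = s dst" using neq by (simp_all add: wc)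
    ultimately show "\<forall>i<Suc j. sem clear t M (s src i) = 0 \<and> sem clear t M (s dst i) = 0"
      using neq by (auto simp: clear_def less_Suc_eq)
  qed (use neq in auto)
  then have init: "s1 M v = 0" if "v \<in> V" for v
    using that by (auto simp: V_def)
  \<comment> \<open>Marks are updated in place, so a round can get farther than one step. Soundness
    of the marks and the guaranteed progress per round are therefore tracked separately.\<close>
  define sound where "sound t \<longleftrightarrow> (\<forall>v\<in>V. t M v \<noteq> 0 \<longrightarrow> (?r, v) \<in> ?R\<^sup>+)" for t :: state
  have round: "sound (sem (For 30 step) t) \<and> (\<forall>v. t M v \<noteq> 0 \<longrightarrow> sem (For 30 step) t M v \<noteq> 0) \<and>
      (\<forall>i<?n. s P i \<noteq> 0 \<longrightarrow> t M (s src i) \<noteq> 0 \<or> s src i = ?r \<longrightarrow> sem (For 30 step) t M (s dst i) \<noteq> 0)"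
    if t: "sound t" "\<forall>a. a \<notin> {M, 30, 31} \<longrightarrow> t a = s a" for t
  proof -
    have t0: "t 0 1 = s 0 1" using t(2) neq by simp
    have "sound (sem (For 30 step) t) \<and> (\<forall>v. t M v \<noteq> 0 \<longrightarrow> sem (For 30 step) t M v \<noteq> 0) \<and>
      (\<forall>i<2 * t 0 1. s P i \<noteq> 0 \<longrightarrow> t M (s src i) \<noteq> 0 \<or> s src i = ?r \<longrightarrow> sem (For 30 step) t M (s dst i) \<noteq> 0)"
    proof (rule For_rule[where P = "\<lambda>j u. sound u \<and> (\<forall>v. t M v \<noteq> 0 \<longrightarrow> u M v \<noteq> 0) \<and>
        (\<forall>i<j. s P i \<noteq> 0 \<longrightarrow> t M (s src i) \<noteq> 0 \<or> s src i = ?r \<longrightarrow> u M (s dst i) \<noteq> 0)"])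
      fix j u assume j: "j < 2 * t 0 1" "\<And>a. a \<noteq> 30 \<Longrightarrow> a \<notin> writes step \<Longrightarrow> u a = t a" "u 30 0 = j"
        and IH: "sound u \<and> (\<forall>v. t M v \<noteq> 0 \<longrightarrow> u M v \<noteq> 0) \<and>
          (\<forall>i<j. s P i \<noteq> 0 \<longrightarrow> t M (s src i) \<noteq> 0 \<or> s src i = ?r \<longrightarrow> u M (s dst i) \<noteq> 0)"
      have u: "u a = s a" if "a \<notin> {M, 30, 31}" for a using that j(2) t(2) by (simp add: ws)
      have eq: "u src = s src" "u dst = s dst" "u P = s P" "u ROOT = s ROOT" using u neq by auto
      have sem: "sem step u M = (if s P j \<noteq> 0 \<and> (u M (s src j) \<noteq> 0 \<or> s src j = ?r)
        then (u M)(s dst j := 1) else u M)"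
        using j(3) by (auto simp: step_def eq)
      have V: "s src j \<in> V" "s dst j \<in> V" using j(1) t0 by (auto simp: V_def)
      have "(?r, s dst j) \<in> ?R\<^sup>+" if "s P j \<noteq> 0" "u M (s src j) \<noteq> 0 \<or> s src j = ?r"
      proof -
        have e: "(s src j, s dst j) \<in> ?R" using that j(1) t0 by (auto simp: arc_rel_def flags_def)
        moreover have "s src j = ?r \<or> (?r, s src j) \<in> ?R\<^sup>+" using that(2) IH V by (auto simp: sound_def)
        ultimately show ?thesis by (auto intro: trancl_into_trancl)
      qed
      then have "sound (sem step u)" using IH by (auto simp: sound_def sem)
      then show "sound (sem step u) \<and> (\<forall>v. t M v \<noteq> 0 \<longrightarrow> sem step u M v \<noteq> 0) \<and>
        (\<forall>i<Suc j. s P i \<noteq> 0 \<longrightarrow> t M (s src i) \<noteq> 0 \<or> s src i = ?r \<longrightarrow> sem step u M (s dst i) \<noteq> 0)"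
        using IH by (auto simp: sem less_Suc_eq)
    qed (use t neq in \<open>auto simp: sound_def\<close>)
    then show ?thesis unfolding t0 .
  qed
  let ?c = "For 31 (For 30 step)"
  have s10: "s1 0 1 = s 0 1" using s1[of 0] neq by simp
  have sem: "sound (sem ?c s1) \<and> (\<forall>v\<in>V. \<forall>n. 0 < n \<and> n \<le> 2 * s1 0 1 \<longrightarrow> (?r, v) \<in> ?R ^^ n \<longrightarrow> sem ?c s1 M v \<noteq> 0)"
  proof (rule For_rule[where P = "\<lambda>k t. sound t \<and>
      (\<forall>v\<in>V. \<forall>n. 0 < n \<and> n \<le> k \<longrightarrow> (?r, v) \<in> ?R ^^ n \<longrightarrow> t M v \<noteq> 0)"])
    fix k t assume j: "\<And>a. a \<noteq> 31 \<Longrightarrow> a \<notin> writes (For 30 step) \<Longrightarrow> t a = s1 a"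
      and IH: "sound t \<and> (\<forall>v\<in>V. \<forall>n. 0 < n \<and> n \<le> k \<longrightarrow> (?r, v) \<in> ?R ^^ n \<longrightarrow> t M v \<noteq> 0)"
    have "\<forall>a. a \<notin> {M, 30, 31} \<longrightarrow> t a = s a" using j s1 by (simp add: ws)
    note rd = round[OF conjunct1[OF IH] this]
    show "sound (sem (For 30 step) t) \<and> (\<forall>v\<in>V. \<forall>n. 0 < n \<and> n \<le> Suc k \<longrightarrow> (?r, v) \<in> ?R ^^ n \<longrightarrow>
        sem (For 30 step) t M v \<noteq> 0)"
    proof (intro conjI ballI allI impI)
      show "sound (sem (For 30 step) t)" using rd by blast
    next
      fix v n assume vn: "v \<in> V" "0 < n \<and> n \<le> Suc k" "(?r, v) \<in> ?R ^^ n"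
      then obtain n' where n: "n = Suc n'" "n' \<le> k" by (cases n) auto
      then obtain w where w: "(?r, w) \<in> ?R ^^ n'" "(w, v) \<in> ?R" using vn(3) by auto
      then obtain i where i: "i < ?n" "s P i \<noteq> 0" "w = s src i" "v = s dst i"
        by (auto simp: arc_rel_def flags_def)
      have "w \<in> V" using i by (auto simp: V_def)
      then have "t M w \<noteq> 0 \<or> w = ?r" using IH w(1) n(2) by (cases "n' = 0") auto
      then show "sem (For 30 step) t M v \<noteq> 0" using rd i(1,2) unfolding i(3,4) by blast
    qed
  qed (use neq init in \<open>auto simp: sound_def\<close>)
  \<comment> \<open>Walks no longer than the number of arcs suffice, and this number is at most the
    number of rounds.\<close>
  have trancl: "?R\<^sup>+ = (\<Union>n\<in>{n. 0 < n \<and> n \<le> card ?R}. ?R ^^ n)"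
    by (intro trancl_finite_eq_relpow) (simp add: arc_rel_def)
  have card: "card ?R \<le> ?n"
  proof -
    have "card ?R \<le> card (flags s P)" unfolding arc_rel_def by (rule card_image_le) simp
    also have "\<dots> \<le> card {..<?n}" by (intro card_mono) (auto simp: flags_def)
    finally show ?thesis by simp
  qed
  have "v \<in> V" using v by (simp add: V_def)
  have "sem ?c s1 M v \<noteq> 0 \<longleftrightarrow> (?r, v) \<in> ?R\<^sup>+"
  proof
    assume "(?r, v) \<in> ?R\<^sup>+"
    then obtain n where "0 < n" "n \<le> card ?R" "(?r, v) \<in> ?R ^^ n" unfolding trancl by blast
    then show "sem ?c s1 M v \<noteq> 0" using sem card \<open>v \<in> V\<close> unfolding s10 by (meson le_trans)
  qed (use sem \<open>v \<in> V\<close> in \<open>simp add: sound_def\<close>)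
  moreover have "sem (reach src dst P M) s = sem ?c s1"
    by (simp add: reach_def s1_def clear_def step_def)
  ultimately show ?thesis by simp
qed

text \<open>The truncated difference of the edge number and the index is nonzero exactly for genuine
  edges. This guard recurs, since every loop also passes over the auxiliary indices.\<close>

definition test :: "nat \<Rightarrow> prog" where
  "test P = OK ::= Const 1 ;;
     For 32 (Ite (Minus (Cell 0 (Const 1)) (Var 32))
       (ROOT ::= Cell TL (Var 32) ;; reach TL HD P MARK ;;
        Ite (Cell MARK (Cell HD (Var 32))) Skip (OK ::= Const 0)) Skip)"

text \<open>The reference is the set of all input edges, including those deleted at the start of an
  attempt, so that one test serves all attempts.\<close>

definition connects :: "state \<Rightarrow> nat set \<Rightarrow> bool" where
  "connects s P \<longleftrightarrow> arc_rel (s TL) (s HD) {..<s 0 1} \<subseteq> (arc_rel (s TL) (s HD) P)\<^sup>+"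

lemma writes_test [simp]: "writes (test P) = {OK, ROOT, MARK, 30, 31, 32}"
  by (auto simp: test_def)

lemma bounded_test [simp]: "bounded (test P)"
  by (simp add: test_def)

lemma connects_cong: "s TL = t TL \<Longrightarrow> s HD = t HD \<Longrightarrow> s 0 = t 0 \<Longrightarrow> connects s = connects t"
  by (simp add: connects_def[abs_def])

lemma mono_connects: "mono (connects s)"
  unfolding connects_def arc_rel_def
  by (intro monoI le_boolI) (meson image_mono order_trans trancl_mono_subset)

lemma sem_test:
  assumes "P \<notin> {OK, ROOT, MARK, 30, 31, 32}"
  shows "sem (test P) s OK 0 \<noteq> 0 \<longleftrightarrow> connects s (flags s P)"
proof -
  define body where "body = Ite (Minus (Cell 0 (Const 1)) (Var 32))
       (ROOT ::= Cell TL (Var 32) ;; reach TL HD P MARK ;;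
        Ite (Cell MARK (Cell HD (Var 32))) Skip (OK ::= Const 0)) Skip"
  have w: "writes body = {OK, ROOT, MARK, 30, 31}" by (auto simp: body_def)
  define s1 where "s1 = s(OK := (s OK)(0 := 1))"
  let ?R = "graph s TL HD P"
  have "sem (For 32 body) s1 OK 0 \<noteq> 0 \<longleftrightarrow> (\<forall>i<2 * s1 0 1. i < s 0 1 \<longrightarrow> (s TL i, s HD i) \<in> ?R\<^sup>+)"
  proof (rule For_rule[where P = "\<lambda>j t. t OK 0 \<noteq> 0 \<longleftrightarrow> (\<forall>i<j. i < s 0 1 \<longrightarrow> (s TL i, s HD i) \<in> ?R\<^sup>+)"])
    fix j t assume j: "\<And>a. a \<noteq> 32 \<Longrightarrow> a \<notin> writes body \<Longrightarrow> t a = s1 a" "t 32 0 = j"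
      and IH: "t OK 0 \<noteq> 0 \<longleftrightarrow> (\<forall>i<j. i < s 0 1 \<longrightarrow> (s TL i, s HD i) \<in> ?R\<^sup>+)"
    have eq: "t 0 = s 0" "t TL = s TL" "t HD = s HD" "t P = s P"
      using j(1) assms by (auto simp: w s1_def)
    let ?t = "t(ROOT := (t ROOT)(0 := s TL j))"
    have "flags ?t P = flags s P" using assms eq by (auto simp: flags_def)
    then have mark: "sem (reach TL HD P MARK) ?t MARK (s HD j) \<noteq> 0 \<longleftrightarrow> (s TL j, s HD j) \<in> ?R\<^sup>+"
      if "j < s 0 1"
      using assms that by (subst sem_reach) (auto simp: eq)
    have "sem body t OK 0 = (if j < s 0 1 \<and> (s TL j, s HD j) \<notin> ?R\<^sup>+ then 0 else t OK 0)"
      using mark by (simp add: body_def eq j(2))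
    then show "sem body t OK 0 \<noteq> 0 \<longleftrightarrow> (\<forall>i<Suc j. i < s 0 1 \<longrightarrow> (s TL i, s HD i) \<in> ?R\<^sup>+)"
      using IH by (auto simp: less_Suc_eq)
  qed (auto simp: s1_def)
  moreover have "sem (test P) s = sem (For 32 body) s1"
    by (simp add: test_def body_def s1_def)
  ultimately show ?thesis by (auto simp: connects_def s1_def arc_rel_def)
qed

definition delete :: "nat \<Rightarrow> prog" where
  "delete P = Ite (Cell P (Var EDGE)) (Assign P (Var EDGE) (Const 0) ;; test P ;;
     Ite (Var OK) Skip (Assign P (Var EDGE) (Const 1))) Skip"

lemma writes_delete [simp]: "writes (delete P) = {P, OK, ROOT, MARK, 30, 31, 32}"
  by (auto simp: delete_def)

lemma bounded_delete [simp]: "0 < P \<Longrightarrow> bounded (delete P)"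
  by (simp add: delete_def)

lemma sem_delete:
  assumes P: "P \<notin> {0, OK, ROOT, MARK, EDGE, TL, HD, 30, 31, 32}" and "s EDGE 0 < 2 * s 0 1"
  shows "flags (sem (delete P) s) P = prune (connects s) (s EDGE 0) (flags s P)"
proof -
  define s1 where "s1 = s(P := (s P)(s EDGE 0 := 0))"
  define s2 where "s2 = sem (test P) s1"
  have s1: "s1 a = s a" if "a \<noteq> P" for a using that by (simp add: s1_def)
  have s2: "s2 a = s1 a" if "a \<notin> {OK, ROOT, MARK, 30, 31, 32}" for a
    using that unfolding s2_def by (intro sem_frame) simp
  have f1: "flags s1 P = flags s P - {s EDGE 0}"
    using P by (auto simp: flags_def s1_def)
  have ok: "s2 OK 0 \<noteq> 0 \<longleftrightarrow> connects s (flags s P - {s EDGE 0})"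
    using sem_test[of P s1] P connects_cong[of s1 s] s1 by (simp add: s2_def f1)
  have "sem (delete P) s P = (if s P (s EDGE 0) = 0 \<or> s2 OK 0 \<noteq> 0 then s1 P else (s1 P)(s EDGE 0 := 1))"
    using s2 s1 P by (auto simp: delete_def s1_def[symmetric] s2_def[symmetric], auto simp: s1_def)
  moreover have "sem (delete P) s 0 = s 0" using P by (intro sem_frame) simp
  ultimately show ?thesis using ok assms(2) f1 P
    by (auto simp: prune_def flags_def s1_def split: if_splits)
qed

text \<open>Round \<open>j\<close> takes the stack entry at \<open>TOP - (j + 1)\<close>, so the
  edge pushed last is tried first, as in \<open>chain_prune\<close>.\<close>

definition unstack :: prog where
  "unstack = For 33 (Ite (Minus (Var TOP) (Var 33))
     (EDGE ::= Cell STACK (Minus (Var TOP) (Plus (Var 33) (Const 1))) ;; delete SEL) Skip)"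

definition stack :: "state \<Rightarrow> nat list" where
  "stack s = map (s STACK) [0..<s TOP 0]"

lemma writes_unstack [simp]: "writes unstack = {33, EDGE, SEL, OK, ROOT, MARK, 30, 31, 32}"
  by (auto simp: unstack_def)

lemma bounded_unstack [simp]: "bounded unstack"
  by (simp add: unstack_def)

lemma sem_unstack:
  assumes "set (stack s) \<subseteq> {..<2 * s 0 1}" "s TOP 0 \<le> 2 * s 0 1"
  shows "flags (sem unstack s) SEL = fold (prune (connects s)) (rev (stack s)) (flags s SEL)"
proof -
  define body where "body = Ite (Minus (Var TOP) (Var 33))
     (EDGE ::= Cell STACK (Minus (Var TOP) (Plus (Var 33) (Const 1))) ;; delete SEL) Skip"
  have w: "writes body = {EDGE, SEL, OK, ROOT, MARK, 30, 31, 32}" by (auto simp: body_def)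
  let ?xs = "rev (stack s)"
  have "flags (sem (For 33 body) s) SEL =
    fold (prune (connects s)) (take (2 * s 0 1) ?xs) (flags s SEL)"
  proof (rule For_rule[where P = "\<lambda>j t. flags t SEL = fold (prune (connects s)) (take j ?xs) (flags s SEL)"])
    fix j t assume j: "\<And>a. a \<noteq> 33 \<Longrightarrow> a \<notin> writes body \<Longrightarrow> t a = s a" "t 33 0 = j"
      and IH: "flags t SEL = fold (prune (connects s)) (take j ?xs) (flags s SEL)"
    have eq: "t 0 = s 0" "t TL = s TL" "t HD = s HD" "t STACK = s STACK" "t TOP = s TOP"
      using j(1) by (auto simp: w)
    show "flags (sem body t) SEL = fold (prune (connects s)) (take (Suc j) ?xs) (flags s SEL)"
    proof (cases "j < s TOP 0")
      case True
      then have x: "?xs ! j = s STACK (s TOP 0 - Suc j)" and len: "j < length ?xs"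
        by (simp_all add: stack_def rev_nth)
      have "?xs ! j \<in> set (stack s)" using nth_mem[OF len] by simp
      then have lt: "?xs ! j < 2 * s 0 1" using assms(1) by auto
      define t1 where "t1 = t(EDGE := (t EDGE)(0 := ?xs ! j))"
      have "sem body t = sem (delete SEL) t1"
        using True x eq j(2) by (simp add: body_def t1_def)
      moreover have "flags (sem (delete SEL) t1) SEL = prune (connects t1) (t1 EDGE 0) (flags t1 SEL)"
        using lt eq by (intro sem_delete) (auto simp: t1_def)
      moreover have "connects t1 = connects s" using eq by (intro connects_cong) (auto simp: t1_def)
      moreover have "flags t1 SEL = flags t SEL" by (rule flags_cong) (auto simp: t1_def)
      ultimately show ?thesis using IH len by (simp add: take_Suc_conv_app_nth t1_def)
    next
      case False
      then have "sem body t = t" using eq j(2) by (simp add: body_def)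
      then show ?thesis using IH False by (simp add: stack_def)
    qed
  qed (auto simp: flags_def)
  moreover have "take (2 * s 0 1) ?xs = ?xs" using assms(2) by (simp add: stack_def)
  ultimately show ?thesis by (simp add: unstack_def body_def)
qed

section \<open>Collecting and pruning the cuts\<close>

definition reach_from :: "nat \<Rightarrow> nat \<Rightarrow> nat \<Rightarrow> nat \<Rightarrow> prog" where
  "reach_from src dst P M = reach src dst P M ;; Assign M (Var ROOT) (Const 1)"

lemma writes_reach_from [simp]: "writes (reach_from src dst P M) = {M, 30, 31}"
  by (auto simp: reach_from_def)

lemma bounded_reach_from [simp]:
  "0 < M \<Longrightarrow> M \<noteq> 30 \<Longrightarrow> M \<noteq> 31 \<Longrightarrow> bounded (reach_from src dst P M)"
  by (simp add: reach_from_def)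

lemma sem_reach_from:
  assumes "M \<notin> {0, 30, 31, ROOT, src, dst, P}" "{src, dst, P} \<inter> {30, 31} = {}"
    and "v \<in> s src ` {..<2 * s 0 1} \<union> s dst ` {..<2 * s 0 1}"
  shows "sem (reach_from src dst P M) s M v \<noteq> 0 \<longleftrightarrow> (s ROOT 0, v) \<in> (graph s src dst P)\<^sup>*"
  using assms sem_reach[OF assms] by (auto simp: reach_from_def rtrancl_eq_or_trancl)

text \<open>Decides \<open>cut_at\<close> for a current edge from the marks. Looking at the tails of
  edges replaces the quantifier over all vertices: whatever reaches the head of the edge, other than
  the head itself, is the tail of some edge.\<close>

definition source_test :: "nat \<Rightarrow> prog" where
  "source_test src = GOOD ::= Const 1 ;;
     Ite (Cell ANC (Cell src (Var 35))) (GOOD ::= Const 0) Skip ;;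
     Ite (Cell COMP (Cell src (Var 35))) Skip (GOOD ::= Const 0) ;;
     For 36 (Ite (Cell ANC (Cell src (Var 36))) (Ite (Cell COMP (Cell src (Var 36)))
       (Ite (Cell DESC (Cell src (Var 36))) Skip (GOOD ::= Const 0)) Skip) Skip)"

lemma writes_source_test [simp]: "writes (source_test src) = {GOOD, 36}"
  by (auto simp: source_test_def)

lemma bounded_source_test [simp]: "bounded (source_test src)"
  by (simp add: source_test_def)

lemma sem_source_test:
  assumes "src \<notin> {GOOD, 36}"
  shows "sem (source_test src) s GOOD 0 \<noteq> 0 \<longleftrightarrow>
    s ANC (s src (s 35 0)) = 0 \<and> s COMP (s src (s 35 0)) \<noteq> 0 \<and>
    (\<forall>i<2 * s 0 1. s ANC (s src i) \<noteq> 0 \<longrightarrow> s COMP (s src i) \<noteq> 0 \<longrightarrow> s DESC (s src i) \<noteq> 0)"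
proof -
  define body where "body = Ite (Cell ANC (Cell src (Var 36))) (Ite (Cell COMP (Cell src (Var 36)))
       (Ite (Cell DESC (Cell src (Var 36))) Skip (GOOD ::= Const 0)) Skip) Skip"
  have w: "writes body = {GOOD}" by (auto simp: body_def)
  define pre where "pre = GOOD ::= Const 1 ;;
     Ite (Cell ANC (Cell src (Var 35))) (GOOD ::= Const 0) Skip ;;
     Ite (Cell COMP (Cell src (Var 35))) Skip (GOOD ::= Const 0)"
  have wp: "writes pre = {GOOD}" by (auto simp: pre_def)
  let ?s = "sem pre s"
  have pre: "?s GOOD 0 \<noteq> 0 \<longleftrightarrow> s ANC (s src (s 35 0)) = 0 \<and> s COMP (s src (s 35 0)) \<noteq> 0"
    using assms by (simp add: pre_def)
  have "sem (For 36 body) ?s GOOD 0 \<noteq> 0 \<longleftrightarrow> ?s GOOD 0 \<noteq> 0 \<and>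
    (\<forall>i<2 * ?s 0 1. s ANC (s src i) \<noteq> 0 \<longrightarrow> s COMP (s src i) \<noteq> 0 \<longrightarrow> s DESC (s src i) \<noteq> 0)"
  proof (rule For_rule[where P = "\<lambda>j t. t GOOD 0 \<noteq> 0 \<longleftrightarrow> ?s GOOD 0 \<noteq> 0 \<and>
      (\<forall>i<j. s ANC (s src i) \<noteq> 0 \<longrightarrow> s COMP (s src i) \<noteq> 0 \<longrightarrow> s DESC (s src i) \<noteq> 0)"])
    fix j t assume j: "\<And>a. a \<noteq> 36 \<Longrightarrow> a \<notin> writes body \<Longrightarrow> t a = ?s a" "t 36 0 = j"
      and IH: "t GOOD 0 \<noteq> 0 \<longleftrightarrow> ?s GOOD 0 \<noteq> 0 \<and>
        (\<forall>i<j. s ANC (s src i) \<noteq> 0 \<longrightarrow> s COMP (s src i) \<noteq> 0 \<longrightarrow> s DESC (s src i) \<noteq> 0)"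
    have eq: "t ANC = s ANC" "t COMP = s COMP" "t DESC = s DESC" "t src = s src"
      using assms by (simp_all add: j(1) w wp)
    have "sem body t GOOD 0 = (if s ANC (s src j) \<noteq> 0 \<and> s COMP (s src j) \<noteq> 0 \<and> s DESC (s src j) = 0
      then 0 else t GOOD 0)"
      by (simp add: body_def eq j(2))
    with IH show "sem body t GOOD 0 \<noteq> 0 \<longleftrightarrow> ?s GOOD 0 \<noteq> 0 \<and>
        (\<forall>i<Suc j. s ANC (s src i) \<noteq> 0 \<longrightarrow> s COMP (s src i) \<noteq> 0 \<longrightarrow> s DESC (s src i) \<noteq> 0)"
      by (auto simp: less_Suc_eq)
  qed auto
  moreover have "sem (source_test src) s = sem (For 36 body) ?s"
    by (simp add: source_test_def pre_def body_def)
  ultimately show ?thesis using pre by (simp add: wp)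
qed

text \<open>Membership in the cut is read from marks made before the scan, so selecting edges on the
  way does not change the cut.\<close>

definition push :: "nat \<Rightarrow> nat \<Rightarrow> prog" where
  "push src dst = For 36 (Ite (Cell CUR (Var 36)) (Ite (Cell COMP (Cell src (Var 36)))
     (Ite (Cell ANC (Cell dst (Var 36))) (Ite (Cell ANC (Cell src (Var 36))) Skip
       (Assign STACK (Var TOP) (Var 36) ;; Assign SEL (Var 36) (Const 1) ;;
        TOP ::= Plus (Var TOP) (Const 1))) Skip) Skip) Skip)"

lemma writes_push [simp]: "writes (push src dst) = {STACK, SEL, TOP, 36}"
  by (auto simp: push_def)

lemma bounded_push [simp]: "bounded (push src dst)"
  by (simp add: push_def)

lemma sem_push:
  fixes src dst :: nat and s :: state
  assumes "{src, dst} \<inter> {STACK, SEL, TOP, 36} = {}"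
  defines "K \<equiv> {i. i < 2 * s 0 1 \<and> s CUR i \<noteq> 0 \<and> s COMP (s src i) \<noteq> 0 \<and> s ANC (s dst i) \<noteq> 0 \<and>
    s ANC (s src i) = 0}"
  shows "flags (sem (push src dst) s) SEL = flags s SEL \<union> K \<and>
    stack (sem (push src dst) s) = stack s @ filter (\<lambda>i. i \<in> K) [0..<2 * s 0 1]"
proof -
  define body where "body = Ite (Cell CUR (Var 36)) (Ite (Cell COMP (Cell src (Var 36)))
     (Ite (Cell ANC (Cell dst (Var 36))) (Ite (Cell ANC (Cell src (Var 36))) Skip
       (Assign STACK (Var TOP) (Var 36) ;; Assign SEL (Var 36) (Const 1) ;;
        TOP ::= Plus (Var TOP) (Const 1))) Skip) Skip) Skip"
  have w: "writes body = {STACK, SEL, TOP}" by (auto simp: body_def)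
  have "flags (sem (For 36 body) s) SEL = flags s SEL \<union> (K \<inter> {..<2 * s 0 1}) \<and>
    stack (sem (For 36 body) s) = stack s @ filter (\<lambda>i. i \<in> K) [0..<2 * s 0 1]"
  proof (rule For_rule[where P = "\<lambda>j t. flags t SEL = flags s SEL \<union> (K \<inter> {..<j}) \<and>
      stack t = stack s @ filter (\<lambda>i. i \<in> K) [0..<j]"])
    fix j t assume j: "j < 2 * s 0 1" "\<And>a. a \<noteq> 36 \<Longrightarrow> a \<notin> writes body \<Longrightarrow> t a = s a" "t 36 0 = j"
      and IH: "flags t SEL = flags s SEL \<union> (K \<inter> {..<j}) \<and>
        stack t = stack s @ filter (\<lambda>i. i \<in> K) [0..<j]"
    have eq: "t 0 = s 0" "t CUR = s CUR" "t COMP = s COMP" "t ANC = s ANC" "t src = s src" "t dst = s dst"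
      using assms by (auto simp: j(2) w)
    show "flags (sem body t) SEL = flags s SEL \<union> (K \<inter> {..<Suc j}) \<and>
      stack (sem body t) = stack s @ filter (\<lambda>i. i \<in> K) [0..<Suc j]"
    proof (cases "j \<in> K")
      case True
      then have sem: "sem body t = t(STACK := (t STACK)(t TOP 0 := j), SEL := (t SEL)(j := 1),
          TOP := (t TOP)(0 := t TOP 0 + 1))"
        by (simp add: body_def eq j(3) K_def)
      have "flags (sem body t) SEL = insert j (flags t SEL)"
        using j(1) by (auto simp: sem flags_def eq)
      moreover have "stack (sem body t) = stack t @ [j]"
        by (simp add: sem stack_def)
      ultimately show ?thesis using IH True by (auto simp: lessThan_Suc)
    next
      case False
      then have "sem body t = t" using j(1) by (auto simp: body_def eq j(3) K_def)
      then show ?thesis using IH False by (auto simp: lessThan_Suc)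
    qed
  qed (auto simp: stack_def)
  moreover have "K \<inter> {..<2 * s 0 1} = K" by (auto simp: K_def)
  ultimately show ?thesis by (simp add: push_def body_def)
qed

definition marks :: "nat \<Rightarrow> nat \<Rightarrow> prog" where
  "marks src dst = ROOT ::= Cell dst (Var 35) ;; reach_from dst src SEL ANC ;;
     reach_from src dst SEL DESC ;; reach_from src dst CUR COMP"

definition probe :: "nat \<Rightarrow> nat \<Rightarrow> prog" where
  "probe src dst = Ite (Cell CUR (Var 35))
     (marks src dst ;; source_test src ;; Ite (Var GOOD) (push src dst) Skip) Skip"

definition stage :: "nat \<Rightarrow> nat \<Rightarrow> prog" where
  "stage src dst = TOP ::= Const 0 ;; For 34 (For 35 (probe src dst))"

lemma writes_marks [simp]: "writes (marks src dst) = {ROOT, ANC, DESC, COMP, 30, 31}"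
  by (auto simp: marks_def)

lemma writes_probe [simp]: "writes (probe src dst) =
    {ROOT, ANC, DESC, COMP, GOOD, STACK, SEL, TOP, 30, 31, 36}"
  by (auto simp: probe_def)

lemma writes_stage [simp]: "writes (stage src dst) =
    {ROOT, ANC, DESC, COMP, GOOD, STACK, SEL, TOP, 30, 31, 34, 35, 36}"
  by (auto simp: stage_def)

lemma bounded_stage [simp]: "bounded (stage src dst)"
  by (simp add: stage_def probe_def marks_def)

lemma sem_marks:
  fixes src dst :: nat and s :: state
  assumes "{src, dst} = {TL, HD}" and v: "v \<in> s src ` {..<2 * s 0 1} \<union> s dst ` {..<2 * s 0 1}"
  defines "t \<equiv> sem (marks src dst) s" and "y \<equiv> s dst (s 35 0)"
  shows "t ANC v \<noteq> 0 \<longleftrightarrow> (v, y) \<in> (graph s src dst SEL)\<^sup>*"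
    "t DESC v \<noteq> 0 \<longleftrightarrow> (y, v) \<in> (graph s src dst SEL)\<^sup>*"
    "t COMP v \<noteq> 0 \<longleftrightarrow> (y, v) \<in> (graph s src dst CUR)\<^sup>*"
proof -
  have sd: "src = TL \<and> dst = HD \<or> src = HD \<and> dst = TL" using assms(1) by (auto simp: doubleton_eq_iff)
  define s1 where "s1 = s(ROOT := (s ROOT)(0 := y))"
  define s2 where "s2 = sem (reach_from dst src SEL ANC) s1"
  define s3 where "s3 = sem (reach_from src dst SEL DESC) s2"
  have t: "t = sem (reach_from src dst CUR COMP) s3"
    by (simp add: t_def marks_def s1_def s2_def s3_def y_def)
  have f1: "s1 a = s a" if "a \<noteq> ROOT" for a using that by (simp add: s1_def)
  have f2: "s2 a = s1 a" if "a \<notin> {ANC, 30, 31}" for a using that by (simp add: s2_def)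
  have f3: "s3 a = s2 a" if "a \<notin> {DESC, 30, 31}" for a using that by (simp add: s3_def)
  have fl: "flags s1 a = flags s a" "flags s2 a = flags s a" "flags s3 a = flags s a"
    if "a \<in> {SEL, CUR}" for a
    using that by (auto simp: s1_def s2_def s3_def)
  have y: "s1 ROOT 0 = y" by (simp add: s1_def)
  have "s2 ANC v \<noteq> 0 \<longleftrightarrow> (y, v) \<in> (graph s dst src SEL)\<^sup>*"
    unfolding s2_def using sd v by (subst sem_reach_from) (auto simp: f1 fl y)
  moreover have "t ANC = s2 ANC" by (simp add: t s3_def)
  ultimately show "t ANC v \<noteq> 0 \<longleftrightarrow> (v, y) \<in> (graph s src dst SEL)\<^sup>*"
    by (simp add: arc_rel_converse[of "s src" "s dst", symmetric] rtrancl_converse)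
  have "s3 DESC v \<noteq> 0 \<longleftrightarrow> (y, v) \<in> (graph s src dst SEL)\<^sup>*"
    unfolding s3_def using sd v by (subst sem_reach_from) (auto simp: f1 f2 fl y)
  then show "t DESC v \<noteq> 0 \<longleftrightarrow> (y, v) \<in> (graph s src dst SEL)\<^sup>*" by (simp add: t)
  show "t COMP v \<noteq> 0 \<longleftrightarrow> (y, v) \<in> (graph s src dst CUR)\<^sup>*"
    unfolding t using sd v by (subst sem_reach_from) (auto simp: f1 f2 f3 fl y)
qed

lemma network_flags: "network (flags s a)"
  by unfold_locales simp

lemma sem_probe:
  fixes src dst :: nat and s :: state
  assumes sd: "{src, dst} = {TL, HD}" and j: "s 35 0 < 2 * s 0 1"
  defines "t \<equiv> sem (probe src dst) s"
  shows "if network.cut_at (s src) (s dst) (flags s CUR) (flags s SEL) (s 35 0)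
    then flags t SEL = flags s SEL \<union> network.cutset (s src) (s dst) (flags s CUR) (flags s SEL) (s 35 0) \<and>
      (\<exists>ks. stack t = stack s @ ks \<and> distinct ks \<and>
        set ks = network.cutset (s src) (s dst) (flags s CUR) (flags s SEL) (s 35 0))
    else flags t SEL = flags s SEL \<and> stack t = stack s"
proof -
  interpret N: network "s src" "s dst" "flags s CUR" by (rule network_flags)
  have sd': "src = TL \<and> dst = HD \<or> src = HD \<and> dst = TL" using sd by (auto simp: doubleton_eq_iff)
  let ?j = "s 35 0"
  show ?thesis
  proof (cases "?j \<in> flags s CUR")
    case False
    then have "t = s" using j by (simp add: t_def probe_def flags_def)
    then show ?thesis using False by (simp add: N.cut_at_def)
  next
    case True
    define u where "u = sem (marks src dst) s"
    define w where "w = sem (source_test src) u"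
    have u: "u a = s a" if "a \<notin> {ROOT, ANC, DESC, COMP, 30, 31}" for a
      using that by (simp add: u_def)
    have w: "w a = u a" if "a \<notin> {GOOD, 36}" for a using that by (simp add: w_def)
    have t: "t = (if w GOOD 0 \<noteq> 0 then sem (push src dst) w else w)"
      using True by (simp add: t_def probe_def flags_def u_def w_def)
    have V: "s src i \<in> s src ` {..<2 * s 0 1} \<union> s dst ` {..<2 * s 0 1}"
      "s dst i \<in> s src ` {..<2 * s 0 1} \<union> s dst ` {..<2 * s 0 1}" if "i < 2 * s 0 1" for i
      using that by auto
    note mark = sem_marks[OF sd, of _ s, folded u_def]
    have eq: "u 0 = s 0" "u 35 = s 35" "u src = s src" "u dst = s dst" "u CUR = s CUR"
      using sd' u by auto
    have "w GOOD 0 \<noteq> 0 \<longleftrightarrow> u ANC (s src ?j) = 0 \<and> u COMP (s src ?j) \<noteq> 0 \<and>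
        (\<forall>i<2 * s 0 1. u ANC (s src i) \<noteq> 0 \<longrightarrow> u COMP (s src i) \<noteq> 0 \<longrightarrow> u DESC (s src i) \<noteq> 0)"
      unfolding w_def using sd' by (subst sem_source_test) (auto simp: eq)
    also have "\<dots> \<longleftrightarrow> \<not> N.conn (flags s SEL) (s src ?j) (s dst ?j) \<and>
        N.conn (flags s CUR) (s dst ?j) (s src ?j) \<and>
        (\<forall>i<2 * s 0 1. N.conn (flags s SEL) (s src i) (s dst ?j) \<longrightarrow>
          N.conn (flags s CUR) (s dst ?j) (s src i) \<longrightarrow> N.conn (flags s SEL) (s dst ?j) (s src i))"
      using mark[OF V(1)[OF j]] mark[OF V(1)] by auto
    also have "\<dots> \<longleftrightarrow> N.cut_at (flags s SEL) ?j"
    proof -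
      have "N.conn (flags s SEL) (s dst ?j) v"
        if src: "\<forall>i<2 * s 0 1. N.conn (flags s SEL) (s src i) (s dst ?j) \<longrightarrow>
          N.conn (flags s CUR) (s dst ?j) (s src i) \<longrightarrow> N.conn (flags s SEL) (s dst ?j) (s src i)"
          and v: "N.conn (flags s SEL) v (s dst ?j)" "N.conn (flags s CUR) (s dst ?j) v" for v
      proof (cases "v = s dst ?j")
        case False
        then obtain i where "i < 2 * s 0 1" "v = s src i"
          using v(1) by (auto simp: arc_rel_def flags_def elim: converse_rtranclE)
        then show ?thesis using src v by blast
      qed simp
      then show ?thesis using True by (auto simp: N.cut_at_def)
    qed
    finally have good: "w GOOD 0 \<noteq> 0 \<longleftrightarrow> N.cut_at (flags s SEL) ?j" .
    have fl: "flags w a = flags s a" if "a \<in> {SEL, CUR}" for a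
      using that by (auto simp: w_def u_def)
    have st: "stack w = stack s" by (simp add: stack_def w u)
    show ?thesis
    proof (cases "N.cut_at (flags s SEL) ?j")
      case False
      then show ?thesis using good by (simp add: t fl st)
    next
      case cut: True
      let ?K = "{i. i < 2 * s 0 1 \<and> s CUR i \<noteq> 0 \<and> u COMP (s src i) \<noteq> 0 \<and> u ANC (s dst i) \<noteq> 0 \<and>
        u ANC (s src i) = 0}"
      have "i \<in> ?K \<longleftrightarrow> i \<in> N.cutset (flags s SEL) ?j" for i
      proof (cases "i < 2 * s 0 1")
        case True
        then have "i \<in> flags s CUR \<longleftrightarrow> s CUR i \<noteq> 0" by (simp add: flags_def)
        then show ?thesis
          using True mark[OF V(1)[OF True]] mark[OF V(2)[OF True]] unfolding N.cutset_def by blast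
      next
        case False
        then have "i \<notin> flags s CUR" by (simp add: flags_def)
        then show ?thesis using False by (simp add: N.cutset_def)
      qed
      then have "?K = N.cutset (flags s SEL) ?j" by blast
      moreover have "flags t SEL = flags w SEL \<union> ?K \<and>
          stack t = stack w @ filter (\<lambda>i. i \<in> ?K) [0..<2 * s 0 1]"
      proof -
        have weq: "w 0 = s 0" "w src = s src" "w dst = s dst" "w CUR = s CUR" "w COMP = u COMP"
          "w ANC = u ANC"
          using sd' eq by (auto simp: w)
        have "{src, dst} \<inter> {STACK, SEL, TOP, 36} = {}" using sd' by auto
        from sem_push[OF this, of w] show ?thesis using good cut by (simp add: t weq)
      qed
      moreover have "set (filter (\<lambda>i. i \<in> ?K) [0..<2 * s 0 1]) = ?K" by auto
      ultimately show ?thesis using cut fl st by (auto intro!: exI[of _ "filter (\<lambda>i. i \<in> ?K) [0..<2 * s 0 1]"])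
    qed
  qed
qed

text \<open>A pass over all indices that finds a cut pushes at least one edge; a pass that finds
  none leaves the selection unchanged for good. As no edge is pushed twice, the passes run out of
  cuts in time.\<close>

lemma sem_stage:
  fixes src dst :: nat and s :: state
  assumes sd: "{src, dst} = {TL, HD}" and F: "flags s CUR \<subseteq> {..<s 0 1}"
  defines "t \<equiv> sem (stage src dst) s"
  shows "network.chain (s src) (s dst) (flags s CUR) (flags s SEL) (stack t) (flags t SEL)"
    "\<not> network.cut_at (s src) (s dst) (flags s CUR) (flags t SEL) j"
proof -
  interpret N: network "s src" "s dst" "flags s CUR" by (rule network_flags)
  have sd': "src = TL \<and> dst = HD \<or> src = HD \<and> dst = TL" using sd by (auto simp: doubleton_eq_iff)
  define s1 where "s1 = s(TOP := (s TOP)(0 := 0))"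
  define W where "W = {ROOT, ANC, DESC, COMP, GOOD, STACK, SEL, TOP, 30, 31, 34, 35, 36::nat}"
  let ?Z = "\<lambda>u. flags u SEL"
  define inv where "inv u \<longleftrightarrow> N.chain (flags s SEL) (stack u) (?Z u)" for u
  define idle where "idle Z \<longleftrightarrow> (\<forall>i<2 * s 0 1. \<not> N.cut_at Z i)" for Z
  have frame: "u src = s src" "u dst = s dst" "u 0 = s 0" "u CUR = s CUR" "flags u CUR = flags s CUR"
    if "\<forall>a. a \<notin> W \<longrightarrow> u a = s a" for u
    using that sd' by (auto simp: W_def flags_def)
  have round: "inv (sem (For 35 (probe src dst)) u) \<and>
      (?Z (sem (For 35 (probe src dst)) u) = ?Z u \<and> idle (?Z u) \<and>
         stack (sem (For 35 (probe src dst)) u) = stack u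
       \<or> \<not> idle (?Z u) \<and> length (stack u) < length (stack (sem (For 35 (probe src dst)) u)))"
    if inv: "inv u" and u: "\<forall>a. a \<notin> W \<longrightarrow> u a = s a" for u
  proof -
    note fr = frame[OF u]
    have "inv (sem (For 35 (probe src dst)) u) \<and>
      (?Z (sem (For 35 (probe src dst)) u) = ?Z u \<and> (\<forall>i<2 * u 0 1. \<not> N.cut_at (?Z u) i) \<and>
         stack (sem (For 35 (probe src dst)) u) = stack u
       \<or> \<not> idle (?Z u) \<and> length (stack u) < length (stack (sem (For 35 (probe src dst)) u)))"
    proof (rule For_rule[where P = "\<lambda>j v. inv v \<and>
        (?Z v = ?Z u \<and> (\<forall>i<j. \<not> N.cut_at (?Z u) i) \<and> stack v = stack u
         \<or> \<not> idle (?Z u) \<and> length (stack u) < length (stack v))"])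
      fix j v assume j: "j < 2 * u 0 1" "\<And>a. a \<noteq> 35 \<Longrightarrow> a \<notin> writes (probe src dst) \<Longrightarrow> v a = u a" "v 35 0 = j"
        and IH: "inv v \<and> (?Z v = ?Z u \<and> (\<forall>i<j. \<not> N.cut_at (?Z u) i) \<and> stack v = stack u
          \<or> \<not> idle (?Z u) \<and> length (stack u) < length (stack v))"
      have v: "\<forall>a. a \<notin> W \<longrightarrow> v a = s a" using j(2) u by (simp add: W_def)
      note fv = frame[OF v]
      let ?v = "sem (probe src dst) v"
      have "v 35 0 < 2 * v 0 1" using j fr fv by simp
      from sem_probe[OF sd this]
      have pr: "if N.cut_at (?Z v) j
        then ?Z ?v = ?Z v \<union> N.cutset (?Z v) j \<and>
          (\<exists>ks. stack ?v = stack v @ ks \<and> distinct ks \<and> set ks = N.cutset (?Z v) j)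
        else ?Z ?v = ?Z v \<and> stack ?v = stack v"
        by (simp only: fv j(3))
      show "inv ?v \<and> (?Z ?v = ?Z u \<and> (\<forall>i<Suc j. \<not> N.cut_at (?Z u) i) \<and> stack ?v = stack u
          \<or> \<not> idle (?Z u) \<and> length (stack u) < length (stack ?v))"
      proof (cases "N.cut_at (?Z v) j")
        case True
        then obtain ks where ks: "?Z ?v = ?Z v \<union> N.cutset (?Z v) j" "stack ?v = stack v @ ks"
          "distinct ks" "set ks = N.cutset (?Z v) j"
          using pr by auto
        have "N.chain (flags s SEL) (stack v @ ks) (?Z v \<union> N.cutset (?Z v) j)"
          using IH True ks by (intro N.chain.Snoc) (auto simp: inv_def)
        moreover have "ks \<noteq> []" using N.cut_self[OF True] ks(4) by auto
        moreover have "?Z v = ?Z u \<Longrightarrow> \<not> idle (?Z u)" using True j(1) fr by (auto simp: idle_def)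
        ultimately show ?thesis using IH ks by (auto simp: inv_def)
      next
        case False
        then show ?thesis using pr IH by (auto simp: inv_def less_Suc_eq)
      qed
    qed (use inv in \<open>auto simp: inv_def stack_def\<close>)
    then show ?thesis by (simp add: idle_def fr)
  qed
  let ?c = "For 34 (For 35 (probe src dst))"
  have "inv s1" by (simp add: inv_def s1_def stack_def N.chain.Nil)
  have t: "t = sem ?c s1" by (simp add: t_def stage_def s1_def)
  have "inv (sem ?c s1) \<and> (idle (?Z (sem ?c s1)) \<or> 2 * s1 0 1 \<le> length (stack (sem ?c s1)))"
  proof (rule For_rule[where P = "\<lambda>k u. inv u \<and> (idle (?Z u) \<or> k \<le> length (stack u))"])
    fix k u assume u: "\<And>a. a \<noteq> 34 \<Longrightarrow> a \<notin> writes (For 35 (probe src dst)) \<Longrightarrow> u a = s1 a"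
      and IH: "inv u \<and> (idle (?Z u) \<or> k \<le> length (stack u))"
    let ?u = "sem (For 35 (probe src dst)) u"
    have "\<forall>a. a \<notin> W \<longrightarrow> u a = s a" using u by (simp add: W_def s1_def)
    from round[OF conjunct1[OF IH], OF this]
    show "inv ?u \<and> (idle (?Z ?u) \<or> Suc k \<le> length (stack ?u))"
      using IH by auto
  qed (use \<open>inv s1\<close> in \<open>auto simp: inv_def stack_def\<close>)
  then have ch: "N.chain (flags s SEL) (stack t) (?Z t)"
    and alt: "idle (?Z t) \<or> 2 * s 0 1 \<le> length (stack t)"
    by (auto simp: inv_def t s1_def)
  show "N.chain (flags s SEL) (stack t) (?Z t)" by (rule ch)
  note D = N.chainD[OF ch]
  have "length (stack t) = card (set (stack t))" using D(3) by (simp add: distinct_card)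
  also have "\<dots> \<le> card {..<s 0 1}" using D(2) F by (intro card_mono) auto
  \<comment> \<open>At most \<open>m\<close> distinct edges are on the stack, so all
    \<open>2 m\<close> passes can have pushed something only if \<open>m = 0\<close>.\<close>
  finally have "idle (?Z t) \<or> s 0 1 = 0" using alt by auto
  moreover have "j < 2 * s 0 1" if "N.cut_at (?Z t) j"
    using that by (simp add: N.cut_at_def) (simp add: flags_def)
  ultimately show "\<not> N.cut_at (?Z t) j" by (auto simp: idle_def)
qed

section \<open>Initial selection and final trimming\<close>

definition mark_necessary :: prog where
  "mark_necessary = For 37 (Assign NEC (Var 37) (Cell REQ (Var 37)) ;;
     Ite (Cell CUR (Var 37))
       (Assign CUR (Var 37) (Const 0) ;; test CUR ;;
        Ite (Var OK) Skip (Assign NEC (Var 37) (Const 1)) ;;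
        Assign CUR (Var 37) (Const 1)) Skip)"

lemma writes_mark_necessary [simp]:
  "writes mark_necessary = {NEC, CUR, OK, ROOT, MARK, 30, 31, 32, 37}"
  by (auto simp: mark_necessary_def)

lemma bounded_mark_necessary [simp]: "bounded mark_necessary"
  by (simp add: mark_necessary_def)

lemma sem_mark_necessary:
  fixes s :: state
  defines "t \<equiv> sem mark_necessary s"
  shows "flags t CUR = flags s CUR"
    "flags t NEC = flags s REQ \<union> {i \<in> flags s CUR. \<not> connects s (flags s CUR - {i})}"
proof -
  define body where "body = Assign NEC (Var 37) (Cell REQ (Var 37)) ;;
     Ite (Cell CUR (Var 37))
       (Assign CUR (Var 37) (Const 0) ;; test CUR ;;
        Ite (Var OK) Skip (Assign NEC (Var 37) (Const 1)) ;;
        Assign CUR (Var 37) (Const 1)) Skip"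
  have w: "writes body = {NEC, CUR, OK, ROOT, MARK, 30, 31, 32}" by (auto simp: body_def)
  let ?F = "flags s CUR"
  let ?N = "flags s REQ \<union> {i \<in> ?F. \<not> connects s (?F - {i})}"
  have "flags (sem (For 37 body) s) CUR = ?F \<and>
    flags (sem (For 37 body) s) NEC \<inter> {..<2 * s 0 1} = ?N \<inter> {..<2 * s 0 1}"
  proof (rule For_rule[where P = "\<lambda>j u. flags u CUR = ?F \<and> flags u NEC \<inter> {..<j} = ?N \<inter> {..<j}"])
    fix j u assume j: "j < 2 * s 0 1" "\<And>a. a \<noteq> 37 \<Longrightarrow> a \<notin> writes body \<Longrightarrow> u a = s a" "u 37 0 = j"
      and IH: "flags u CUR = ?F \<and> flags u NEC \<inter> {..<j} = ?N \<inter> {..<j}"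
    have eq: "u 0 = s 0" "u TL = s TL" "u HD = s HD" "u REQ = s REQ" by (simp_all add: j(2) w)
    let ?u = "u(NEC := (u NEC)(j := s REQ j), CUR := (u CUR)(j := 0))"
    have curj: "u CUR j \<noteq> 0 \<longleftrightarrow> j \<in> ?F"
      using IH j(1) by (auto simp: flags_def eq)
    have "flags ?u CUR = ?F - {j}"
      using IH by (auto simp: flags_def eq)
    then have ok: "sem (test CUR) ?u OK 0 \<noteq> 0 \<longleftrightarrow> connects s (?F - {j})"
      using sem_test[of CUR ?u] connects_cong[of ?u s] eq by simp
    have nec: "sem body u NEC = (u NEC)(j := if j \<in> ?F \<and> \<not> connects s (?F - {j}) then 1 else s REQ j)"
      using curj ok by (auto simp: body_def eq j(3) fun_eq_iff)
    have cur: "sem body u CUR = (if j \<in> ?F then (u CUR)(j := 1) else u CUR)"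
      using curj by (auto simp: body_def eq j(3) fun_eq_iff)
    have b0: "sem body u 0 = s 0" using eq by (simp add: w)
    have "sem body u CUR i \<noteq> 0 \<longleftrightarrow> u CUR i \<noteq> 0" for i
      using cur curj by (cases "i = j") auto
    then have "flags (sem body u) CUR = flags u CUR" by (simp only: flags_def b0 eq)
    with IH have "flags (sem body u) CUR = ?F" by blast
    moreover have "i \<in> flags (sem body u) NEC \<inter> {..<Suc j} \<longleftrightarrow> i \<in> ?N \<inter> {..<Suc j}" for i
    proof (cases "i = j")
      case True
      have "j \<in> flags (sem body u) NEC \<longleftrightarrow> j \<in> ?N"
        using j(1) unfolding flags_def[of "sem body u"] nec b0 by (auto simp: flags_def[of s REQ])
      with True show ?thesis by simp
    next
      case False
      then have "i \<in> flags (sem body u) NEC \<longleftrightarrow> i \<in> flags u NEC"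
        unfolding flags_def nec b0 by (simp add: eq)
      moreover have "i < j \<Longrightarrow> i \<in> flags u NEC \<longleftrightarrow> i \<in> ?N" using IH by blast
      ultimately show ?thesis using False by (auto simp: less_Suc_eq)
    qed
    ultimately show "flags (sem body u) CUR = ?F \<and>
      flags (sem body u) NEC \<inter> {..<Suc j} = ?N \<inter> {..<Suc j}"
      by blast
  qed auto
  moreover have "flags u a \<inter> {..<2 * s 0 1} = flags u a" if "u 0 = s 0" for u a
    using that by (auto simp: flags_def)
  moreover have "?N \<inter> {..<2 * s 0 1} = ?N" by (auto simp: flags_def)
  moreover have "t = sem (For 37 body) s" by (simp add: t_def mark_necessary_def body_def)
  moreover have "t 0 = s 0" by (simp add: t_def)
  ultimately show "flags t CUR = ?F" "flags t NEC = ?N" by metis+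
qed

text \<open>Builds the start set of phase one in \<open>half_optimal\<close>. An edge joins
  different components exactly if its head does not reach its tail; the indices from
  \<open>m\<close> on are the stars.\<close>

definition init_selection :: prog where
  "init_selection = For 37 (Assign SEL (Var 37) (Cell NEC (Var 37)) ;;
     Ite (Minus (Cell 0 (Const 1)) (Var 37))
       (Ite (Cell CUR (Var 37)) (ROOT ::= Cell HD (Var 37) ;; reach_from TL HD CUR COMP ;;
          Ite (Cell COMP (Cell TL (Var 37))) Skip (Assign SEL (Var 37) (Const 1))) Skip)
       (Assign SEL (Var 37) (Const 1)))"

lemma writes_init_selection [simp]: "writes init_selection = {SEL, ROOT, COMP, 30, 31, 37}"
  by (auto simp: init_selection_def)

lemma bounded_init_selection [simp]: "bounded init_selection"
  by (simp add: init_selection_def)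

lemma sem_init_selection:
  fixes s :: state
  assumes "flags s CUR \<subseteq> {..<s 0 1}"
  shows "flags (sem init_selection s) SEL =
    flags s NEC \<union> network.bridges (s TL) (s HD) (flags s CUR) \<union> {s 0 1..<2 * s 0 1}"
proof -
  interpret N: network "s TL" "s HD" "flags s CUR" by (rule network_flags)
  define body where "body = Assign SEL (Var 37) (Cell NEC (Var 37)) ;;
     Ite (Minus (Cell 0 (Const 1)) (Var 37))
       (Ite (Cell CUR (Var 37)) (ROOT ::= Cell HD (Var 37) ;; reach_from TL HD CUR COMP ;;
          Ite (Cell COMP (Cell TL (Var 37))) Skip (Assign SEL (Var 37) (Const 1))) Skip)
       (Assign SEL (Var 37) (Const 1))"
  have w: "writes body = {SEL, ROOT, COMP, 30, 31}" by (auto simp: body_def)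
  let ?N = "flags s NEC \<union> N.bridges \<union> {s 0 1..<2 * s 0 1}"
  have "\<forall>i<2 * s 0 1. sem (For 37 body) s SEL i \<noteq> 0 \<longleftrightarrow> i \<in> ?N"
  proof (rule For_rule[where P = "\<lambda>j u. \<forall>i<j. u SEL i \<noteq> 0 \<longleftrightarrow> i \<in> ?N"])
    fix j u assume j: "j < 2 * s 0 1" "\<And>a. a \<noteq> 37 \<Longrightarrow> a \<notin> writes body \<Longrightarrow> u a = s a" "u 37 0 = j"
      and IH: "\<forall>i<j. u SEL i \<noteq> 0 \<longleftrightarrow> i \<in> ?N"
    have eq: "u 0 = s 0" "u TL = s TL" "u HD = s HD" "u NEC = s NEC" "u CUR = s CUR"
      by (simp_all add: j(2) w)
    let ?u = "u(SEL := (u SEL)(j := s NEC j), ROOT := (u ROOT)(0 := s HD j))"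
    have fl: "flags ?u CUR = flags s CUR" by (rule flags_cong) (simp_all add: eq)
    have reach: "sem (reach_from TL HD CUR COMP) ?u COMP (s TL j) \<noteq> 0 \<longleftrightarrow>
        N.conn (flags s CUR) (s HD j) (s TL j)"
      using j(1) by (subst sem_reach_from) (auto simp: fl eq)
    have Fj: "j \<in> flags s CUR \<longleftrightarrow> s CUR j \<noteq> 0" using j(1) by (simp add: flags_def)
    have "sem body u SEL = (u SEL)(j := if s 0 1 \<le> j \<or> j \<in> N.bridges then 1 else s NEC j)"
      using reach Fj assms by (auto simp: body_def eq j(3) N.bridges_def fun_eq_iff)
    moreover have "j \<in> flags s NEC \<longleftrightarrow> s NEC j \<noteq> 0" using j(1) by (simp add: flags_def)
    ultimately show "\<forall>i<Suc j. sem body u SEL i \<noteq> 0 \<longleftrightarrow> i \<in> ?N"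
      using IH j(1) by (auto simp: less_Suc_eq)
  qed auto
  moreover have "?N \<subseteq> {..<2 * s 0 1}" by (auto simp: N.bridges_def) (auto simp: flags_def)
  moreover have "sem init_selection s = sem (For 37 body) s"
    by (simp add: init_selection_def body_def)
  moreover have "sem init_selection s 0 = s 0" by simp
  ultimately show ?thesis unfolding flags_def[of "sem init_selection s"] by auto
qed

definition drop_stars :: prog where
  "drop_stars = For 37 (Ite (Minus (Cell 0 (Const 1)) (Var 37)) Skip (Assign SEL (Var 37) (Const 0)))"

lemma writes_drop_stars [simp]: "writes drop_stars = {SEL, 37}"
  by (auto simp: drop_stars_def)

lemma bounded_drop_stars [simp]: "bounded drop_stars"
  by (simp add: drop_stars_def)

lemma sem_drop_stars:
  "flags (sem drop_stars s) SEL = flags s SEL - {s 0 1..<2 * s 0 1}"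
proof -
  define body where "body = Ite (Minus (Cell 0 (Const 1)) (Var 37)) Skip (Assign SEL (Var 37) (Const 0))"
  have w: "writes body = {SEL}" by (auto simp: body_def)
  have "\<forall>i. sem (For 37 body) s SEL i = (if s 0 1 \<le> i \<and> i < 2 * s 0 1 then 0 else s SEL i)"
  proof (rule For_rule[where P = "\<lambda>j u. \<forall>i. u SEL i = (if s 0 1 \<le> i \<and> i < j then 0 else s SEL i)"])
    fix j u assume j: "\<And>a. a \<noteq> 37 \<Longrightarrow> a \<notin> writes body \<Longrightarrow> u a = s a" "u 37 0 = j"
      and IH: "\<forall>i. u SEL i = (if s 0 1 \<le> i \<and> i < j then 0 else s SEL i)"
    have "u 0 = s 0" by (simp add: j w)
    then show "\<forall>i. sem body u SEL i = (if s 0 1 \<le> i \<and> i < Suc j then 0 else s SEL i)"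
      using IH by (auto simp: body_def j(2))
  qed auto
  moreover have "sem drop_stars s = sem (For 37 body) s" by (simp add: drop_stars_def body_def)
  moreover have "sem drop_stars s 0 = s 0" by simp
  ultimately show ?thesis unfolding flags_def by auto
qed

definition trim :: prog where
  "trim = For 37 (Ite (Cell REQ (Var 37)) Skip (EDGE ::= Var 37 ;; delete SEL))"

lemma writes_trim [simp]: "writes trim = {EDGE, SEL, OK, ROOT, MARK, 30, 31, 32, 37}"
  by (auto simp: trim_def)

lemma bounded_trim [simp]: "bounded trim"
  by (simp add: trim_def)

lemma sem_trim:
  "flags (sem trim s) SEL =
    fold (prune (connects s)) (filter (\<lambda>i. i \<notin> flags s REQ) [0..<2 * s 0 1]) (flags s SEL)"
proof -
  define body where "body = Ite (Cell REQ (Var 37)) Skip (EDGE ::= Var 37 ;; delete SEL)"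
  have w: "writes body = {EDGE, SEL, OK, ROOT, MARK, 30, 31, 32}" by (auto simp: body_def)
  let ?f = "\<lambda>j. fold (prune (connects s)) (filter (\<lambda>i. i \<notin> flags s REQ) [0..<j]) (flags s SEL)"
  have "flags (sem (For 37 body) s) SEL = ?f (2 * s 0 1)"
  proof (rule For_rule[where P = "\<lambda>j u. flags u SEL = ?f j"])
    fix j u assume j: "j < 2 * s 0 1" "\<And>a. a \<noteq> 37 \<Longrightarrow> a \<notin> writes body \<Longrightarrow> u a = s a" "u 37 0 = j"
      and IH: "flags u SEL = ?f j"
    have eq: "u 0 = s 0" "u TL = s TL" "u HD = s HD" "u REQ = s REQ" by (simp_all add: j(2) w)
    let ?u = "u(EDGE := (u EDGE)(0 := j))"
    have "j \<in> flags s REQ \<longleftrightarrow> s REQ j \<noteq> 0" using j(1) by (simp add: flags_def)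
    moreover have "flags (sem (delete SEL) ?u) SEL = prune (connects ?u) (?u EDGE 0) (flags ?u SEL)"
      using j(1) eq by (intro sem_delete) auto
    moreover have "connects ?u = connects s" by (rule connects_cong) (simp_all add: eq)
    moreover have "sem body u = (if s REQ j \<noteq> 0 then u else sem (delete SEL) ?u)"
      by (simp add: body_def eq j(3))
    ultimately show "flags (sem body u) SEL = ?f (Suc j)" using IH by simp
  qed auto
  then show ?thesis by (simp add: trim_def body_def)
qed

section \<open>One run of both phases on the current edges\<close>

definition solve :: prog where
  "solve = mark_necessary ;; init_selection ;; stage TL HD ;; unstack ;; drop_stars ;;
     stage HD TL ;; unstack ;; trim"

lemma writes_solve [simp]: "writes solve = {CUR, NEC, SEL, STACK, TOP, OK, ANC, DESC, COMP, MARK, GOOD,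
    ROOT, EDGE, 30, 31, 32, 33, 34, 35, 36, 37}"
  by (auto simp: solve_def)

lemma bounded_solve [simp]: "bounded solve"
  by (simp add: solve_def)

text \<open>If the current edges generate all input edges, then generating the current ones is
  enough to generate the input ones.\<close>

lemma connects_eq_covers:
  assumes F: "flags s CUR \<subseteq> {..<s 0 1}" "connects s (flags s CUR)"
  shows "connects s = network.covers (s TL) (s HD) (flags s CUR)"
proof
  interpret N: network "s TL" "s HD" "flags s CUR" by (rule network_flags)
  fix P
  show "connects s P = N.covers P"
  proof
    assume "connects s P"
    then show "N.covers P"
      using N.arcs_mono[OF F(1)] by (auto simp: connects_def N.covers_def)
  next
    assume "N.covers P"
    then have "(N.arcs (flags s CUR))\<^sup>+ \<subseteq> (N.arcs P)\<^sup>+"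
      unfolding N.covers_def using trancl_mono_subset trancl_id[OF trans_trancl] by metis
    then show "connects s P" using F(2) unfolding connects_def by blast
  qed
qed

lemma stage_unstack:
  assumes sd: "{src, dst} = {TL, HD}" and F: "flags s CUR \<subseteq> {..<s 0 1}"
  obtains es Z where "network.chain (s src) (s dst) (flags s CUR) (flags s SEL) es Z"
    "\<And>j. \<not> network.cut_at (s src) (s dst) (flags s CUR) Z j"
    "flags (sem unstack (sem (stage src dst) s)) SEL = fold (prune (connects s)) (rev es) Z"
proof -
  interpret N: network "s src" "s dst" "flags s CUR" by (rule network_flags)
  let ?t = "sem (stage src dst) s"
  note st = sem_stage[OF sd F]
  note ch = N.chainD[OF st(1)]
  have set: "set (stack ?t) \<subseteq> {..<s 0 1}" using ch(2) F by blast
  have "s 0 1 = card {..<s 0 1}" by simp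
  also have "\<dots> \<ge> card (set (stack ?t))" using set by (intro card_mono) auto
  also have "card (set (stack ?t)) = ?t TOP 0" using distinct_card[OF ch(3)] by (simp add: stack_def)
  finally have "?t TOP 0 \<le> 2 * ?t 0 1" by simp
  moreover have "set (stack ?t) \<subseteq> {..<2 * ?t 0 1}" using set by auto
  moreover have "connects ?t = connects s" by (rule connects_cong) simp_all
  ultimately have "flags (sem unstack ?t) SEL = fold (prune (connects s)) (rev (stack ?t)) (flags ?t SEL)"
    using sem_unstack[of ?t] by simp
  with st show ?thesis by (intro that)
qed

lemma sem_solve:
  fixes s :: state
  assumes F: "flags s CUR \<subseteq> {..<s 0 1}" and D: "flags s REQ \<subseteq> flags s CUR"
    and conn: "connects s (flags s CUR)"
    and inj: "inj_on (\<lambda>i. (s TL i, s HD i)) {..<s 0 1}"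
    and star: "network.star (s TL) (s HD) (flags s CUR) {s 0 1..<2 * s 0 1}"
  defines "H \<equiv> flags (sem solve s) SEL"
  shows "flags s REQ \<subseteq> H" "H \<subseteq> flags s CUR" "connects s H"
    "flags s REQ \<subseteq> A \<Longrightarrow> A \<subseteq> flags s CUR \<Longrightarrow> connects s A \<Longrightarrow>
      card (flags s CUR - A) \<le> 2 * card (flags s CUR - H)"
proof -
  interpret N: network "s TL" "s HD" "flags s CUR" by (rule network_flags)
  let ?S = "{s 0 1..<2 * s 0 1}"
  have cov: "connects s = N.covers" using F conn by (rule connects_eq_covers)
  define s1 where "s1 = sem mark_necessary s"
  define s2 where "s2 = sem init_selection s1"
  define s3 where "s3 = sem unstack (sem (stage TL HD) s2)"
  define s4 where "s4 = sem drop_stars s3"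
  define s5 where "s5 = sem unstack (sem (stage HD TL) s4)"
  have H: "H = flags (sem trim s5) SEL"
    by (simp add: H_def solve_def s1_def s2_def s3_def s4_def s5_def)
  have fr: "u TL = s TL" "u HD = s HD" "u REQ = s REQ" "u 0 = s 0" "connects u = N.covers"
    "flags u CUR = flags s CUR" "flags u REQ = flags s REQ"
    if "u \<in> {s1, s2, s3, s4, s5}" for u
  proof -
    show *: "u TL = s TL" "u HD = s HD" "u REQ = s REQ" "u 0 = s 0"
      using that by (auto simp: s1_def s2_def s3_def s4_def s5_def)
    show "connects u = N.covers" using connects_cong[OF *(1,2,4)] cov by simp
    show "flags u CUR = flags s CUR"
    proof -
      have "flags s1 CUR = flags s CUR" unfolding s1_def by (rule sem_mark_necessary(1))
      moreover have "flags s2 CUR = flags s1 CUR" unfolding s2_def by simp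
      moreover have "flags s3 CUR = flags s2 CUR" unfolding s3_def by simp
      moreover have "flags s4 CUR = flags s3 CUR" unfolding s4_def by simp
      moreover have "flags s5 CUR = flags s4 CUR" unfolding s5_def by simp
      ultimately show ?thesis using that by fastforce
    qed
    show "flags u REQ = flags s REQ" using * by (rule_tac flags_cong)
  qed
  have nec: "flags s1 NEC = N.necessary (flags s REQ)"
    using sem_mark_necessary(2)[of s] by (simp add: s1_def N.necessary_def cov)
  have sel2: "flags s2 SEL = N.necessary (flags s REQ) \<union> N.bridges \<union> ?S"
    using sem_init_selection[of s1] F by (simp add: s2_def[symmetric] fr nec)
  obtain es1 Z1 where c1: "N.chain (flags s2 SEL) es1 Z1" "\<And>j. \<not> N.cut_at Z1 j"
    "flags s3 SEL = fold (prune N.covers) (rev es1) Z1"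
    using stage_unstack[of TL HD s2] F by (auto simp: fr s3_def)
  have sel4: "flags s4 SEL = flags s3 SEL - ?S"
    using sem_drop_stars[of s3] by (simp add: s4_def fr)
  obtain es2 Z2 where c2: "network.chain (s HD) (s TL) (flags s CUR) (flags s4 SEL) es2 Z2"
    "\<And>j. \<not> network.cut_at (s HD) (s TL) (flags s CUR) Z2 j"
    "flags s5 SEL = fold (prune N.covers) (rev es2) Z2"
    using stage_unstack[of HD TL s4] F by (auto simp: fr s5_def)
  have trim: "H = fold (prune N.covers) (filter (\<lambda>i. i \<notin> flags s REQ) [0..<2 * s 0 1]) (flags s5 SEL)"
    using sem_trim[of s5] by (simp add: H fr)
  note half = N.half_optimal[OF inj_on_subset[OF inj F] D star _ c1(1)[unfolded sel2] c1(2) c1(3)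
      c2(1)[unfolded sel4] c2(2) c2(3) trim]
  have side: "?S \<inter> flags s CUR = {}"
    "flags s CUR - flags s REQ \<subseteq> set (filter (\<lambda>i. i \<notin> flags s REQ) [0..<2 * s 0 1])"
    "flags s REQ \<inter> set (filter (\<lambda>i. i \<notin> flags s REQ) [0..<2 * s 0 1]) = {}"
    using F by auto
  show "flags s REQ \<subseteq> H" "H \<subseteq> flags s CUR" "connects s H"
    unfolding cov by (rule half[OF side])+
  show "flags s REQ \<subseteq> A \<Longrightarrow> A \<subseteq> flags s CUR \<Longrightarrow> connects s A \<Longrightarrow>
      card (flags s CUR - A) \<le> 2 * card (flags s CUR - H)"
    unfolding cov by (rule half(4)[OF side])
qed

section \<open>The complete program\<close>

text \<open>\<open>BEST\<close> starts with all edges, in accordance with the initial 0 in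
  \<open>VALUE\<close>; this is the answer if the optimum is 0. The ends are copied, since extra
  cells are needed for the stars and array 2 will receive output.\<close>

definition read_edges :: prog where
  "read_edges = For 40 (Assign TL (Var 40) (Cell 2 (Var 40)) ;; Assign HD (Var 40) (Cell 3 (Var 40)) ;;
     Ite (Minus (Cell 0 (Const 1)) (Var 40))
       (Assign CUR (Var 40) (Const 1) ;; Assign BEST (Var 40) (Const 1)) Skip)"

lemma writes_read_edges [simp]: "writes read_edges = {TL, HD, CUR, BEST, 40}"
  by (auto simp: read_edges_def)

lemma bounded_read_edges [simp]: "bounded read_edges"
  by (simp add: read_edges_def)

lemma sem_read_edges:
  fixes s :: state
  assumes "s CUR = (\<lambda>_. 0)" "s BEST = (\<lambda>_. 0)"
  defines "t \<equiv> sem read_edges s"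
  shows "i < 2 * s 0 1 \<Longrightarrow> t TL i = s 2 i" "i < 2 * s 0 1 \<Longrightarrow> t HD i = s 3 i"
    "flags t CUR = {..<s 0 1}" "flags t BEST = {..<s 0 1}"
proof -
  define body where "body = Assign TL (Var 40) (Cell 2 (Var 40)) ;; Assign HD (Var 40) (Cell 3 (Var 40)) ;;
     Ite (Minus (Cell 0 (Const 1)) (Var 40))
       (Assign CUR (Var 40) (Const 1) ;; Assign BEST (Var 40) (Const 1)) Skip"
  have w: "writes body = {TL, HD, CUR, BEST}" by (auto simp: body_def)
  have *: "(\<forall>i<2 * s 0 1. t TL i = s 2 i \<and> t HD i = s 3 i \<and>
    (t CUR i \<noteq> 0 \<longleftrightarrow> i < s 0 1) \<and> (t BEST i \<noteq> 0 \<longleftrightarrow> i < s 0 1)) \<and>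
    (\<forall>i\<ge>2 * s 0 1. t CUR i = 0 \<and> t BEST i = 0)"
    unfolding t_def read_edges_def body_def[symmetric]
  proof (rule For_rule[where P = "\<lambda>j u. (\<forall>i<j. u TL i = s 2 i \<and> u HD i = s 3 i \<and>
      (u CUR i \<noteq> 0 \<longleftrightarrow> i < s 0 1) \<and> (u BEST i \<noteq> 0 \<longleftrightarrow> i < s 0 1)) \<and>
      (\<forall>i\<ge>j. u CUR i = 0 \<and> u BEST i = 0)"])
    fix j u assume j: "\<And>a. a \<noteq> 40 \<Longrightarrow> a \<notin> writes body \<Longrightarrow> u a = s a" "u 40 0 = j"
      and IH: "(\<forall>i<j. u TL i = s 2 i \<and> u HD i = s 3 i \<and>
      (u CUR i \<noteq> 0 \<longleftrightarrow> i < s 0 1) \<and> (u BEST i \<noteq> 0 \<longleftrightarrow> i < s 0 1)) \<and>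
      (\<forall>i\<ge>j. u CUR i = 0 \<and> u BEST i = 0)"
    have eq: "u 0 = s 0" "u 2 = s 2" "u 3 = s 3" by (simp_all add: j(1) w)
    have "sem body u TL = (u TL)(j := s 2 j)" "sem body u HD = (u HD)(j := s 3 j)"
      "sem body u CUR = (if j < s 0 1 then (u CUR)(j := 1) else u CUR)"
      "sem body u BEST = (if j < s 0 1 then (u BEST)(j := 1) else u BEST)"
      by (simp_all add: body_def eq j(2))
    then show "(\<forall>i<Suc j. sem body u TL i = s 2 i \<and> sem body u HD i = s 3 i \<and>
      (sem body u CUR i \<noteq> 0 \<longleftrightarrow> i < s 0 1) \<and> (sem body u BEST i \<noteq> 0 \<longleftrightarrow> i < s 0 1)) \<and>
      (\<forall>i\<ge>Suc j. sem body u CUR i = 0 \<and> sem body u BEST i = 0)"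
      using IH by (auto simp: less_Suc_eq)
  qed (use assms in auto)
  have t0: "t 0 = s 0" by (simp add: t_def)
  show "i < 2 * s 0 1 \<Longrightarrow> t TL i = s 2 i" "i < 2 * s 0 1 \<Longrightarrow> t HD i = s 3 i" using * by auto
  show "flags t CUR = {..<s 0 1}" "flags t BEST = {..<s 0 1}"
    using * unfolding flags_def t0 by auto
qed

text \<open>The four truncated differences add up to 0 exactly if both edges agree. The inner loop
  has only \<open>2 m\<close> rounds, which is enough because \<open>D \<subseteq> E\<close> limits
  the required edges to \<open>m\<close>.\<close>

definition read_required :: prog where
  "read_required = For 40 (For 41 (Ite (Minus (Cell 0 (Const 1)) (Var 40))
     (Ite (Minus (Cell 0 (Const 2)) (Var 41))
       (Ite (Plus (Plus (Minus (Cell 4 (Var 41)) (Cell 2 (Var 40))) (Minus (Cell 2 (Var 40)) (Cell 4 (Var 41))))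
             (Plus (Minus (Cell 5 (Var 41)) (Cell 3 (Var 40))) (Minus (Cell 3 (Var 40)) (Cell 5 (Var 41)))))
         Skip (Assign REQ (Var 40) (Const 1))) Skip) Skip))"

lemma writes_read_required [simp]: "writes read_required = {REQ, 40, 41}"
  by (auto simp: read_required_def)

lemma bounded_read_required [simp]: "bounded read_required"
  by (simp add: read_required_def)

lemma sem_read_required:
  fixes s :: state
  assumes "s REQ = (\<lambda>_. 0)"
  shows "flags (sem read_required s) REQ =
    {i. i < s 0 1 \<and> (\<exists>k < 2 * s 0 1. k < s 0 2 \<and> s 4 k = s 2 i \<and> s 5 k = s 3 i)}"
proof -
  define body where "body = Ite (Minus (Cell 0 (Const 1)) (Var 40))
     (Ite (Minus (Cell 0 (Const 2)) (Var 41))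
       (Ite (Plus (Plus (Minus (Cell 4 (Var 41)) (Cell 2 (Var 40))) (Minus (Cell 2 (Var 40)) (Cell 4 (Var 41))))
             (Plus (Minus (Cell 5 (Var 41)) (Cell 3 (Var 40))) (Minus (Cell 3 (Var 40)) (Cell 5 (Var 41)))))
         Skip (Assign REQ (Var 40) (Const 1))) Skip) Skip"
  have w: "writes body = {REQ}" by (auto simp: body_def)
  define hit where "hit i k \<longleftrightarrow> i < s 0 1 \<and> k < s 0 2 \<and> s 4 k = s 2 i \<and> s 5 k = s 3 i" for i k
  have req: "\<forall>i. sem read_required s REQ i \<noteq> 0 \<longleftrightarrow> i < 2 * s 0 1 \<and> (\<exists>k < 2 * s 0 1. hit i k)"
    unfolding read_required_def body_def[symmetric]
  proof (rule For_rule[where P = "\<lambda>j u. \<forall>i. u REQ i \<noteq> 0 \<longleftrightarrow> i < j \<and> (\<exists>k < 2 * s 0 1. hit i k)"])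
    fix j u assume j: "\<And>a. a \<noteq> 40 \<Longrightarrow> a \<notin> writes (For 41 body) \<Longrightarrow> u a = s a" "u 40 0 = j"
      and IH: "\<forall>i. u REQ i \<noteq> 0 \<longleftrightarrow> i < j \<and> (\<exists>k < 2 * s 0 1. hit i k)"
    have u0: "u 0 = s 0" by (simp add: j(1) w)
    have "\<forall>i. sem (For 41 body) u REQ i \<noteq> 0 \<longleftrightarrow> u REQ i \<noteq> 0 \<or> i = j \<and> (\<exists>k < 2 * u 0 1. hit i k)"
    proof (rule For_rule[where P = "\<lambda>l v. \<forall>i. v REQ i \<noteq> 0 \<longleftrightarrow> u REQ i \<noteq> 0 \<or> i = j \<and> (\<exists>k < l. hit i k)"])
      fix l v assume l: "\<And>a. a \<noteq> 41 \<Longrightarrow> a \<notin> writes body \<Longrightarrow> v a = u a" "v 41 0 = l"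
        and IH: "\<forall>i. v REQ i \<noteq> 0 \<longleftrightarrow> u REQ i \<noteq> 0 \<or> i = j \<and> (\<exists>k < l. hit i k)"
      have eq: "v 0 = s 0" "v 2 = s 2" "v 3 = s 3" "v 4 = s 4" "v 5 = s 5" "v 40 0 = j"
        using j(2) by (simp_all add: j(1) l(1) w)
      have "sem body v REQ = (if hit j l then (v REQ)(j := 1) else v REQ)"
        by (auto simp: body_def eq l(2) hit_def)
      then show "\<forall>i. sem body v REQ i \<noteq> 0 \<longleftrightarrow> u REQ i \<noteq> 0 \<or> i = j \<and> (\<exists>k < Suc l. hit i k)"
        using IH by (auto simp: less_Suc_eq)
    qed auto
    then show "\<forall>i. sem (For 41 body) u REQ i \<noteq> 0 \<longleftrightarrow> i < Suc j \<and> (\<exists>k < 2 * s 0 1. hit i k)"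
      using IH unfolding u0 by (auto simp: less_Suc_eq)
  qed (use assms in auto)
  have "sem read_required s 0 = s 0" by simp
  then have "i \<in> flags (sem read_required s) REQ \<longleftrightarrow> i < 2 * s 0 1 \<and> sem read_required s REQ i \<noteq> 0" for i
    by (simp only: flags_def mem_Collect_eq)
  moreover have "i < 2 * s 0 1" if "hit i k" for i k using that by (simp add: hit_def)
  ultimately have "i \<in> flags (sem read_required s) REQ \<longleftrightarrow> (\<exists>k < 2 * s 0 1. hit i k)" for i
    using req by blast
  then show ?thesis unfolding hit_def by blast
qed

section \<open>Computing the stars\<close>

definition find_root :: prog where
  "find_root = For 43 (Ite (Minus (Cell 0 (Const 1)) (Var 43))
     (Ite (Cell COMP (Cell HD (Var 43))) (Ite (Cell ANC (Cell HD (Var 43)))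
       (Assign HD (Plus (Cell 0 (Const 1)) (Var 42)) (Cell HD (Var 43))) Skip) Skip) Skip)"

text \<open>The star edge with index \<open>m + i\<close> leads from the head of edge
  \<open>i\<close> to the root of its component. By \<open>starI\<close>, heads are enough.\<close>

definition add_stars :: prog where
  "add_stars = For 42 (Ite (Minus (Cell 0 (Const 1)) (Var 42))
     (Assign TL (Plus (Cell 0 (Const 1)) (Var 42)) (Cell HD (Var 42)) ;;
      ROOT ::= Cell HD (Var 42) ;; reach_from TL HD CUR COMP ;; reach_from HD TL CUR ANC ;;
      find_root) Skip)"

lemma writes_find_root [simp]: "writes find_root = {HD, 43}"
  by (auto simp: find_root_def)

lemma writes_add_stars [simp]: "writes add_stars = {TL, HD, ROOT, COMP, ANC, 30, 31, 42, 43}"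
  by (auto simp: add_stars_def)

lemma bounded_add_stars [simp]: "bounded add_stars"
  by (simp add: add_stars_def find_root_def)

lemma sem_find_root:
  fixes s :: state
  defines "t \<equiv> sem find_root s"
    and "ks \<equiv> filter (\<lambda>k. k < s 0 1 \<and> s COMP (s HD k) \<noteq> 0 \<and> s ANC (s HD k) \<noteq> 0) [0..<2 * s 0 1]"
  shows "i \<noteq> s 0 1 + s 42 0 \<Longrightarrow> t HD i = s HD i"
    "ks \<noteq> [] \<Longrightarrow> t HD (s 0 1 + s 42 0) = s HD (last ks)"
proof -
  define body where "body = Ite (Minus (Cell 0 (Const 1)) (Var 43))
     (Ite (Cell COMP (Cell HD (Var 43))) (Ite (Cell ANC (Cell HD (Var 43)))
       (Assign HD (Plus (Cell 0 (Const 1)) (Var 42)) (Cell HD (Var 43))) Skip) Skip) Skip"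
  have w: "writes body = {HD}" by (auto simp: body_def)
  let ?ks = "\<lambda>n. filter (\<lambda>k. k < s 0 1 \<and> s COMP (s HD k) \<noteq> 0 \<and> s ANC (s HD k) \<noteq> 0) [0..<n]"
  have "(\<forall>i. i \<noteq> s 0 1 + s 42 0 \<longrightarrow> t HD i = s HD i) \<and>
    (?ks (2 * s 0 1) \<noteq> [] \<longrightarrow> t HD (s 0 1 + s 42 0) = s HD (last (?ks (2 * s 0 1))))"
    unfolding t_def find_root_def body_def[symmetric]
  proof (rule For_rule[where P = "\<lambda>j u. (\<forall>i. i \<noteq> s 0 1 + s 42 0 \<longrightarrow> u HD i = s HD i) \<and>
      (?ks j \<noteq> [] \<longrightarrow> u HD (s 0 1 + s 42 0) = s HD (last (?ks j)))"])
    fix j u assume j: "\<And>a. a \<noteq> 43 \<Longrightarrow> a \<notin> writes body \<Longrightarrow> u a = s a" "u 43 0 = j"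
      and IH: "(\<forall>i. i \<noteq> s 0 1 + s 42 0 \<longrightarrow> u HD i = s HD i) \<and>
        (?ks j \<noteq> [] \<longrightarrow> u HD (s 0 1 + s 42 0) = s HD (last (?ks j)))"
    have eq: "u 0 = s 0" "u COMP = s COMP" "u ANC = s ANC" "u 42 = s 42"
      by (simp_all add: j(1) w)
    have HDj: "j < s 0 1 \<Longrightarrow> u HD j = s HD j" using IH by simp
    have "sem body u HD = (if j < s 0 1 \<and> s COMP (s HD j) \<noteq> 0 \<and> s ANC (s HD j) \<noteq> 0
        then (u HD)(s 0 1 + s 42 0 := s HD j) else u HD)"
      using HDj by (auto simp: body_def eq j(2))
    then show "(\<forall>i. i \<noteq> s 0 1 + s 42 0 \<longrightarrow> sem body u HD i = s HD i) \<and>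
      (?ks (Suc j) \<noteq> [] \<longrightarrow> sem body u HD (s 0 1 + s 42 0) = s HD (last (?ks (Suc j))))"
      using IH by auto
  qed auto
  then show "i \<noteq> s 0 1 + s 42 0 \<Longrightarrow> t HD i = s HD i"
    "ks \<noteq> [] \<Longrightarrow> t HD (s 0 1 + s 42 0) = s HD (last ks)"
    by (auto simp: ks_def)
qed

lemma sem_add_stars:
  fixes s :: state
  assumes F: "flags s CUR = {..<s 0 1}"
  defines "t \<equiv> sem add_stars s"
  shows "i < s 0 1 \<Longrightarrow> t TL i = s TL i" "i < s 0 1 \<Longrightarrow> t HD i = s HD i"
    "network.star (t TL) (t HD) {..<s 0 1} {s 0 1..<2 * s 0 1}"
proof -
  let ?m = "s 0 1"
  interpret N: network "s TL" "s HD" "{..<?m}" by unfold_locales simp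
  define body where "body = Assign TL (Plus (Cell 0 (Const 1)) (Var 42)) (Cell HD (Var 42)) ;;
      ROOT ::= Cell HD (Var 42) ;; reach_from TL HD CUR COMP ;; reach_from HD TL CUR ANC ;;
      find_root"
  have w: "writes body = {TL, HD, ROOT, COMP, ANC, 30, 31, 43}" by (auto simp: body_def)
  \<comment> \<open>The last head in scan order depends only on the strong component, so all its
    vertices agree on the root.\<close>
  define rep where "rep y = s HD (last (filter (\<lambda>k. k < ?m \<and> N.strong y (s HD k)) [0..<2 * ?m]))" for y
  have "(\<forall>i<?m. t TL i = s TL i \<and> t HD i = s HD i) \<and>
    (\<forall>i<2 * ?m. i < ?m \<longrightarrow> t TL (?m + i) = s HD i \<and> t HD (?m + i) = rep (s HD i))"
    unfolding t_def add_stars_def body_def[symmetric]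
  proof (rule For_rule[where P = "\<lambda>j u. (\<forall>i<?m. u TL i = s TL i \<and> u HD i = s HD i) \<and>
      (\<forall>i<j. i < ?m \<longrightarrow> u TL (?m + i) = s HD i \<and> u HD (?m + i) = rep (s HD i))"])
    let ?body = "Ite (Minus (Cell 0 (Const 1)) (Var 42)) body Skip"
    fix j u assume j: "\<And>a. a \<noteq> 42 \<Longrightarrow> a \<notin> writes ?body \<Longrightarrow> u a = s a" "u 42 0 = j"
      and IH: "(\<forall>i<?m. u TL i = s TL i \<and> u HD i = s HD i) \<and>
        (\<forall>i<j. i < ?m \<longrightarrow> u TL (?m + i) = s HD i \<and> u HD (?m + i) = rep (s HD i))"
    have eq: "u 0 = s 0" "u CUR = s CUR" by (simp_all add: j(1) w)
    show "(\<forall>i<?m. sem ?body u TL i = s TL i \<and> sem ?body u HD i = s HD i) \<and>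
      (\<forall>i<Suc j. i < ?m \<longrightarrow> sem ?body u TL (?m + i) = s HD i \<and> sem ?body u HD (?m + i) = rep (s HD i))"
    proof (cases "j < ?m")
      case False
      then have "sem ?body u = u" by (simp add: eq j(2))
      then show ?thesis using IH False by (auto simp: less_Suc_eq)
    next
      case True
      let ?y = "s HD j"
      define u1 where "u1 = u(TL := (u TL)(?m + j := ?y), ROOT := (u ROOT)(0 := ?y))"
      define u2 where "u2 = sem (reach_from TL HD CUR COMP) u1"
      define u3 where "u3 = sem (reach_from HD TL CUR ANC) u2"
      have sem: "sem ?body u = sem find_root u3"
        using True IH by (simp add: eq j(2) body_def u1_def u2_def u3_def)
      have e1: "u1 TL i = s TL i" "u1 HD i = s HD i" if "i < ?m" for i
        using that IH by (auto simp: u1_def)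
      have fl: "flags u1 CUR = {..<?m}" "flags u2 CUR = {..<?m}"
        using F by (simp_all add: u1_def u2_def flags_def eq)
      have g: "arc_rel (u1 TL) (u1 HD) {..<?m} = N.arcs {..<?m}"
        "arc_rel (u1 HD) (u1 TL) {..<?m} = arc_rel (s HD) (s TL) {..<?m}"
        by (rule arc_rel_cong; use e1 in simp)+
      have u10: "u1 0 = s 0" by (simp add: u1_def eq)
      have V: "s HD k \<in> u1 HD ` {..<2 * ?m}" if "k < ?m" for k
        using e1(2)[OF that] that by (intro image_eqI[of _ _ k]) auto
      have comp: "u2 COMP (s HD k) \<noteq> 0 \<longleftrightarrow> N.conn {..<?m} ?y (s HD k)" if "k < ?m" for k
      proof -
        have "u2 COMP (s HD k) \<noteq> 0 \<longleftrightarrow> (u1 ROOT 0, s HD k) \<in> (graph u1 TL HD CUR)\<^sup>*"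
          unfolding u2_def using V[OF that] by (intro sem_reach_from) (auto simp: u10)
        also have "u1 ROOT 0 = ?y" by (simp add: u1_def)
        finally show ?thesis unfolding fl(1) g(1) .
      qed
      have anc: "u3 ANC (s HD k) \<noteq> 0 \<longleftrightarrow> N.conn {..<?m} (s HD k) ?y" if "k < ?m" for k
      proof -
        have "u3 ANC (s HD k) \<noteq> 0 \<longleftrightarrow> (u2 ROOT 0, s HD k) \<in> (graph u2 HD TL CUR)\<^sup>*"
          unfolding u3_def using V[OF that]
          by (intro sem_reach_from) (auto simp: u2_def u10)
        also have "u2 ROOT 0 = ?y" by (simp add: u2_def u1_def)
        also have "graph u2 HD TL CUR = (N.arcs {..<?m})\<inverse>"
          using fl(2) g(2) by (simp add: u2_def arc_rel_converse)
        finally show ?thesis by (simp add: rtrancl_converse)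
      qed
      have "u3 HD = u1 HD" "u3 TL = u1 TL" "u3 COMP = u2 COMP"
        by (simp_all add: u3_def u2_def)
      moreover have "u3 0 = s 0" "u3 42 0 = j"
        using j(2) by (simp_all add: u3_def u2_def u1_def eq)
      ultimately have e3: "u3 0 = s 0" "u3 42 0 = j" "u3 HD = u1 HD" "u3 TL = u1 TL" "u3 COMP = u2 COMP"
        by blast+
      have ks: "filter (\<lambda>k. k < u3 0 1 \<and> u3 COMP (u3 HD k) \<noteq> 0 \<and> u3 ANC (u3 HD k) \<noteq> 0) [0..<2 * u3 0 1] =
          filter (\<lambda>k. k < ?m \<and> N.strong ?y (s HD k)) [0..<2 * ?m]" (is "?ks = ?ks'")
        unfolding e3 by (intro filter_cong) (use comp anc e1 in auto)
      have "j \<in> set ?ks'" using True by simp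
      then have ne: "?ks' \<noteq> []" by (metis list.set(1) empty_iff)
      then have "last ?ks' \<in> set ?ks'" by (rule last_in_set)
      then have "last ?ks' < ?m" by simp
      then have "sem find_root u3 HD (?m + j) = rep ?y"
        using sem_find_root(2)[of u3] ne e1(2) unfolding ks rep_def by (simp add: e3)
      moreover have "sem find_root u3 HD i = u1 HD i" if "i \<noteq> ?m + j" for i
        using sem_find_root(1)[of i u3] that by (simp add: e3)
      moreover have "sem find_root u3 TL = u1 TL" by (simp add: e3)
      ultimately show ?thesis using IH e1 unfolding sem by (auto simp: less_Suc_eq u1_def)
    qed
  qed auto
  then have below: "\<And>i. i < ?m \<Longrightarrow> t TL i = s TL i" "\<And>i. i < ?m \<Longrightarrow> t HD i = s HD i"
    and above: "\<And>i. i < ?m \<Longrightarrow> t TL (?m + i) = s HD i" "\<And>i. i < ?m \<Longrightarrow> t HD (?m + i) = rep (s HD i)"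
    by auto
  show "i < ?m \<Longrightarrow> t TL i = s TL i" "i < ?m \<Longrightarrow> t HD i = s HD i" by (rule below; simp)+
  interpret T: network "t TL" "t HD" "{..<?m}" by unfold_locales simp
  have arcs: "T.arcs {..<?m} = N.arcs {..<?m}" by (rule arc_rel_cong) (use below in simp)
  have S: "\<exists>k<?m. i = ?m + k" if "i \<in> {?m..<2 * ?m}" for i
    using that by (intro exI[of _ "i - ?m"]) auto
  have rep: "N.strong (s HD k) (rep (s HD k))" if "k < ?m" for k
  proof -
    let ?ks = "filter (\<lambda>l. l < ?m \<and> N.strong (s HD k) (s HD l)) [0..<2 * ?m]"
    have "k \<in> set ?ks" using that by simp
    then have "?ks \<noteq> []" by (metis list.set(1) empty_iff)
    then have "last ?ks \<in> set ?ks" by (rule last_in_set)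
    then show ?thesis by (simp add: rep_def)
  qed
  show "T.star {?m..<2 * ?m}"
  proof (rule T.starI)
    show "t HD ` {..<?m} \<subseteq> t TL ` {?m..<2 * ?m}"
    proof safe
      fix i assume "i < ?m"
      then show "t HD i \<in> t TL ` {?m..<2 * ?m}"
        using above(1) below(2) by (intro image_eqI[of _ _ "?m + i"]) auto
    qed
  next
    fix i assume "i \<in> {?m..<2 * ?m}"
    then show "T.strong (t TL i) (t HD i)"
      using S rep above unfolding arcs by metis
  next
    fix i j assume "i \<in> {?m..<2 * ?m}" "j \<in> {?m..<2 * ?m}" and st: "T.strong (t TL i) (t TL j)"
    then obtain k l where kl: "k < ?m" "i = ?m + k" "l < ?m" "j = ?m + l" using S by blast
    have "N.strong (s HD k) (s HD l)" using st above kl unfolding arcs by simp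
    then have "N.strong (s HD k) v \<longleftrightarrow> N.strong (s HD l) v" for v by (meson rtrancl_trans)
    then have "rep (s HD k) = rep (s HD l)" unfolding rep_def by simp
    then show "t HD i = t HD j" using above(2) kl by simp
  qed
qed

section \<open>Trying all pairs of deleted edges\<close>

definition load_current :: prog where
  "load_current = For 46 (Ite (Minus (Cell 0 (Const 1)) (Var 46))
     (Assign CUR (Var 46) (Const 1)) (Assign CUR (Var 46) (Const 0))) ;;
     Assign CUR (Var 44) (Const 0) ;; Assign CUR (Var 45) (Const 0)"

lemma writes_load_current [simp]: "writes load_current = {CUR, 46}"
  by (auto simp: load_current_def)

lemma bounded_load_current [simp]: "bounded load_current"
  by (simp add: load_current_def)

lemma sem_load_current:
  "flags (sem load_current s) CUR = {..<s 0 1} - {s 44 0, s 45 0}"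
proof -
  define body where "body = Ite (Minus (Cell 0 (Const 1)) (Var 46))
     (Assign CUR (Var 46) (Const 1)) (Assign CUR (Var 46) (Const 0))"
  have w: "writes body = {CUR}" by (auto simp: body_def)
  let ?t = "sem (For 46 body) s"
  have loop: "\<forall>i<2 * s 0 1. ?t CUR i \<noteq> 0 \<longleftrightarrow> i < s 0 1"
  proof (rule For_rule[where P = "\<lambda>j u. \<forall>i<j. u CUR i \<noteq> 0 \<longleftrightarrow> i < s 0 1"])
    fix j u assume j: "\<And>a. a \<noteq> 46 \<Longrightarrow> a \<notin> writes body \<Longrightarrow> u a = s a" "u 46 0 = j"
      and IH: "\<forall>i<j. u CUR i \<noteq> 0 \<longleftrightarrow> i < s 0 1"
    have "u 0 = s 0" by (simp add: j(1) w)
    then have "sem body u CUR = (u CUR)(j := if j < s 0 1 then 1 else 0)"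
      by (simp add: body_def j(2))
    then show "\<forall>i<Suc j. sem body u CUR i \<noteq> 0 \<longleftrightarrow> i < s 0 1"
      using IH by (auto simp: less_Suc_eq)
  qed auto
  have "sem load_current s = sem (Assign CUR (Var 44) (Const 0) ;; Assign CUR (Var 45) (Const 0)) ?t"
    by (simp add: load_current_def body_def)
  then have "sem load_current s CUR = (?t CUR)(s 44 0 := 0, s 45 0 := 0)"
    by (simp del: sem.simps(5) add: w)
  moreover have "sem load_current s 0 = s 0" by simp
  ultimately have "i \<in> flags (sem load_current s) CUR \<longleftrightarrow>
      i < 2 * s 0 1 \<and> ?t CUR i \<noteq> 0 \<and> i \<notin> {s 44 0, s 45 0}" for i
    by (simp only: flags_def mem_Collect_eq) (simp del: sem.simps(5))
  then show ?thesis using loop by auto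
qed

definition count_deleted :: prog where
  "count_deleted = COUNT ::= Const 0 ;; For 46 (Ite (Minus (Cell 0 (Const 1)) (Var 46))
     (Ite (Cell SEL (Var 46)) Skip (COUNT ::= Plus (Var COUNT) (Const 1))) Skip)"

lemma writes_count_deleted [simp]: "writes count_deleted = {COUNT, 46}"
  by (auto simp: count_deleted_def)

lemma bounded_count_deleted [simp]: "bounded count_deleted"
  by (simp add: count_deleted_def)

lemma sem_count_deleted:
  "sem count_deleted s COUNT 0 = card ({..<s 0 1} - flags s SEL)"
proof -
  define body where "body = Ite (Minus (Cell 0 (Const 1)) (Var 46))
     (Ite (Cell SEL (Var 46)) Skip (COUNT ::= Plus (Var COUNT) (Const 1))) Skip"
  have w: "writes body = {COUNT}" by (auto simp: body_def)
  let ?s = "s(COUNT := (s COUNT)(0 := 0))"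
  let ?X = "{..<s 0 1} - flags s SEL"
  have "sem (For 46 body) ?s COUNT 0 = card (?X \<inter> {..<2 * ?s 0 1})"
  proof (rule For_rule[where P = "\<lambda>j u. u COUNT 0 = card (?X \<inter> {..<j})"])
    fix j u assume j: "j < 2 * ?s 0 1" "\<And>a. a \<noteq> 46 \<Longrightarrow> a \<notin> writes body \<Longrightarrow> u a = ?s a" "u 46 0 = j"
      and IH: "u COUNT 0 = card (?X \<inter> {..<j})"
    have eq: "u 0 = s 0" "u SEL = s SEL" by (simp_all add: j(2) w)
    have X: "j \<in> ?X \<longleftrightarrow> j < s 0 1 \<and> s SEL j = 0" using j(1) by (auto simp: flags_def)
    have "sem body u COUNT 0 = (if j \<in> ?X then Suc (u COUNT 0) else u COUNT 0)"
      unfolding X by (simp add: body_def eq j(3))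
    moreover have "?X \<inter> {..<Suc j} = (if j \<in> ?X then insert j (?X \<inter> {..<j}) else ?X \<inter> {..<j})"
      by (auto simp: lessThan_Suc)
    ultimately show "sem body u COUNT 0 = card (?X \<inter> {..<Suc j})" using IH by simp
  qed auto
  moreover have "?X \<inter> {..<2 * ?s 0 1} = ?X" by auto
  moreover have "sem count_deleted s = sem (For 46 body) ?s"
    by (simp add: count_deleted_def body_def)
  ultimately show ?thesis by metis
qed

definition update_best :: prog where
  "update_best = Ite (Minus (Var COUNT) (Var VALUE))
     (VALUE ::= Var COUNT ;; For 46 (Assign BEST (Var 46) (Cell SEL (Var 46)))) Skip"

lemma writes_update_best [simp]: "writes update_best = {VALUE, BEST, 46}"
  by (auto simp: update_best_def)

lemma bounded_update_best [simp]: "bounded update_best"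
  by (simp add: update_best_def)

lemma sem_update_best:
  fixes s :: state
  defines "t \<equiv> sem update_best s"
  shows "t VALUE 0 = max (s VALUE 0) (s COUNT 0)"
    "flags t BEST = (if s VALUE 0 < s COUNT 0 then flags s SEL else flags s BEST)"
proof -
  define body where "body = Assign BEST (Var 46) (Cell SEL (Var 46))"
  have w: "writes body = {BEST}" by (auto simp: body_def)
  let ?s = "s(VALUE := (s VALUE)(0 := s COUNT 0))"
  have copy: "\<forall>i<2 * ?s 0 1. sem (For 46 body) ?s BEST i = s SEL i"
  proof (rule For_rule[where P = "\<lambda>j u. \<forall>i<j. u BEST i = s SEL i"])
    fix j u assume j: "\<And>a. a \<noteq> 46 \<Longrightarrow> a \<notin> writes body \<Longrightarrow> u a = ?s a" "u 46 0 = j"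
      and IH: "\<forall>i<j. u BEST i = s SEL i"
    have "u SEL = s SEL" by (simp add: j(1) w)
    then show "\<forall>i<Suc j. sem body u BEST i = s SEL i"
      using IH by (auto simp: less_Suc_eq body_def j(2))
  qed auto
  have t: "t = (if s VALUE 0 < s COUNT 0 then sem (For 46 body) ?s else s)"
    by (simp add: t_def update_best_def body_def)
  show "t VALUE 0 = max (s VALUE 0) (s COUNT 0)"
    by (simp del: sem.simps(5) add: t w)
  have "flags (sem (For 46 body) ?s) BEST = flags s SEL"
  proof -
    have "sem (For 46 body) ?s 0 = s 0" by (simp del: sem.simps(5) add: w)
    then show ?thesis using copy by (auto simp: flags_def simp del: sem.simps(5))
  qed
  then show "flags t BEST = (if s VALUE 0 < s COUNT 0 then flags s SEL else flags s BEST)"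
    by (simp only: t split: if_split) simp
qed

definition attempt :: prog where
  "attempt = Ite (Minus (Cell 0 (Const 1)) (Var 44)) (Ite (Minus (Cell 0 (Const 1)) (Var 45))
     (Ite (Cell REQ (Var 44)) Skip (Ite (Cell REQ (Var 45)) Skip
       (load_current ;; test CUR ;; Ite (Var OK) (solve ;; count_deleted ;; update_best) Skip))) Skip) Skip"

definition search :: prog where
  "search = For 44 (For 45 attempt)"

lemma writes_attempt: "writes attempt \<inter> {0, TL, HD, REQ, 44, 45} = {}"
  by (simp add: attempt_def)

lemma bounded_search [simp]: "bounded search"
  by (simp add: search_def attempt_def)

lemma writes_search: "writes search \<inter> {0, TL, HD, REQ} = {}"
  by (simp add: search_def attempt_def)

definition best_ok :: "state \<Rightarrow> bool" where
  "best_ok s \<longleftrightarrow> flags s REQ \<subseteq> flags s BEST \<and> flags s BEST \<subseteq> {..<s 0 1} \<and>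
     connects s (flags s BEST) \<and> s VALUE 0 = card ({..<s 0 1} - flags s BEST)"

text \<open>For \<open>f \<noteq> g\<close> and an optimal \<open>A\<close> this is the bound of
  half the optimum plus one, multiplied by two. For \<open>f = g\<close> the summand is 1, which is
  what an optimum of 1 needs.\<close>

definition beats :: "state \<Rightarrow> nat \<Rightarrow> nat \<Rightarrow> bool" where
  "beats s f g \<longleftrightarrow> (\<forall>A. flags s REQ \<subseteq> A \<longrightarrow> A \<subseteq> {..<s 0 1} - {f, g} \<longrightarrow> connects s A \<longrightarrow>
     card ({..<s 0 1} - A) + card {f, g} \<le> 2 * s VALUE 0)"

definition instance_ok :: "state \<Rightarrow> bool" where
  "instance_ok s \<longleftrightarrow> flags s REQ \<subseteq> {..<s 0 1} \<and> inj_on (\<lambda>i. (s TL i, s HD i)) {..<s 0 1} \<and>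
     network.star (s TL) (s HD) {..<s 0 1} {s 0 1..<2 * s 0 1}"

lemma connects_rtrancl:
  assumes "F \<subseteq> {..<s 0 1}" "connects s F"
  shows "(arc_rel (s TL) (s HD) F)\<^sup>* = (arc_rel (s TL) (s HD) {..<s 0 1})\<^sup>*"
proof
  have "arc_rel (s TL) (s HD) F \<subseteq> arc_rel (s TL) (s HD) {..<s 0 1}"
    using assms(1) by (auto simp: arc_rel_def)
  then show "(arc_rel (s TL) (s HD) F)\<^sup>* \<subseteq> (arc_rel (s TL) (s HD) {..<s 0 1})\<^sup>*"
    by (rule rtrancl_mono)
  have "arc_rel (s TL) (s HD) {..<s 0 1} \<subseteq> (arc_rel (s TL) (s HD) F)\<^sup>*"
    using assms(2) unfolding connects_def by (auto dest: trancl_into_rtrancl)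
  then show "(arc_rel (s TL) (s HD) {..<s 0 1})\<^sup>* \<subseteq> (arc_rel (s TL) (s HD) F)\<^sup>*"
    by (rule rtrancl_subset_rtrancl)
qed

lemma sem_attempt:
  fixes s :: state
  assumes ok: "instance_ok s" "best_ok s"
  defines "t \<equiv> sem attempt s"
  shows "best_ok t" "s VALUE 0 \<le> t VALUE 0"
    "{s 44 0, s 45 0} \<subseteq> {..<s 0 1} - flags s REQ \<Longrightarrow> beats t (s 44 0) (s 45 0)"
proof -
  let ?m = "s 0 1" and ?f = "s 44 0" and ?g = "s 45 0"
  let ?D = "flags s REQ"
  let ?F = "{..<?m} - {?f, ?g}"
  have req: "i \<in> ?D \<longleftrightarrow> s REQ i \<noteq> 0" if "i < ?m" for i using that by (simp add: flags_def)
  have "best_ok t \<and> s VALUE 0 \<le> t VALUE 0 \<and> ({?f, ?g} \<subseteq> {..<?m} - ?D \<longrightarrow> beats t ?f ?g)"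
  proof (cases "{?f, ?g} \<subseteq> {..<?m} - ?D")
    case False
    then have "t = s" using req by (auto simp: t_def attempt_def)
    then show ?thesis using False ok(2) order_refl by metis
  next
    case True
    define s1 where "s1 = sem load_current s"
    define s2 where "s2 = sem (test CUR) s1"
    have t: "t = (if s2 OK 0 \<noteq> 0 then sem (solve ;; count_deleted ;; update_best) s2 else s2)"
    proof -
      have "?f < ?m" "?g < ?m" "s REQ ?f = 0" "s REQ ?g = 0" using True req by auto
      then show ?thesis by (simp add: t_def attempt_def s1_def s2_def)
    qed
    have cur: "flags s1 CUR = ?F" by (simp add: s1_def sem_load_current)
    have fr1: "s1 0 = s 0" "s1 TL = s TL" "s1 HD = s HD" by (simp_all add: s1_def)
    have "connects s1 = connects s" using fr1 by (intro connects_cong)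
    then have OK: "s2 OK 0 \<noteq> 0 \<longleftrightarrow> connects s ?F"
      using sem_test[of CUR s1] by (simp add: s2_def cur)
    have fr2: "s2 0 = s 0" "s2 TL = s TL" "s2 HD = s HD" "s2 REQ = s REQ" "s2 BEST = s BEST"
      "s2 VALUE = s VALUE" "flags s2 CUR = ?F" "flags s2 REQ = ?D" "flags s2 BEST = flags s BEST"
      using cur by (simp_all add: s2_def s1_def)
    have conn2: "connects s2 = connects s" using fr2 by (intro connects_cong)
    show ?thesis
    proof (cases "connects s ?F")
      case False
      then have "t = s2" using OK t by simp
      \<comment> \<open>No competitor avoids the pair, so \<open>beats\<close> holds
        vacuously.\<close>
      moreover have "\<not> connects s A" if "A \<subseteq> ?F" for A
        using False monoD[OF mono_connects that, of s] by auto
      ultimately show ?thesis using ok(2) unfolding best_ok_def beats_def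
        by (simp add: fr2 conn2)
    next
      case conn: True
      define s3 where "s3 = sem solve s2"
      define s4 where "s4 = sem count_deleted s3"
      have t: "t = sem update_best s4" using OK conn t by (simp add: s3_def s4_def)
      let ?H = "flags s3 SEL"
      have star: "network.star (s TL) (s HD) ?F {?m..<2 * ?m}"
        using ok(1) star_cong[OF _ _ connects_rtrancl[OF _ conn]] by (auto simp: instance_ok_def)
      have inj: "inj_on (\<lambda>i. (s2 TL i, s2 HD i)) {..<s2 0 1}"
        using ok(1) by (simp add: instance_ok_def fr2)
      have DF: "?D \<subseteq> ?F" using True ok(1) by (auto simp: instance_ok_def)
      note solve = sem_solve[of s2, folded s3_def, unfolded fr2 conn2, OF _ DF conn _ star]
      have inj': "inj_on (\<lambda>i. (s TL i, s HD i)) {..<?m}" using ok(1) by (simp add: instance_ok_def)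
      have H: "?D \<subseteq> ?H" "?H \<subseteq> ?F" "connects s ?H"
        by (rule solve; use inj' in blast)+
      have half: "card (?F - A) \<le> 2 * card (?F - ?H)" if "?D \<subseteq> A" "A \<subseteq> ?F" "connects s A" for A
        using solve(4)[OF _ inj' that] by blast
      have fr3: "s3 0 = s 0" "s3 BEST = s BEST" "s3 VALUE = s VALUE" by (simp_all add: s3_def fr2)
      have fr4: "s4 VALUE = s VALUE" "flags s4 SEL = ?H" "flags s4 BEST = flags s BEST"
        "s4 COUNT 0 = card ({..<?m} - ?H)"
        using sem_count_deleted[of s3] by (simp_all add: s4_def s3_def fr2)
      have frt: "t 0 = s 0" "t TL = s TL" "t HD = s HD" "flags t REQ = ?D"
        by (simp_all add: t s4_def s3_def fr2)
      have connt: "connects t = connects s" using frt by (intro connects_cong)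
      note upd = sem_update_best[of s4, folded t, unfolded fr4]
      have "best_ok t"
        using ok(2) H upd unfolding best_ok_def frt connt by auto
      moreover have "s VALUE 0 \<le> t VALUE 0" using upd by simp
      moreover have "beats t ?f ?g"
        unfolding beats_def frt connt
      proof (intro allI impI)
        fix A assume A: "?D \<subseteq> A" "A \<subseteq> ?F" "connects s A"
        have split: "card ({..<?m} - B) = card (?F - B) + card {?f, ?g}" if "B \<subseteq> ?F" for B
        proof -
          have "{..<?m} - B = (?F - B) \<union> {?f, ?g}" using that True by auto
          moreover have "card ((?F - B) \<union> {?f, ?g}) = card (?F - B) + card {?f, ?g}"
            by (intro card_Un_disjoint) auto
          ultimately show ?thesis by simp
        qed
        \<comment> \<open>Both \<open>A\<close> and \<open>?H\<close> delete the pair. Doubling the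
          value of \<open>?H\<close> counts the pair twice, which pays for the extra summand on the
          left.\<close>
        show "card ({..<?m} - A) + card {?f, ?g} \<le> 2 * t VALUE 0"
          using split[OF A(2)] split[OF H(2)] half[OF A] upd(1) by linarith
      qed
      ultimately show ?thesis by blast
    qed
  qed
  then show "best_ok t" "s VALUE 0 \<le> t VALUE 0"
    "{?f, ?g} \<subseteq> {..<?m} - ?D \<Longrightarrow> beats t ?f ?g"
    by blast+
qed

text \<open>Apart from data that stay fixed, \<open>beats\<close> depends only on
  \<open>VALUE\<close>, which never decreases. What one attempt has achieved therefore persists to
  the end.\<close>

lemma sem_search:
  fixes s :: state
  assumes ok: "instance_ok s" "best_ok s"
  defines "t \<equiv> sem search s"
  shows "best_ok t" "f \<in> {..<s 0 1} - flags s REQ \<Longrightarrow> g \<in> {..<s 0 1} - flags s REQ \<Longrightarrow> beats t f g"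
proof -
  let ?Q = "{..<s 0 1} - flags s REQ"
  define same where "same u \<longleftrightarrow> u 0 = s 0 \<and> u TL = s TL \<and> u HD = s HD \<and> u REQ = s REQ" for u :: state
  have flags_same: "flags u REQ = flags s REQ" "connects u = connects s" "instance_ok u"
    if "same u" for u
  proof -
    show "flags u REQ = flags s REQ" using that unfolding same_def by (intro flags_cong) auto
    moreover show "connects u = connects s" using that unfolding same_def by (intro connects_cong) auto
    ultimately show "instance_ok u" using ok(1) that by (simp add: instance_ok_def same_def)
  qed
  have beats_put: "beats (put i k u) f g = beats u f g" if "i \<in> {44, 45}" for i k u f g
  proof -
    have "connects (put i k u) = connects u" using that by (intro connects_cong) auto
    then show ?thesis using that by (auto simp: beats_def)
  qed
  have best_put: "best_ok (put i k u) = best_ok u" if "i \<in> {44, 45}" for i k u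
  proof -
    have "connects (put i k u) = connects u" using that by (intro connects_cong) auto
    then show ?thesis using that by (auto simp: best_ok_def)
  qed
  have beats_mono: "beats v f g" if "beats u f g" "same u" "same v" "u VALUE 0 \<le> v VALUE 0" for u v f g
    using that flags_same[OF that(2)] flags_same[OF that(3)] unfolding beats_def same_def
    by (auto intro: order_trans)
  have "best_ok t \<and> (\<forall>f<2 * s 0 1. \<forall>g<2 * s 0 1. f \<in> ?Q \<longrightarrow> g \<in> ?Q \<longrightarrow> beats t f g)"
    unfolding t_def search_def
  proof (rule For_rule[where P = "\<lambda>j u. best_ok u \<and>
      (\<forall>f<j. \<forall>g<2 * s 0 1. f \<in> ?Q \<longrightarrow> g \<in> ?Q \<longrightarrow> beats u f g)"])
    fix j u assume j: "\<And>a. a \<noteq> 44 \<Longrightarrow> a \<notin> writes (For 45 attempt) \<Longrightarrow> u a = s a" "u 44 0 = j"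
      and IH: "best_ok u \<and> (\<forall>f<j. \<forall>g<2 * s 0 1. f \<in> ?Q \<longrightarrow> g \<in> ?Q \<longrightarrow> beats u f g)"
    have u: "same u" using writes_attempt by (auto simp: same_def j(1))
    then have u0: "u 0 = s 0" by (simp add: same_def)
    let ?u = "sem (For 45 attempt) u"
    have u': "same ?u" using u writes_attempt by (auto simp: same_def sem_frame simp del: sem.simps)
    have "best_ok ?u \<and> u VALUE 0 \<le> ?u VALUE 0 \<and> (\<forall>g<2 * u 0 1. j \<in> ?Q \<longrightarrow> g \<in> ?Q \<longrightarrow> beats ?u j g)"
    proof (rule For_rule[where P = "\<lambda>l v. best_ok v \<and> u VALUE 0 \<le> v VALUE 0 \<and>
        (\<forall>g<l. j \<in> ?Q \<longrightarrow> g \<in> ?Q \<longrightarrow> beats v j g)"])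
      fix l v assume l: "\<And>a. a \<noteq> 45 \<Longrightarrow> a \<notin> writes attempt \<Longrightarrow> v a = u a" "v 45 0 = l"
        and IH: "best_ok v \<and> u VALUE 0 \<le> v VALUE 0 \<and> (\<forall>g<l. j \<in> ?Q \<longrightarrow> g \<in> ?Q \<longrightarrow> beats v j g)"
      have v: "same v" using u writes_attempt by (auto simp: same_def l(1))
      have v44: "v 44 0 = j" using l(1) writes_attempt j(2) by auto
      let ?v = "sem attempt v"
      have v': "same ?v" using v writes_attempt by (auto simp: same_def sem_frame)
      have v0: "v 0 = s 0" using v by (simp add: same_def)
      note at = sem_attempt[OF flags_same(3)[OF v] conjunct1[OF IH]]
      have new: "beats ?v j l" if "j \<in> ?Q" "l \<in> ?Q"
        using at(3) that by (simp add: v44 l(2) v0 flags_same(1)[OF v])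
      have "beats ?v j g" if "g < l" "j \<in> ?Q" "g \<in> ?Q" for g
        using IH that at(2) v v' beats_mono by blast
      with new show "best_ok ?v \<and> u VALUE 0 \<le> ?v VALUE 0 \<and>
        (\<forall>g<Suc l. j \<in> ?Q \<longrightarrow> g \<in> ?Q \<longrightarrow> beats ?v j g)"
        using IH at(1,2) by (auto simp: less_Suc_eq)
    qed (use IH beats_put best_put in auto)
    then show "best_ok ?u \<and> (\<forall>f<Suc j. \<forall>g<2 * s 0 1. f \<in> ?Q \<longrightarrow> g \<in> ?Q \<longrightarrow> beats ?u f g)"
      using IH u u' beats_mono unfolding u0 less_Suc_eq by blast
  qed (use ok(2) beats_put best_put in auto)
  then show "best_ok t" "f \<in> ?Q \<Longrightarrow> g \<in> ?Q \<Longrightarrow> beats t f g" by auto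
qed

text \<open>Overwriting arrays 1 and 2 is harmless, since the ends of the edges were copied. Array 0
  is written last, as \<open>bounded\<close> demands.\<close>

definition write_output :: prog where
  "write_output = For 46 (Ite (Cell BEST (Var 46))
     (Assign 1 (Var OUT) (Cell TL (Var 46)) ;; Assign 2 (Var OUT) (Cell HD (Var 46)) ;;
      OUT ::= Plus (Var OUT) (Const 1)) Skip) ;; Assign 0 (Const 0) (Var OUT)"

lemma bounded_write_output [simp]: "bounded write_output"
  by (simp add: write_output_def)

lemma sem_write_output:
  assumes "s OUT 0 = 0"
  shows "output_edges (sem write_output s) =
    map (\<lambda>i. (s TL i, s HD i)) (filter (\<lambda>i. i \<in> flags s BEST) [0..<2 * s 0 1])"
proof -
  define body where "body = Ite (Cell BEST (Var 46))
     (Assign 1 (Var OUT) (Cell TL (Var 46)) ;; Assign 2 (Var OUT) (Cell HD (Var 46)) ;;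
      OUT ::= Plus (Var OUT) (Const 1)) Skip"
  have w: "writes body = {1, 2, OUT}" by (auto simp: body_def)
  let ?out = "\<lambda>u :: state. map (\<lambda>i. (u 1 i, u 2 i)) [0..<u OUT 0]"
  let ?e = "\<lambda>i. (s TL i, s HD i)"
  let ?t = "sem (For 46 body) s"
  have "?out ?t = map ?e (filter (\<lambda>i. i \<in> flags s BEST) [0..<2 * s 0 1])"
  proof (rule For_rule[where P = "\<lambda>j u. ?out u = map ?e (filter (\<lambda>i. i \<in> flags s BEST) [0..<j])"])
    fix j u assume j: "j < 2 * s 0 1" "\<And>a. a \<noteq> 46 \<Longrightarrow> a \<notin> writes body \<Longrightarrow> u a = s a" "u 46 0 = j"
      and IH: "?out u = map ?e (filter (\<lambda>i. i \<in> flags s BEST) [0..<j])"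
    have eq: "u BEST = s BEST" "u TL = s TL" "u HD = s HD" by (simp_all add: j(2) w)
    have best: "j \<in> flags s BEST \<longleftrightarrow> s BEST j \<noteq> 0" using j(1) by (simp add: flags_def)
    show "?out (sem body u) = map ?e (filter (\<lambda>i. i \<in> flags s BEST) [0..<Suc j])"
    proof (cases "s BEST j = 0")
      case True
      then have "sem body u = u" by (simp add: body_def eq j(3))
      then show ?thesis using IH best True by simp
    next
      case False
      then have 1: "sem body u OUT 0 = Suc (u OUT 0)" by (simp add: body_def eq j(3))
      have 2: "sem body u 1 = (u 1)(u OUT 0 := s TL j)" "sem body u 2 = (u 2)(u OUT 0 := s HD j)"
        using False by (simp_all add: body_def eq j(3))
      have "?out (sem body u) = ?out u @ [?e j]" unfolding 1 2 by simp
      then show ?thesis using IH best False by simp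
    qed
  qed (use assms in auto)
  moreover have "sem write_output s = ?t(0 := (?t 0)(0 := ?t OUT 0))"
    by (simp add: write_output_def body_def)
  then have "output_edges (sem write_output s) = ?out ?t"
    by (simp add: output_edges_def del: sem.simps)
  ultimately show ?thesis by simp
qed

section \<open>The whole program and its guarantee\<close>

definition max_tr_program :: prog where
  "max_tr_program = read_edges ;; read_required ;; add_stars ;; search ;; write_output"

lemma bounded_max_tr_program: "bounded max_tr_program"
  using writes_search by (simp add: max_tr_program_def)

lemma sem_max_tr_program:
  fixes vs :: "nat list"
  assumes DE: "D \<subseteq> E" and es: "list_of es E" and ds: "list_of ds D"
  defines "s \<equiv> input_state vs es ds"
  shows "\<exists>H. list_of (output_edges (sem max_tr_program s)) H \<and> transitive_reduction E D H \<and>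
    (let k = max_deleted E D in
      (2 \<le> k \<longrightarrow> real (card (E - H)) \<ge> 0.5 * real k + 1) \<and> (k < 2 \<longrightarrow> card (E - H) = k))"
proof -
  define m where "m = length es"
  have es': "distinct es" "set es = E" and ds': "distinct ds" "set ds = D"
    using es ds by (auto simp: list_of_def)
  have finE: "finite E" using es'(2) by auto
  have E_eq: "E = (!) es ` {..<m}"
    unfolding es'(2)[symmetric] set_conv_nth m_def by auto
  have inj: "inj_on ((!) es) {..<m}"
    using es'(1) by (auto simp: m_def inj_on_def nth_eq_iff_index_eq)
  have "length ds \<le> m"
    using card_mono[OF finE DE] by (simp add: m_def distinct_card[OF es'(1), symmetric]
        distinct_card[OF ds'(1), symmetric] es' ds')
  have s: "s 0 1 = m" "s 0 2 = length ds"
    "\<And>i. i < m \<Longrightarrow> s 2 i = fst (es ! i)" "\<And>i. i < m \<Longrightarrow> s 3 i = snd (es ! i)"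
    "\<And>i. i < length ds \<Longrightarrow> s 4 i = fst (ds ! i)" "\<And>i. i < length ds \<Longrightarrow> s 5 i = snd (ds ! i)"
    "\<And>a. 6 \<le> a \<Longrightarrow> s a = (\<lambda>_. 0)"
    by (auto simp: s_def input_state_def load_def m_def nth_Cons' fun_eq_iff)
  define s1 where "s1 = sem read_edges s"
  define s2 where "s2 = sem read_required s1"
  define s3 where "s3 = sem add_stars s2"
  define s4 where "s4 = sem search s3"
  note r1 = sem_read_edges[of s, OF s(7) s(7), folded s1_def]
  have f1: "s1 a = s a" if "a \<notin> {TL, HD, CUR, BEST, 40}" for a using that by (simp add: s1_def)
  have f2: "s2 a = s1 a" if "a \<notin> {REQ, 40, 41}" for a using that by (simp add: s2_def)
  have f3: "s3 a = s2 a" if "a \<notin> {TL, HD, ROOT, COMP, ANC, 30, 31, 42, 43}" for a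
    using that by (simp add: s3_def)
  have zero: "s1 0 = s 0" "s2 0 = s 0" "s3 0 = s 0" by (simp_all add: f1 f2 f3)
  have ends2: "s2 TL i = fst (es ! i)" "s2 HD i = snd (es ! i)" if "i < m" for i
    using r1(1,2)[of i, unfolded s(1)] s(3,4)[OF that] that by (simp_all add: f2)
  have "flags s2 CUR = {..<s2 0 1}"
    using r1(3) by (simp del: One_nat_def add: s2_def zero)
  note r3 = sem_add_stars[OF this, folded s3_def, unfolded zero s(1)]
  have ends3: "s3 TL i = fst (es ! i)" "s3 HD i = snd (es ! i)" if "i < m" for i
    using r3(1,2)[OF that] ends2[OF that] by simp_all
  have req: "flags s3 REQ = {i. i < m \<and> es ! i \<in> D}"
  proof -
    have "flags s3 REQ = flags s2 REQ" by (simp add: s3_def)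
    also have "\<dots> = {i. i < m \<and> (\<exists>k < 2 * m. k < length ds \<and> s 4 k = s 2 i \<and> s 5 k = s 3 i)}"
      using sem_read_required[of s1] by (simp del: One_nat_def add: s2_def zero s f1)
    also have "\<dots> = {i. i < m \<and> es ! i \<in> D}"
    proof (intro Collect_cong conj_cong refl iffI)
      fix i assume i: "i < m" "\<exists>k < 2 * m. k < length ds \<and> s 4 k = s 2 i \<and> s 5 k = s 3 i"
      then obtain k where "k < length ds" "ds ! k = es ! i" by (auto simp: s prod_eq_iff)
      then show "es ! i \<in> D" using ds'(2) nth_mem by metis
    next
      fix i assume i: "i < m" "es ! i \<in> D"
      then obtain k where "k < length ds" "ds ! k = es ! i"
        using ds'(2) by (metis in_set_conv_nth)
      then show "\<exists>k < 2 * m. k < length ds \<and> s 4 k = s 2 i \<and> s 5 k = s 3 i"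
        using i \<open>length ds \<le> m\<close> by (intro exI[of _ k]) (auto simp: s)
    qed
    finally show ?thesis .
  qed
  have arcs3: "arc_rel (s3 TL) (s3 HD) P = (!) es ` P" if "P \<subseteq> {..<m}" for P
    unfolding arc_rel_def using that ends3 by (intro image_cong) auto
  have m3: "s3 0 1 = m" by (simp only: zero s)
  have conn3: "connects s3 P \<longleftrightarrow> E \<subseteq> ((!) es ` P)\<^sup>+" if "P \<subseteq> {..<m}" for P
    unfolding connects_def m3 arcs3[OF order_refl] arcs3[OF that] E_eq ..
  have "inj_on (\<lambda>i. (s3 TL i, s3 HD i)) {..<m}"
    using inj by (simp add: inj_on_def ends3)
  then have inst: "instance_ok s3"
    unfolding instance_ok_def m3 using r3(3) req by auto
  have "flags s3 BEST = {..<m}" using r1(4) by (simp del: One_nat_def add: s3_def s2_def s(1))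
  moreover have "connects s3 {..<m}" unfolding conn3[OF order_refl] E_eq by auto
  moreover have "s3 VALUE 0 = 0" by (simp add: f1 f2 f3 s)
  ultimately have best: "best_ok s3" using req unfolding best_ok_def m3 by auto
  note search = sem_search[OF inst best, folded s4_def]
  have f4: "s4 0 = s3 0" "s4 TL = s3 TL" "s4 HD = s3 HD" "s4 REQ = s3 REQ"
    using writes_search by (auto simp: s4_def)
  have conn4: "connects s4 = connects s3" using f4 by (intro connects_cong)
  have req4: "flags s4 REQ = flags s3 REQ" using f4 by (intro flags_cong)
  have m4: "s4 0 1 = m" by (simp only: f4 m3)
  define B where "B = flags s4 BEST"
  define H where "H = (!) es ` B"
  have B: "flags s3 REQ \<subseteq> B" "B \<subseteq> {..<m}" "E \<subseteq> H\<^sup>+" "s4 VALUE 0 = card ({..<m} - B)"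
    using search(1) conn3 unfolding best_ok_def req4 m4 conn4 B_def[symmetric] H_def by auto
  have HE: "H \<subseteq> E" using B(2) by (auto simp: H_def E_eq)
  have DH: "D \<subseteq> H"
  proof
    fix e assume e: "e \<in> D"
    then obtain i where "i < m" "e = es ! i" using DE E_eq by auto
    then show "e \<in> H" using e B(1) req by (auto simp: H_def)
  qed
  have tr: "transitive_reduction E D H"
    using DH HE B(3) trancl_mono_subset[OF HE] trancl_mono_subset[OF B(3)] trancl_id[OF trans_trancl]
    unfolding transitive_reduction_def by (metis order_antisym)
  have card: "card (E - (!) es ` P) = card ({..<m} - P)" if "P \<subseteq> {..<m}" for P
  proof -
    have "E - (!) es ` P = (!) es ` ({..<m} - P)"
      unfolding E_eq using inj that by (simp add: inj_on_image_set_diff)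
    then show ?thesis using inj by (simp add: card_image inj_on_diff)
  qed
  have val: "card (E - H) = s4 VALUE 0" using card[OF B(2)] B(4) by (simp add: H_def)
  have "transitive_reduction E D E" using DE by (simp add: transitive_reduction_def)
  moreover have "finite {card (E - A) | A. transitive_reduction E D A}"
    by (rule finite_subset[of _ "{..card E}"]) (auto intro: card_mono finE)
  ultimately obtain A where A: "transitive_reduction E D A" "card (E - A) = max_deleted E D"
    unfolding max_deleted_def
    using Max_in[of "{card (E - A) | A. transitive_reduction E D A}"] by fastforce
  \<comment> \<open>The optimum solution, translated to edge indices.\<close>
  define A' where "A' = {i. i < m \<and> es ! i \<in> A}"
  have A': "A' \<subseteq> {..<m}" by (auto simp: A'_def)
  have AA: "(!) es ` A' = A"
    using A(1) E_eq by (auto simp: A'_def transitive_reduction_def)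
  have k: "card ({..<m} - A') = max_deleted E D" using card[OF A'] A(2) AA by simp
  have "E \<subseteq> A\<^sup>+" using A(1) by (auto simp: transitive_reduction_def)
  then have connA: "connects s4 A'" unfolding conn4 conn3[OF A'] AA .
  have DA: "flags s4 REQ \<subseteq> A'"
    using A(1) by (auto simp: req4 req A'_def transitive_reduction_def)
  \<comment> \<open>Any two edges deleted by the optimum form a pair that has been tried, and the
    optimum is a competitor for this pair.\<close>
  have beats: "max_deleted E D + card {f, g} \<le> 2 * card (E - H)" if "f \<in> {..<m} - A'" "g \<in> {..<m} - A'" for f g
  proof -
    have "f \<in> {..<s3 0 1} - flags s3 REQ" "g \<in> {..<s3 0 1} - flags s3 REQ"
      unfolding m3 using that DA req4 by auto
    then have "beats s4 f g" by (rule search(2))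
    moreover have "A' \<subseteq> {..<m} - {f, g}" using A' that by auto
    ultimately have "card ({..<m} - A') + card {f, g} \<le> 2 * s4 VALUE 0"
      using DA connA unfolding beats_def m4 by simp
    then show ?thesis unfolding k val .
  qed
  have le: "card (E - H) \<le> max_deleted E D"
    using finE tr by (rule card_deleted_le_max_deleted)
  have "2 \<le> max_deleted E D \<Longrightarrow> max_deleted E D + 2 \<le> 2 * card (E - H)"
  proof -
    assume "2 \<le> max_deleted E D"
    then obtain X where "X \<subseteq> {..<m} - A'" "card X = 2" using k obtain_subset_with_card_n by metis
    then obtain f g where "f \<in> {..<m} - A'" "g \<in> {..<m} - A'" "f \<noteq> g"
      by (auto simp: card_2_iff)
    then show ?thesis using beats[of f g] by simp
  qed
  \<comment> \<open>For an optimum of 1, the pair with \<open>f = g\<close> shows that at least one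
    edge is deleted.\<close>
  moreover have "max_deleted E D < 2 \<Longrightarrow> card (E - H) = max_deleted E D"
  proof (cases "max_deleted E D = 0")
    case False
    assume "max_deleted E D < 2"
    moreover have "{..<m} - A' \<noteq> {}" using False k card.empty by metis
    then obtain f where "f \<in> {..<m} - A'" by blast
    ultimately show ?thesis using beats[of f f] le by simp
  qed (use le in simp)
  moreover have "list_of (output_edges (sem max_tr_program s)) H"
  proof -
    have "s4 OUT = s OUT"
    proof -
      have "OUT \<notin> writes search" by (simp add: search_def attempt_def)
      then show ?thesis by (simp add: s4_def f1 f2 f3)
    qed
    then have "output_edges (sem write_output s4) =
      map (\<lambda>i. (s4 TL i, s4 HD i)) (filter (\<lambda>i. i \<in> B) [0..<2 * m])"
      using sem_write_output[of s4] by (simp only: s(7) m4 B_def)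
    also have "\<dots> = map ((!) es) (filter (\<lambda>i. i \<in> B) [0..<2 * m])"
      using B(2) by (intro map_cong) (auto simp: f4 ends3)
    finally have "output_edges (sem max_tr_program s) = map ((!) es) (filter (\<lambda>i. i \<in> B) [0..<2 * m])"
      by (simp only: max_tr_program_def sem.simps s1_def s2_def s3_def s4_def)
    moreover have "set (filter (\<lambda>i. i \<in> B) [0..<2 * m]) = B" using B(2) by auto
    ultimately show ?thesis
      using inj_on_subset[OF inj B(2)] by (simp add: list_of_def distinct_map H_def)
  qed
  ultimately show ?thesis using tr by (intro exI[of _ H]) (auto simp: Let_def)
qed

text \<open>For \<open>k < 2\<close> no solution attains \<open>k / 2 + 1\<close> by
  \<open>half_plus_one_needs_two\<close>, so an optimum solution is demanded there.\<close>

theorem theorem2: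
  "\<exists>(c :: com) (p :: nat poly).
     \<forall>(V :: nat set) (E :: (nat \<times> nat) set) (D :: (nat \<times> nat) set).
       digraph V E \<longrightarrow> D \<subseteq> E \<longrightarrow>
       computes_in_time c (poly p) V E D
         (\<lambda>H. transitive_reduction E D H \<and>
              (let k = max_deleted E D in
                 (2 \<le> k \<longrightarrow> real (card (E - H)) \<ge> 0.5 * real k + 1) \<and>
                 (k < 2 \<longrightarrow> card (E - H) = k)))"
proof (intro exI allI impI)
  fix V E D assume VED: "digraph V E" "D \<subseteq> E"
  show "computes_in_time (compile max_tr_program) (poly (cost max_tr_program)) V E D
    (\<lambda>H. transitive_reduction E D H \<and>
      (let k = max_deleted E D in
        (2 \<le> k \<longrightarrow> real (card (E - H)) \<ge> 0.5 * real k + 1) \<and> (k < 2 \<longrightarrow> card (E - H) = k)))"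
    unfolding computes_in_time_def
  proof (intro allI impI)
    fix vs es ds assume lists: "list_of vs V" "list_of es E" "list_of ds D"
    let ?s = "input_state vs es ds"
    have "length es = card E" using lists(2) by (auto simp: list_of_def distinct_card)
    then have "?s 0 1 = card E" by (simp add: input_state_def load_def)
    with exec_compile[of max_tr_program ?s "card E"] bounded_max_tr_program obtain t where
      "t \<le> poly (cost max_tr_program) (card E)"
      "exec (compile max_tr_program) ?s t (sem max_tr_program ?s)"
      by blast
    \<comment> \<open>The running time depends on the number of edges only; natural coefficients
      make the polynomial monotone.\<close>
    moreover have "poly (cost max_tr_program) (card E) \<le> poly (cost max_tr_program) (card V + card E)"
      by (rule poly_nat_mono) simp
    ultimately show "\<exists>t s H. exec (compile max_tr_program) ?s t s \<and>
        t \<le> poly (cost max_tr_program) (card V + card E) \<and> list_of (output_edges s) H \<and>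
        transitive_reduction E D H \<and>
        (let k = max_deleted E D in
          (2 \<le> k \<longrightarrow> real (card (E - H)) \<ge> 0.5 * real k + 1) \<and> (k < 2 \<longrightarrow> card (E - H) = k))"
      using sem_max_tr_program[OF VED(2) lists(2,3), of vs] order_trans by blast
  qed
qed

end
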